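(* Suppose that $\lambda\leq\mathfrak{c}$ is the minimal cardinal such that there is a family of $\lambda$ many $e$-separable spaces whose product is not $e$-separable. Then $\lambda\notin\mathcal{M}^*$, and so $\mathcal{L}_{\lambda,\omega}$ is weakly compact.
   Context: All topological spaces are assumed to be $T_1$. A space $X$ is $e$-separable if there is a sequence $(D_n)_{n\in\omega}$ of closed discrete subspaces of $X$ such that $\bigcup_{n\in\omega}D_n$ is dense in $X$. Products carry the Tychonoff product topology, and $\mathfrak{c}=2^{\aleph_0}$. The class $\mathcal{M}^*$ of cardinals (due to Mrówka) is defined by: $\lambda\in\mathcal{M}^*$ iff there is a product $X=\prod\{X_\alpha:\alpha<\lambda\}$ of $\lambda$ many discrete spaces, each of size $<\lambda$, such that $X$ has a closed discrete subset of size $\lambda$. $\mathcal{L}_{\lambda,\omega}$ denotes the infinitary language allowing conjunctions and disjunctions of fewer than $\lambda$ formulas and universal or existential quantification over finitely many variables; it is called weakly compact if every set $\Sigma$ of at most $\lambda$ sentences of $\mathcal{L}_{\lambda,\omega}$ has a model provided every subset of $\Sigma$ of size $<\lambda$ has a model. *)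

theory Defs
  imports "HOL-Analysis.Analysis"
begin

unbundle cardinal_syntax

definition closed_discrete_in :: "'a topology \<Rightarrow> 'a set \<Rightarrow> bool" where
  "closed_discrete_in X D \<longleftrightarrow> closedin X D \<and> subtopology X D = discrete_topology D"

definition e_separable :: "'a topology \<Rightarrow> bool" where
  "e_separable X \<longleftrightarrow>
     (\<exists>D :: nat \<Rightarrow> 'a set. (\<forall>n. closed_discrete_in X (D n)) \<and>
        X closure_of (\<Union>n. D n) = topspace X)"

text \<open>
  A cardinal is represented by a cardinal order \<^term>\<open>k :: 'i rel\<close>, and a family of
  \<open>k\<close> many spaces is indexed by \<^term>\<open>Field k\<close>. The spaces range over all T1 topologies
  whose points are taken from the type \<open>'a\<close>, an arbitrary universe of points: HOL has no
  quantification over all types inside a formula.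
\<close>

definition e_separable_product_fails :: "'a itself \<Rightarrow> 'i rel \<Rightarrow> bool" where
  "e_separable_product_fails (_ :: 'a itself) k \<longleftrightarrow>
     (\<exists>X :: 'i \<Rightarrow> 'a topology.
        (\<forall>i\<in>Field k. t1_space (X i) \<and> e_separable (X i)) \<and>
        \<not> e_separable (product_topology X (Field k)))"

text \<open>
  Every set of size less than \<open>l\<close> has a copy inside \<^term>\<open>Field l\<close>, so discrete
  factors with points in the index type \<open>'i\<close> represent all discrete spaces of size less
  than \<open>l\<close> up to homeomorphism.
\<close>

definition mrowka_star :: "'i rel \<Rightarrow> bool" where
  "mrowka_star l \<longleftrightarrow>
     (\<exists>S :: 'i \<Rightarrow> 'i set. (\<forall>i\<in>Field l. |S i| <o l) \<and>
        (\<exists>D. closed_discrete_in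
               (product_topology (\<lambda>i. discrete_topology (S i)) (Field l)) D \<and>
             |D| =o l))"

datatype ('f, 'v) trm = Var 'v | App 'f "('f, 'v) trm list"

text \<open>
  \<open>Conj I \<phi>\<close> and \<open>Disj I \<phi>\<close> stand for the conjunction and the disjunction of the family
  \<open>(\<phi> i)\<close>, \<open>i \<in> I\<close>; the values of \<open>\<phi>\<close> outside \<open>I\<close> play no role. The type imposes no
  bound on \<open>I\<close>: the bound by \<open>l\<close> is part of \<open>in_lang l\<close> below. The index type
  \<open>'i\<close> also supplies the variables. A symbol may be applied to argument lists of any length,
  each length counting as a separate symbol; so every finitary signature with function
  symbols (constants included) from \<open>'f\<close> and relation symbols from \<open>'p\<close> is covered.
\<close>

datatype ('f, 'p, 'i) fm =
    Eql "('f, 'i) trm" "('f, 'i) trm"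
  | Rel 'p "('f, 'i) trm list"
  | Neg "('f, 'p, 'i) fm"
  | Conj "'i set" "'i \<Rightarrow> ('f, 'p, 'i) fm"
  | Disj "'i set" "'i \<Rightarrow> ('f, 'p, 'i) fm"
  | Forall "'i list" "('f, 'p, 'i) fm"
  | Exists "'i list" "('f, 'p, 'i) fm"

primrec fv_trm :: "('f, 'v) trm \<Rightarrow> 'v set" where
  "fv_trm (Var v) = {v}"
| "fv_trm (App f ts) = \<Union> (set (map fv_trm ts))"

primrec fv :: "('f, 'p, 'i) fm \<Rightarrow> 'i set" where
  "fv (Eql s t) = fv_trm s \<union> fv_trm t"
| "fv (Rel p ts) = (\<Union>t\<in>set ts. fv_trm t)"
| "fv (Neg \<phi>) = fv \<phi>"
| "fv (Conj I \<Phi>) = (\<Union>i\<in>I. fv (\<Phi> i))"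
| "fv (Disj I \<Phi>) = (\<Union>i\<in>I. fv (\<Phi> i))"
| "fv (Forall vs \<phi>) = fv \<phi> - set vs"
| "fv (Exists vs \<phi>) = fv \<phi> - set vs"

primrec in_lang :: "'i rel \<Rightarrow> ('f, 'p, 'i) fm \<Rightarrow> bool" where
  "in_lang l (Eql s t) \<longleftrightarrow> True"
| "in_lang l (Rel p ts) \<longleftrightarrow> True"
| "in_lang l (Neg \<phi>) \<longleftrightarrow> in_lang l \<phi>"
| "in_lang l (Conj I \<Phi>) \<longleftrightarrow> |I| <o l \<and> (\<forall>i\<in>I. in_lang l (\<Phi> i))"
| "in_lang l (Disj I \<Phi>) \<longleftrightarrow> |I| <o l \<and> (\<forall>i\<in>I. in_lang l (\<Phi> i))"
| "in_lang l (Forall vs \<phi>) \<longleftrightarrow> in_lang l \<phi>"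
| "in_lang l (Exists vs \<phi>) \<longleftrightarrow> in_lang l \<phi>"

definition sentences :: "'i rel \<Rightarrow> ('f, 'p, 'i) fm set" where
  "sentences l = {\<phi>. in_lang l \<phi> \<and> fv \<phi> = {}}"

record ('f, 'p, 'u) struct =
  universe :: "'u set"
  fun_interp :: "'f \<Rightarrow> 'u list \<Rightarrow> 'u"
  rel_interp :: "'p \<Rightarrow> 'u list \<Rightarrow> bool"

definition is_struct :: "('f, 'p, 'u) struct \<Rightarrow> bool" where
  "is_struct M \<longleftrightarrow> universe M \<noteq> {} \<and>
     (\<forall>f. \<forall>xs\<in>lists (universe M). fun_interp M f xs \<in> universe M)"

primrec eval_trm :: "('f, 'p, 'u) struct \<Rightarrow> ('v \<Rightarrow> 'u) \<Rightarrow> ('f, 'v) trm \<Rightarrow> 'u" where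
  "eval_trm M e (Var v) = e v"
| "eval_trm M e (App f ts) = fun_interp M f (map (eval_trm M e) ts)"

primrec sat :: "('f, 'p, 'u) struct \<Rightarrow> ('i \<Rightarrow> 'u) \<Rightarrow> ('f, 'p, 'i) fm \<Rightarrow> bool" where
  "sat M e (Eql s t) \<longleftrightarrow> eval_trm M e s = eval_trm M e t"
| "sat M e (Rel p ts) \<longleftrightarrow> rel_interp M p (map (eval_trm M e) ts)"
| "sat M e (Neg \<phi>) \<longleftrightarrow> \<not> sat M e \<phi>"
| "sat M e (Conj I \<Phi>) \<longleftrightarrow> (\<forall>i\<in>I. sat M e (\<Phi> i))"
| "sat M e (Disj I \<Phi>) \<longleftrightarrow> (\<exists>i\<in>I. sat M e (\<Phi> i))"
| "sat M e (Forall vs \<phi>) \<longleftrightarrow>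
     (\<forall>d. (\<forall>v\<in>set vs. d v \<in> universe M) \<and> (\<forall>v. v \<notin> set vs \<longrightarrow> d v = e v) \<longrightarrow> sat M d \<phi>)"
| "sat M e (Exists vs \<phi>) \<longleftrightarrow>
     (\<exists>d. (\<forall>v\<in>set vs. d v \<in> universe M) \<and> (\<forall>v. v \<notin> set vs \<longrightarrow> d v = e v) \<and> sat M d \<phi>)"

definition has_model :: "'u itself \<Rightarrow> ('f, 'p, 'i) fm set \<Rightarrow> bool" where
  "has_model (_ :: 'u itself) \<Sigma> \<longleftrightarrow>
     (\<exists>M :: ('f, 'p, 'u) struct. is_struct M \<and>
        (\<forall>\<phi>\<in>\<Sigma>. \<forall>e. (\<forall>v. e v \<in> universe M) \<longrightarrow> sat M e \<phi>))"

text \<open>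
  Weak compactness for signatures over \<open>'f\<close> and \<open>'p\<close>. The small subsets are allowed to
  have models of any kind, with elements from a type \<open>'u\<close> that is a parameter, while the
  model of the whole set is asked for with elements from \<open>'i\<close>. The latter is no
  restriction: at most \<open>l\<close> sentences have at most \<open>l\<close> subformulas altogether, each with
  finitely many free variables, so for infinite \<open>l\<close> the downward Loewenheim-Skolem
  argument yields a model of size at most \<open>l\<close>, which has a copy on a subset of
  \<^term>\<open>Field l\<close>.
\<close>

definition weakly_compact_lang ::
    "'f itself \<Rightarrow> 'p itself \<Rightarrow> 'u itself \<Rightarrow> 'i rel \<Rightarrow> bool" where
  "weakly_compact_lang (_ :: 'f itself) (_ :: 'p itself) (_ :: 'u itself) l \<longleftrightarrow>
     (\<forall>\<Sigma> :: ('f, 'p, 'i) fm set.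
        \<Sigma> \<subseteq> sentences l \<and> |\<Sigma>| \<le>o l \<and>
        (\<forall>\<Sigma>'. \<Sigma>' \<subseteq> \<Sigma> \<and> |\<Sigma>'| <o l \<longrightarrow> has_model TYPE('u) \<Sigma>')
        \<longrightarrow> has_model TYPE('i) \<Sigma>)"

end

theory Submission
  imports Defs
begin

text \<open>
  Suppose that \<open>l\<close> is in \<open>\<M>\<^sup>*\<close> and that all products of fewer than \<open>l\<close> of the spaces are
  e-separable. If for every infinite \<open>\<mu> < l\<close> there are \<open>l\<close> many factors of density above \<open>\<mu>\<close>, then
  these factors have closed discrete subsets of size at least \<open>\<mu>\<close>, and \<open>l \<in> \<M>\<^sup>*\<close> yields
  closed discrete sets of size \<open>l\<close> in countably many disjoint subproducts. Such a set labels the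
  finite choices of closed discrete sets in the factors, so that the points realising different
  choices are kept apart. Otherwise take the least \<open>\<kappa> < l\<close> for which all but fewer than \<open>l\<close>
  factors have density at most \<open>\<kappa>\<close>. As \<open>l \<le> \<cc>\<close>, the product of these factors has density at
  most \<open>\<kappa>\<close>, and for uncountable \<open>\<kappa>\<close> disjoint subproducts of \<open>\<kappa>\<close> many factors have density at
  least \<open>\<kappa>\<close> and are e-separable by assumption, so again they provide enough labels.

  If \<open>l\<close> is not in \<open>\<M>\<^sup>*\<close>, products of discrete spaces of size less than \<open>l\<close> are compact with
  respect to families of \<open>l\<close> many finitely determined conditions. A model of a theory is encoded
  by the truth values of its subformulas at Skolem terms, where a true disjunction and a false
  conjunction also carry the index of a responsible member; then every requirement on such an
  encoding concerns finitely many coordinates.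
\<close>

section \<open>Cardinals and transfinite choice\<close>

text \<open>The obstacle: points of a dense set can be prescribed on finitely many coordinates and
  take base values elsewhere, but as the finite set of coordinates varies, such points can
  accumulate at the base point. A label in coordinates away from the prescribed ones prevents this:
  a neighbourhood that sees one label sees one finite choice, and finitely many separating
  neighbourhoods then isolate the point. The label occupies coordinates that must not be constrained
  by the open box to be hit. A box constrains only finitely many, so among countably many disjoint
  blocks one is free; this is why every block is built countably often. In general there are
  \<open>l\<close> finite choices, hence the wish for a closed discrete set of size
  \<open>l\<close>. Once the densities are bounded by \<kappa>, the number of labels drops to
  \<kappa>, and blocks of \<kappa> < \<open>l\<close> factors are within reach of minimality. In the
  logical half the stored index is affordable: a conjunction of the language has fewer than
  \<open>l\<close> members, so the index gives a factor with fewer than \<open>l\<close> points,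
  which is the size that Mrowka's class permits.\<close>

lemma card_of_lists_bound:
  assumes "infinite B" "|A| \<le>o |B|"
  shows "|lists A| \<le>o |B|"
proof -
  have step: "|{xs \<in> lists A. length xs = n}| \<le>o |B|" for n
  proof (induction n)
    case 0
    have "{xs \<in> lists A. length xs = 0} = {[]}" by auto
    moreover have "B \<noteq> {}" using assms(1) by auto
    ultimately show ?case by (metis card_of_singl_ordLeq)
  next
    case (Suc n)
    have "{xs \<in> lists A. length xs = Suc n} =
        (\<lambda>(x, xs). x # xs) ` (A \<times> {xs \<in> lists A. length xs = n})"
      by (auto simp: length_Suc_conv)
    moreover have "|A \<times> {xs \<in> lists A. length xs = n}| \<le>o |B|"
      using Suc assms by (intro card_of_Sigma_ordLeq_infinite) auto
    ultimately show ?case using ordLeq_transitive[OF card_of_image] by auto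
  qed
  have "lists A = (\<Union>n\<in>(UNIV::nat set). {xs \<in> lists A. length xs = n})" by auto
  moreover have "|\<Union>n\<in>(UNIV::nat set). {xs \<in> lists A. length xs = n}| \<le>o |B|"
    using assms(1) step by (intro card_of_UNION_ordLeq_infinite) (auto simp: infinite_iff_card_of_nat)
  ultimately show ?thesis by simp
qed

lemma card_of_Fpow_bound:
  assumes "infinite B" "|A| \<le>o |B|"
  shows "|Fpow A| \<le>o |B|"
proof -
  have "Fpow A \<subseteq> set ` lists A"
    unfolding Fpow_def using finite_list by fastforce
  then show ?thesis
    using card_of_lists_bound[OF assms] ordLeq_transitive[OF card_of_mono1 ordLeq_transitive[OF card_of_image]] by blast
qed

lemma card_of_Un_bound:
  assumes "infinite B" "|A| \<le>o |B|" "|A'| \<le>o |B|"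
  shows "|A \<union> A'| \<le>o |B|"
  using assms by (intro card_of_Un_ordLeq_infinite_Field) (auto simp: Field_card_of card_of_card_order_on)

lemma countable_card_of_nat: "countable A \<longleftrightarrow> |A| \<le>o |UNIV :: nat set|"
  by (simp add: countable_def flip: card_of_ordLeq)

lemma card_of_Field_leq:
  assumes "Card_order l" shows "|Field l| \<le>o l" "l \<le>o |Field l|"
  using assms card_of_Field_ordIso ordIso_iff_ordLeq by auto

lemma ordLess_or_ordLeq_card:
  assumes "Card_order l" shows "\<not> |A| <o l \<longleftrightarrow> l \<le>o |A|"
  using assms by (meson card_of_Well_order card_order_on_well_order_on not_ordLess_iff_ordLeq)

text \<open>The order \<open>|E|\<close> is isomorphic to a proper initial segment of the order
  \<open>|K|\<close>. This serves to bound densities from below by \<open>|K|\<close>: it is enough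
  to exceed the size of each initial segment.\<close>

lemma ordLess_initial_segment:
  assumes "|E| <o |K|"
  obtains k where "k \<in> K" "|E| \<le>o |underS |K| k|"
proof -
  obtain k where k: "k \<in> K" and iso: "( |E|, Restr |K| (underS |K| k)) \<in> ordIso"
    using assms ordLess_iff_ordIso_Restr[OF card_of_Well_order card_of_Well_order, of E K]
    by (auto simp: Field_card_of)
  have "|E| \<le>o |Field (Restr |K| (underS |K| k))|"
    using card_of_cong[OF iso] by (simp add: Field_card_of ordIso_iff_ordLeq)
  moreover have "Field (Restr |K| (underS |K| k)) \<subseteq> underS |K| k"
    by (auto simp: Field_def)
  ultimately show ?thesis using k that by (meson card_of_mono1 ordLeq_transitive)
qed

text \<open>Recursion along the cardinal order of \<open>J\<close>: fewer than \<open>|J|\<close>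
  \<le> \<open>l\<close> values are used up before stage \<open>j\<close>, while \<open>B j\<close>
  has at least \<open>l\<close> elements. Taking pairs with a natural number as first component for
  \<open>J\<close> gives countably many disjoint blocks at once.\<close>

lemma inj_on_choice:
  fixes B :: "'j \<Rightarrow> 'i set"
  assumes l: "Card_order l" and J: "|J| \<le>o l" and B: "\<And>j. j \<in> J \<Longrightarrow> l \<le>o |B j|"
  obtains a where "inj_on a J" "\<And>j. j \<in> J \<Longrightarrow> a j \<in> B j"
proof -
  let ?r = "|J|"
  interpret wo_rel ?r by (simp add: wo_rel_def card_of_Well_order)
  define H where "H = (\<lambda>(f :: 'j \<Rightarrow> 'i) j. SOME b. b \<in> B j - f ` underS j)"
  define a where "a = worec H"
  have adm: "adm_wo H"
    unfolding adm_wo_def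
  proof (intro allI impI)
    fix f g :: "'j \<Rightarrow> 'i" and x
    assume "\<forall>y\<in>underS x. f y = g y"
    then have "f ` underS x = g ` underS x" by (intro image_cong refl) (rule bspec)
    then show "H f x = H g x" unfolding H_def by (rule arg_cong[where f = "\<lambda>S. SOME b. b \<in> B x - S"])
  qed
  have fp: "a = H a"
    unfolding a_def by (rule worec_fixpoint[OF adm])
  have eq: "a j = (SOME b. b \<in> B j - a ` underS j)" for j
    using fun_cong[OF fp, of j] by (simp only: H_def)
  have a: "a j \<in> B j - a ` underS j" if j: "j \<in> J" for j
  proof -
    have "|underS j| <o ?r"
      using card_of_underS[of ?r j] j by (simp add: card_of_card_order_on Field_card_of)
    then have "|underS j| <o |B j|"
      using ordLeq_transitive[OF J B[OF j]] by (rule ordLess_ordLeq_trans)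
    with card_of_image have "|a ` underS j| <o |B j|"
      by (rule ordLeq_ordLess_trans)
    then have "\<not> B j \<subseteq> a ` underS j"
      using card_of_mono1[of "B j" "a ` underS j"] by (auto dest: not_ordLess_ordLeq)
    then have "\<exists>b. b \<in> B j - a ` underS j" by blast
    then show ?thesis unfolding eq[of j] by (rule someI_ex)
  qed
  have "inj_on a J"
  proof (rule inj_onI, rule ccontr)
    fix i j assume ij: "i \<in> J" "j \<in> J" "a i = a j" "i \<noteq> j"
    then have "i \<in> underS j \<or> j \<in> underS i"
      using TOTALS unfolding underS_def by (auto simp: Field_card_of)
    then have "a i \<in> a ` underS j \<or> a j \<in> a ` underS i" by blast
    then show False using a[OF ij(1)] a[OF ij(2)] ij(3) by auto
  qed
  with a that show ?thesis by blast
qed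

section \<open>Closed discrete sets and e-separable products\<close>

text \<open>The working form of closed discreteness: locally at most one point. If the one point
  \<open>a\<close> of \<open>D\<close> in a neighbourhood of \<open>y\<close> differs from
  \<open>y\<close>, then it can be deleted, because singletons are closed in a T1 space.\<close>

lemma closed_discrete_in_iff:
  assumes "t1_space X"
  shows "closed_discrete_in X D \<longleftrightarrow> D \<subseteq> topspace X \<and>
    (\<forall>y\<in>topspace X. \<exists>U. openin X U \<and> y \<in> U \<and> (\<forall>a\<in>D \<inter> U. \<forall>b\<in>D \<inter> U. a = b))"
    (is "?L \<longleftrightarrow> ?R")
proof
  assume L: ?L
  then have cl: "closedin X D" and sub: "D \<subseteq> topspace X" and disc: "subtopology X D = discrete_topology D"
    by (auto simp: closed_discrete_in_def closedin_def)
  have "\<exists>U. openin X U \<and> y \<in> U \<and> (\<forall>a\<in>D \<inter> U. \<forall>b\<in>D \<inter> U. a = b)" if y: "y \<in> topspace X" for y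
  proof (cases "y \<in> D")
    case True
    then have "openin (subtopology X D) {y}" by (simp add: disc)
    then obtain U where "openin X U" "{y} = U \<inter> D" by (auto simp: openin_subtopology)
    then have "y \<in> U" and "\<And>a. a \<in> D \<inter> U \<Longrightarrow> a = y" by auto
    then show ?thesis using \<open>openin X U\<close> by blast
  next
    case False
    then show ?thesis using cl y by (intro exI[of _ "topspace X - D"]) auto
  qed
  with sub show ?R by blast
next
  assume R: ?R
  have op: "openin X (U - {a})" if "openin X U" for U a
  proof (cases "a \<in> topspace X")
    case True
    then have "closedin X {a}" using assms by (simp add: t1_space_closedin_singleton)
    then show ?thesis using that by (simp add: openin_diff)
  next
    case False
    then have "U - {a} = U" using openin_subset[OF that] by auto
    then show ?thesis using that by simp
  qed
  have "\<exists>V. openin X V \<and> y \<in> V \<and> V \<inter> D \<subseteq> {y}" if y: "y \<in> topspace X" for y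
  proof -
    obtain U where U: "openin X U" "y \<in> U" "\<forall>a\<in>D \<inter> U. \<forall>b\<in>D \<inter> U. a = b"
      using bspec[OF conjunct2[OF R] y] by (elim exE conjE)
    show ?thesis
    proof (cases "\<exists>a\<in>D \<inter> U. a \<noteq> y")
      case True
      then obtain a where a: "a \<in> D \<inter> U" "a \<noteq> y" by blast
      then have "D \<inter> U \<subseteq> {a}" using U(3) by blast
      then show ?thesis using op[OF U(1), of a] U a by (intro exI[of _ "U - {a}"]) auto
    next
      case False
      then show ?thesis using U by (intro exI[of _ U]) auto
    qed
  qed
  then obtain V where V: "\<And>y. y \<in> topspace X \<Longrightarrow> openin X (V y) \<and> y \<in> V y \<and> V y \<inter> D \<subseteq> {y}"
    by metis
  have "openin X (topspace X - D)"
    by (subst openin_subopen) (use V openin_subset in fastforce)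
  then have "closedin X D" using R by (simp add: closedin_def)
  moreover have "openin (subtopology X D) {x}" if "x \<in> D" for x
  proof -
    have "{x} = V x \<inter> D" using V[of x] that R by blast
    then show ?thesis using V[of x] that R by (auto simp: openin_subtopology)
  qed
  then have "discrete_topology D = subtopology X D"
    using R by (subst discrete_topology_unique) (auto simp: topspace_subtopology)
  ultimately show ?L by (simp add: closed_discrete_in_def)
qed

lemma closed_discrete_in_nbhd:
  assumes "t1_space X" "closed_discrete_in X D" "y \<in> topspace X"
  obtains U where "openin X U" "y \<in> U" "\<forall>a b. a \<in> D \<longrightarrow> a \<in> U \<longrightarrow> b \<in> D \<longrightarrow> b \<in> U \<longrightarrow> a = b"
proof -
  have "\<exists>U. openin X U \<and> y \<in> U \<and> (\<forall>a\<in>D \<inter> U. \<forall>b\<in>D \<inter> U. a = b)"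
    using assms closed_discrete_in_iff[OF assms(1)] by simp
  then obtain U where U: "openin X U" "y \<in> U" "\<forall>a\<in>D \<inter> U. \<forall>b\<in>D \<inter> U. a = b"
    by (elim exE conjE)
  show ?thesis by (rule that[OF U(1,2)]) (use U(3) in blast)
qed

lemma closed_discrete_inI:
  assumes "t1_space X" "D \<subseteq> topspace X"
    and "\<And>y. y \<in> topspace X \<Longrightarrow>
      \<exists>U. openin X U \<and> y \<in> U \<and> (\<forall>a b. a \<in> D \<and> a \<in> U \<longrightarrow> b \<in> D \<and> b \<in> U \<longrightarrow> a = b)"
  shows "closed_discrete_in X D"
  using assms by (simp add: closed_discrete_in_iff Ball_def)

lemma closed_discrete_in_subset:
  assumes "closed_discrete_in X D" "E \<subseteq> D"
  shows "closed_discrete_in X E"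
proof -
  have "closedin (subtopology X D) E"
    using assms by (simp add: closed_discrete_in_def)
  then have "closedin X E"
    using assms(1) closedin_trans_full unfolding closed_discrete_in_def by blast
  moreover have "subtopology X E = subtopology (subtopology X D) E"
    using assms(2) by (simp add: subtopology_subtopology Int_absorb1)
  then have "subtopology X E = discrete_topology E"
    using assms by (simp add: closed_discrete_in_def subtopology_discrete_topology Int_absorb1)
  ultimately show ?thesis by (simp add: closed_discrete_in_def)
qed

lemma closed_discrete_in_subset_topspace: "closed_discrete_in X D \<Longrightarrow> D \<subseteq> topspace X"
  by (simp add: closed_discrete_in_def closedin_subset)

lemma e_separable_countableI:
  assumes "countable \<D>" "\<And>D. D \<in> \<D> \<Longrightarrow> closed_discrete_in X D" "X closure_of \<Union>\<D> = topspace X"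
  shows "e_separable X"
proof -
  \<comment> \<open>The empty set is added because an empty family has no enumeration by a
    sequence.\<close>
  have emp: "closed_discrete_in X {}"
    by (simp add: closed_discrete_in_def discrete_topology_unique[symmetric] flip: null_topspace_iff_trivial)
  define D where "D = from_nat_into (insert {} \<D>)"
  have r: "range D = insert {} \<D>"
    unfolding D_def using assms(1) by (intro range_from_nat_into) auto
  then have "closed_discrete_in X (D n)" for n
    using assms(2) emp by (metis insert_iff rangeI)
  moreover have "(\<Union>n. D n) = \<Union>\<D>" using r by auto
  ultimately show ?thesis using assms(3) unfolding e_separable_def by metis
qed

section \<open>Boxes, dense sets and e-separability of products\<close>

lemma dense_in_productI:
  assumes "\<And>K U. \<lbrakk>topspace (product_topology X I) \<noteq> {}; finite K; K \<subseteq> I; \<And>i. i \<in> K \<Longrightarrow> openin (X i) (U i) \<and> U i \<noteq> {}\<rbrakk>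
     \<Longrightarrow> \<exists>x\<in>E. x \<in> topspace (product_topology X I) \<and> (\<forall>i\<in>K. x i \<in> U i)"
  shows "product_topology X I closure_of E = topspace (product_topology X I)"
  unfolding dense_intersects_open
proof (intro allI impI)
  fix T assume T: "openin (product_topology X I) T \<and> T \<noteq> {}"
  then obtain x where "x \<in> T" by blast
  with T obtain U where U: "finite {i \<in> I. U i \<noteq> topspace (X i)}" "\<forall>i\<in>I. openin (X i) (U i)"
     "x \<in> Pi\<^sub>E I U" "Pi\<^sub>E I U \<subseteq> T"
    unfolding openin_product_topology_alt by blast
  have "\<exists>y\<in>E. y \<in> topspace (product_topology X I) \<and> (\<forall>i\<in>{i \<in> I. U i \<noteq> topspace (X i)}. y i \<in> U i)"
    using U T \<open>x \<in> T\<close> openin_subset[of _ T] by (intro assms) (fastforce simp: PiE_iff)+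
  then obtain y where y: "y \<in> E" "y \<in> topspace (product_topology X I)"
     "\<forall>i\<in>{i \<in> I. U i \<noteq> topspace (X i)}. y i \<in> U i" by blast
  have "y \<in> Pi\<^sub>E I U" using y(2,3) by (auto simp: PiE_iff)
  with y U show "E \<inter> T \<noteq> {}" by blast
qed

lemma dense_hits_open:
  assumes "X closure_of E = topspace X" "openin X U" "U \<noteq> {}"
  obtains x where "x \<in> E" "x \<in> U"
  using assms unfolding dense_intersects_open by blast

lemma openin_box:
  assumes "finite K" "K \<subseteq> I" "\<And>i. i \<in> K \<Longrightarrow> openin (X i) (U i)"
  shows "openin (product_topology X I) {x \<in> topspace (product_topology X I). \<forall>i\<in>K. x i \<in> U i}"
proof -
  have "{x \<in> topspace (product_topology X I). \<forall>i\<in>K. x i \<in> U i} =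
    Pi\<^sub>E I (\<lambda>i. if i \<in> K then U i else topspace (X i))"
    using assms(2) openin_subset[OF assms(3)]
    by (auto simp: PiE_iff subset_iff extensional_def split: if_splits)
  moreover have "openin (product_topology X I) \<dots>"
    unfolding openin_PiE_gen using assms by (intro disjI2) (auto intro: rev_finite_subset)
  ultimately show ?thesis by simp
qed

lemma openin_restrict_preimage:
  assumes "A \<subseteq> I" "openin (product_topology X A) V"
  shows "openin (product_topology X I) {x \<in> topspace (product_topology X I). restrict x A \<in> V}"
proof -
  have "continuous_map (product_topology X I) (product_topology X A) (\<lambda>x. restrict x A)"
    using assms(1) by (auto simp: continuous_map_componentwise intro: continuous_map_product_projection)
  then show ?thesis using assms(2) openin_continuous_map_preimage by blast
qed

lemma t1_space_product:
  assumes "\<And>i. i \<in> I \<Longrightarrow> t1_space (X i)" shows "t1_space (product_topology X I)"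
  using assms by (simp add: t1_space_product_topology)

text \<open>A code \<open>g\<close> describes a finite choice: closed discrete sets
  \<open>D g i\<close> at the coordinates in \<open>F g\<close> and the base point
  \<open>b g\<close> elsewhere. On the block \<open>A m\<close> a point carries the label
  \<open>e m g\<close> instead. The labels in one level \<open>E m n\<close> are closed discrete, so
  near a given point only one code is in play, and then only the finitely many coordinates in
  \<open>F g\<close> can still vary. Density uses all blocks: a finite \<open>K\<close> misses one
  of them, and the label put there does not disturb the box.\<close>

lemma e_separable_productI:
  fixes X :: "'i \<Rightarrow> 'a topology" and A :: "nat \<Rightarrow> 'i set"
    and e :: "nat \<Rightarrow> 'g \<Rightarrow> 'i \<Rightarrow> 'a" and E :: "nat \<Rightarrow> nat \<Rightarrow> ('i \<Rightarrow> 'a) set"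
    and F :: "'g \<Rightarrow> 'i set" and D :: "'g \<Rightarrow> 'i \<Rightarrow> 'a set" and b :: "'g \<Rightarrow> 'i \<Rightarrow> 'a"
  assumes t1: "\<And>i. i \<in> I \<Longrightarrow> t1_space (X i)"
    and A: "\<And>m. A m \<subseteq> I" "\<And>m n. m \<noteq> n \<Longrightarrow> A m \<inter> A n = {}"
    and E: "\<And>m n. closed_discrete_in (product_topology X (A m)) (E m n)"
    and e: "\<And>m. inj_on (e m) G" "\<And>m g. g \<in> G \<Longrightarrow> e m g \<in> (\<Union>n. E m n)"
    and F: "\<And>g. g \<in> G \<Longrightarrow> finite (F g) \<and> F g \<subseteq> I"
    and D: "\<And>g i. g \<in> G \<Longrightarrow> i \<in> F g \<Longrightarrow> closed_discrete_in (X i) (D g i)"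
    and b: "\<And>g i. g \<in> G \<Longrightarrow> i \<in> I \<Longrightarrow> b g i \<in> topspace (X i)"
    and hit: "\<And>K U. \<lbrakk>finite K; K \<subseteq> I; \<And>i. i \<in> K \<Longrightarrow> openin (X i) (U i) \<and> U i \<noteq> {}\<rbrakk>
       \<Longrightarrow> \<exists>g\<in>G. F g \<subseteq> K \<and> (\<forall>i\<in>K. if i \<in> F g then D g i \<inter> U i \<noteq> {} else b g i \<in> U i)"
  shows "e_separable (product_topology X I)"
proof -
  let ?P = "product_topology X I"
  \<comment> \<open>The condition \<open>F g \<inter> A m = {}\<close> keeps the label from
    colliding with the choice; \<open>n\<close> is fixed so that all labels involved come from one
    closed discrete set.\<close>
  define Q where "Q m n = {x \<in> topspace ?P. \<exists>g\<in>G. F g \<inter> A m = {} \<and> e m g \<in> E m n \<and>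
      restrict x (A m) = e m g \<and> (\<forall>i\<in>F g. x i \<in> D g i) \<and> (\<forall>i\<in>I - A m - F g. x i = b g i)}"
    for m n
  have t1P: "t1_space ?P" using t1 by (rule t1_space_product)
  have t1A: "t1_space (product_topology X (A m))" for m
    using t1 A(1) by (intro t1_space_product) blast
  have "closed_discrete_in ?P (Q m n)" for m n
  proof (rule closed_discrete_inI[OF t1P])
    show "Q m n \<subseteq> topspace ?P" unfolding Q_def by blast
    fix y assume y: "y \<in> topspace ?P"
    have "restrict y (A m) \<in> topspace (product_topology X (A m))"
      using y A(1)[of m] by (auto simp: PiE_iff subset_iff)
    then obtain V where V: "openin (product_topology X (A m)) V" "restrict y (A m) \<in> V"
        "\<forall>a b. a \<in> E m n \<longrightarrow> a \<in> V \<longrightarrow> b \<in> E m n \<longrightarrow> b \<in> V \<longrightarrow> a = b"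
      by (rule closed_discrete_in_nbhd[OF t1A E[of m n]])
    define W where "W = {x \<in> topspace ?P. restrict x (A m) \<in> V}"
    have W: "openin ?P W" "y \<in> W"
      unfolding W_def using openin_restrict_preimage[OF A(1) V(1)] V(2) y by auto
    show "\<exists>U. openin ?P U \<and> y \<in> U \<and> (\<forall>a b. a \<in> Q m n \<and> a \<in> U \<longrightarrow> b \<in> Q m n \<and> b \<in> U \<longrightarrow> a = b)"
    proof (cases "\<exists>g\<in>G. e m g \<in> E m n \<inter> V")
      case False
      then have "Q m n \<inter> W = {}" unfolding Q_def W_def by auto
      then show ?thesis using W by blast
    next
      case True
      then obtain g where g: "g \<in> G" "e m g \<in> E m n \<inter> V" by blast
      have uniq: "g' = g" if "g' \<in> G" "e m g' \<in> E m n \<inter> V" for g'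
        using V(3)[rule_format, of "e m g'" "e m g"] e(1)[of m] g that by (auto dest: inj_onD)
      have "\<exists>U. openin (X i) U \<and> y i \<in> U \<and> (\<forall>a\<in>D g i \<inter> U. \<forall>b\<in>D g i \<inter> U. a = b)" if "i \<in> F g" for i
      proof -
        have "i \<in> I" using F[OF g(1)] that by blast
        then have "y i \<in> topspace (X i)" using y by auto
        then show ?thesis
          using D[OF g(1) that] closed_discrete_in_iff[OF t1[OF \<open>i \<in> I\<close>], of "D g i"] by simp
      qed
      then obtain U where U: "\<And>i. i \<in> F g \<Longrightarrow> openin (X i) (U i) \<and> y i \<in> U i \<and>
          (\<forall>a\<in>D g i \<inter> U i. \<forall>b\<in>D g i \<inter> U i. a = b)" by metis
      define N where "N = W \<inter> {x \<in> topspace ?P. \<forall>i\<in>F g. x i \<in> U i}"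
      have "openin ?P N"
        unfolding N_def using F[OF g(1)] U W(1) by (intro openin_Int openin_box) auto
      moreover have "y \<in> N" unfolding N_def using W(2) y U by auto
      moreover have "x = z" if x: "x \<in> Q m n \<inter> N" and z: "z \<in> Q m n \<inter> N" for x z
      proof -
        have char: "restrict w (A m) = e m g \<and> (\<forall>i\<in>F g. w i \<in> D g i \<inter> U i) \<and>
            (\<forall>i\<in>I - A m - F g. w i = b g i) \<and> w \<in> extensional I" if w: "w \<in> Q m n \<inter> N" for w
        proof -
          obtain g' where g': "g' \<in> G" "e m g' \<in> E m n" "restrict w (A m) = e m g'"
              "\<forall>i\<in>F g'. w i \<in> D g' i" "\<forall>i\<in>I - A m - F g'. w i = b g' i"
            using w unfolding Q_def by blast
          have "g' = g" using uniq[of g'] g' w unfolding N_def W_def by auto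
          then show ?thesis using g' w unfolding N_def W_def by (auto simp: PiE_iff)
        qed
        have "x i = z i" if i: "i \<in> I" for i
        proof -
          consider "i \<in> A m" | "i \<in> F g" | "i \<in> I - A m - F g" using i by blast
          then show ?thesis
          proof cases
            case 1 then show ?thesis using char[OF x] char[OF z] by (metis restrict_apply')
          next
            case 2 then show ?thesis using char[OF x] char[OF z] U[OF 2] by blast
          next
            case 3 then show ?thesis using char[OF x] char[OF z] by auto
          qed
        qed
        then show ?thesis using char[OF x] char[OF z] by (intro extensionalityI[of x I z]) auto
      qed
      ultimately show ?thesis by blast
    qed
  qed
  moreover have "?P closure_of \<Union>(range (\<lambda>(m, n). Q m n)) = topspace ?P"
  proof (rule dense_in_productI)
    fix K U assume K: "finite K" "K \<subseteq> I" "\<And>i. i \<in> K \<Longrightarrow> openin (X i) (U i) \<and> U i \<noteq> {}"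
    obtain g where g: "g \<in> G" "F g \<subseteq> K" "\<forall>i\<in>K. if i \<in> F g then D g i \<inter> U i \<noteq> {} else b g i \<in> U i"
      using hit[OF K] by blast
    have "\<exists>m. A m \<inter> K = {}"
    proof (rule ccontr)
      assume "\<nexists>m. A m \<inter> K = {}"
      then have "\<exists>f. \<forall>m. f m \<in> A m \<inter> K" by (intro choice) blast
      then obtain f where f: "\<And>m. f m \<in> A m \<inter> K" by blast
      have "inj f" using f A(2) by (intro injI) (metis Int_iff empty_iff)
      moreover have "range f \<subseteq> K" using f by blast
      ultimately show False using K(1) finite_subset range_inj_infinite by blast
    qed
    then obtain m where m: "A m \<inter> K = {}" ..
    obtain n where n: "e m g \<in> E m n" using e(2)[OF g(1)] by blast
    have "\<exists>d. \<forall>i\<in>F g. d i \<in> D g i \<inter> U i"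
      using g(2,3) by (intro bchoice) (metis ex_in_conv subsetD)
    then obtain d where d: "\<And>i. i \<in> F g \<Longrightarrow> d i \<in> D g i \<inter> U i" by blast
    define x where "x = restrict (\<lambda>i. if i \<in> A m then e m g i else if i \<in> F g then d i else b g i) I"
    have em: "e m g \<in> topspace (product_topology X (A m))"
      using closed_discrete_in_subset_topspace[OF E] n by blast
    have x: "x \<in> topspace ?P"
    proof -
      have "x i \<in> topspace (X i)" if i: "i \<in> I" for i
        using em d[of i] b[OF g(1) i] i closed_discrete_in_subset_topspace[OF D[OF g(1)], of i]
        unfolding x_def by (auto simp: PiE_iff)
      then show ?thesis unfolding x_def by (auto simp: PiE_iff)
    qed
    have "restrict x (A m) = e m g"
      using em A(1)[of m] unfolding x_def by (auto simp: fun_eq_iff PiE_iff extensional_def)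
    moreover have "F g \<inter> A m = {}" using m g(2) by blast
    ultimately have "x \<in> Q m n"
      unfolding Q_def using x g n d F[OF g(1)] by (auto simp: x_def)
    moreover have "\<forall>i\<in>K. x i \<in> U i"
      using g(3) d m K(2) unfolding x_def by (auto split: if_splits)
    ultimately show "\<exists>x\<in>\<Union>(range (\<lambda>(m, n). Q m n)). x \<in> topspace ?P \<and> (\<forall>i\<in>K. x i \<in> U i)"
      using x by blast
  qed
  ultimately show ?thesis
    by (intro e_separable_countableI[of "range (\<lambda>(m, n). Q m n)"]) auto
qed

text \<open>For finitely many factors the box of the separating neighbourhoods is open, and there
  are only countably many ways \<open>f\<close> to pick a level in each factor. This is what makes a
  minimal failure infinite.\<close>

lemma e_separable_product_finite:
  assumes "finite I" and t1: "\<And>i. i \<in> I \<Longrightarrow> t1_space (X i)" and es: "\<And>i. i \<in> I \<Longrightarrow> e_separable (X i)"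
  shows "e_separable (product_topology X I)"
proof -
  let ?P = "product_topology X I"
  obtain D :: "_ \<Rightarrow> nat \<Rightarrow> _" where D: "\<And>i n. i \<in> I \<Longrightarrow> closed_discrete_in (X i) (D i n)"
      "\<And>i. i \<in> I \<Longrightarrow> X i closure_of (\<Union>n. D i n) = topspace (X i)"
    using es unfolding e_separable_def by metis
  define Q where "Q f = Pi\<^sub>E I (\<lambda>i. D i (f i))" for f
  have t1P: "t1_space ?P" using t1 by (rule t1_space_product)
  have "closed_discrete_in ?P (Q f)" for f
  proof (rule closed_discrete_inI[OF t1P])
    show "Q f \<subseteq> topspace ?P"
      unfolding Q_def topspace_product_topology using closed_discrete_in_subset_topspace[OF D(1)] by (intro PiE_mono) auto
    fix y assume y: "y \<in> topspace ?P"
    have "\<exists>U. openin (X i) U \<and> y i \<in> U \<and> (\<forall>a\<in>D i (f i) \<inter> U. \<forall>b\<in>D i (f i) \<inter> U. a = b)" if "i \<in> I" for i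
      using D(1)[OF that, of "f i"] y that closed_discrete_in_iff[OF t1[OF that], of "D i (f i)"]
      by (simp add: PiE_iff)
    then obtain U where U: "\<And>i. i \<in> I \<Longrightarrow> openin (X i) (U i) \<and> y i \<in> U i \<and>
        (\<forall>a\<in>D i (f i) \<inter> U i. \<forall>b\<in>D i (f i) \<inter> U i. a = b)" by metis
    let ?N = "{x \<in> topspace ?P. \<forall>i\<in>I. x i \<in> U i}"
    have "openin ?P ?N" using U assms(1) by (intro openin_box) auto
    moreover have "a = b" if "a \<in> Q f \<inter> ?N" "b \<in> Q f \<inter> ?N" for a b
    proof (rule extensionalityI[of a I b])
      fix i assume "i \<in> I"
      with that U[OF this] show "a i = b i" unfolding Q_def by (auto simp: PiE_iff)
    qed (use that in \<open>auto simp: PiE_iff\<close>)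
    ultimately show "\<exists>U. openin ?P U \<and> y \<in> U \<and> (\<forall>a b. a \<in> Q f \<and> a \<in> U \<longrightarrow> b \<in> Q f \<and> b \<in> U \<longrightarrow> a = b)"
      using y U by (intro exI[of _ ?N]) blast
  qed
  moreover have "?P closure_of \<Union>(Q ` (I \<rightarrow>\<^sub>E UNIV)) = topspace ?P"
  proof -
    have "\<Union>(Q ` (I \<rightarrow>\<^sub>E UNIV)) = Pi\<^sub>E I (\<lambda>i. \<Union>n. D i n)"
    proof (intro equalityI subsetI)
      fix x assume x: "x \<in> Pi\<^sub>E I (\<lambda>i. \<Union>n. D i n)"
      then have "\<exists>f. \<forall>i\<in>I. x i \<in> D i (f i)" by (intro bchoice) auto
      then obtain f where "\<forall>i\<in>I. x i \<in> D i (f i)" by blast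
      then have "x \<in> Q (restrict f I)" using x unfolding Q_def by (auto simp: PiE_iff)
      then show "x \<in> \<Union>(Q ` (I \<rightarrow>\<^sub>E UNIV))" by (intro UN_I[of "restrict f I"]) auto
    qed (auto simp: Q_def PiE_iff)
    moreover have "?P closure_of (Pi\<^sub>E I (\<lambda>i. \<Union>n. D i n)) = topspace ?P"
      unfolding closure_of_product_topology topspace_product_topology by (intro PiE_cong) (simp add: D(2))
    ultimately show ?thesis by simp
  qed
  moreover have "countable (Q ` (I \<rightarrow>\<^sub>E UNIV))"
    using assms(1) by (intro countable_image countable_PiE) auto
  ultimately show ?thesis by (intro e_separable_countableI) auto
qed

text \<open>Serves to rejoin the fewer than \<open>l\<close> exceptional factors with the others.
  Points are sorted by the levels of their two restrictions, and each restriction is isolated in its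
  own subproduct.\<close>

lemma e_separable_product_Un:
  assumes t1: "\<And>i. i \<in> A \<union> B \<Longrightarrow> t1_space (X i)" and AB: "A \<inter> B = {}"
    and A: "e_separable (product_topology X A)" and B: "e_separable (product_topology X B)"
  shows "e_separable (product_topology X (A \<union> B))"
proof -
  let ?P = "product_topology X (A \<union> B)"
  obtain D :: "nat \<Rightarrow> _" where D: "\<And>n. closed_discrete_in (product_topology X A) (D n)"
      "product_topology X A closure_of (\<Union>n. D n) = topspace (product_topology X A)"
    using A unfolding e_separable_def by metis
  obtain E :: "nat \<Rightarrow> _" where E: "\<And>n. closed_discrete_in (product_topology X B) (E n)"
      "product_topology X B closure_of (\<Union>n. E n) = topspace (product_topology X B)"
    using B unfolding e_separable_def by metis
  define Q where "Q m n = {x \<in> topspace ?P. restrict x A \<in> D m \<and> restrict x B \<in> E n}" for m n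
  have t1': "t1_space ?P" "t1_space (product_topology X A)" "t1_space (product_topology X B)"
    using t1 by (auto intro!: t1_space_product)
  have "closed_discrete_in ?P (Q m n)" for m n
  proof (rule closed_discrete_inI[OF t1'(1)])
    show "Q m n \<subseteq> topspace ?P" unfolding Q_def by blast
    fix y assume y: "y \<in> topspace ?P"
    have yr: "restrict y A \<in> topspace (product_topology X A)" "restrict y B \<in> topspace (product_topology X B)"
      using y by (auto simp: PiE_iff)
    obtain U where U: "openin (product_topology X A) U" "restrict y A \<in> U"
        "\<forall>a b. a \<in> D m \<longrightarrow> a \<in> U \<longrightarrow> b \<in> D m \<longrightarrow> b \<in> U \<longrightarrow> a = b"
      by (rule closed_discrete_in_nbhd[OF t1'(2) D(1)[of m] yr(1)])
    obtain V where V: "openin (product_topology X B) V" "restrict y B \<in> V"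
        "\<forall>a b. a \<in> E n \<longrightarrow> a \<in> V \<longrightarrow> b \<in> E n \<longrightarrow> b \<in> V \<longrightarrow> a = b"
      by (rule closed_discrete_in_nbhd[OF t1'(3) E(1)[of n] yr(2)])
    let ?N = "{x \<in> topspace ?P. restrict x A \<in> U} \<inter> {x \<in> topspace ?P. restrict x B \<in> V}"
    have "openin ?P ?N"
      by (intro openin_Int openin_restrict_preimage U V) auto
    moreover have "y \<in> ?N" using y U V by simp
    moreover have "a = b" if a: "a \<in> Q m n \<inter> ?N" and b: "b \<in> Q m n \<inter> ?N" for a b
    proof (rule extensionalityI[of a "A \<union> B" b])
      have eq: "restrict a A = restrict b A" "restrict a B = restrict b B"
        using a b U(3) V(3) unfolding Q_def by auto
      fix i assume "i \<in> A \<union> B"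
      then show "a i = b i"
        using fun_cong[OF eq(1), of i] fun_cong[OF eq(2), of i] by (auto split: if_splits)
    qed (use a b in \<open>auto simp: PiE_iff\<close>)
    ultimately show "\<exists>U. openin ?P U \<and> y \<in> U \<and> (\<forall>a b. a \<in> Q m n \<and> a \<in> U \<longrightarrow> b \<in> Q m n \<and> b \<in> U \<longrightarrow> a = b)"
      by blast
  qed
  moreover have "?P closure_of \<Union>(range (\<lambda>(m, n). Q m n)) = topspace ?P"
  proof (rule dense_in_productI)
    fix K U assume ne: "topspace ?P \<noteq> {}" and K: "finite K" "K \<subseteq> A \<union> B"
      "\<And>i. i \<in> K \<Longrightarrow> openin (X i) (U i) \<and> U i \<noteq> {}"
    obtain z where z: "z \<in> topspace ?P" using ne by blast
    have "\<forall>i\<in>K. \<exists>u. u \<in> U i" using K(3) by blast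
    then obtain u where u: "\<And>i. i \<in> K \<Longrightarrow> u i \<in> U i" by metis
    have ut: "u i \<in> topspace (X i)" if "i \<in> K" for i
      using K(3)[OF that] u[OF that] openin_subset by blast
    have box: "{x \<in> topspace (product_topology X C). \<forall>i\<in>K \<inter> C. x i \<in> U i} \<noteq> {}" if C: "C \<subseteq> A \<union> B" for C
    proof -
      let ?v = "restrict (\<lambda>i. if i \<in> K then u i else z i) C"
      have "?v \<in> topspace (product_topology X C)"
        using z ut C by (auto simp: PiE_iff)
      moreover have "\<forall>i\<in>K \<inter> C. ?v i \<in> U i" using u by simp
      ultimately show ?thesis by (intro notI) (simp only: set_eq_iff mem_Collect_eq empty_iff, metis)
    qed
    have op: "openin (product_topology X C) {x \<in> topspace (product_topology X C). \<forall>i\<in>K \<inter> C. x i \<in> U i}" for C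
      using K by (intro openin_box) auto
    obtain x where x: "x \<in> (\<Union>n. D n)" "x \<in> {x \<in> topspace (product_topology X A). \<forall>i\<in>K \<inter> A. x i \<in> U i}"
      by (rule dense_hits_open[OF D(2) op box]) auto
    obtain y where y: "y \<in> (\<Union>n. E n)" "y \<in> {x \<in> topspace (product_topology X B). \<forall>i\<in>K \<inter> B. x i \<in> U i}"
      by (rule dense_hits_open[OF E(2) op box]) auto
    define w where "w i = (if i \<in> A then x i else y i)" for i
    have w: "restrict w A = x" "restrict w B = y" "w \<in> topspace ?P"
      using x(2) y(2) AB unfolding w_def by (auto simp: PiE_iff extensional_def fun_eq_iff)
    then have "w \<in> \<Union>(range (\<lambda>(m, n). Q m n))"
      using x(1) y(1) unfolding Q_def by auto
    moreover have "\<forall>i\<in>K. w i \<in> U i"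
      using x(2) y(2) K(2) unfolding w_def by auto
    ultimately show "\<exists>x\<in>\<Union>(range (\<lambda>(m, n). Q m n)). x \<in> topspace ?P \<and> (\<forall>i\<in>K. x i \<in> U i)"
      using w(3) by blast
  qed
  ultimately show ?thesis
    by (intro e_separable_countableI[of "range (\<lambda>(m, n). Q m n)"]) auto
qed

text \<open>The maps \<open>g j\<close> embed the product of the discrete \<open>S j\<close> as a
  closed subspace. A point off that subspace is separated from all of it by a single coordinate. A
  point on it comes from some \<open>s0\<close>, and neighbourhoods isolating
  \<open>g j (s0 j)\<close> on finitely many coordinates force \<open>s\<close> into a given basic
  neighbourhood of \<open>s0\<close>.\<close>

lemma closed_discrete_in_product_embedding:
  fixes X :: "'i \<Rightarrow> 'a topology" and S :: "'j \<Rightarrow> 's set" and a :: "'j \<Rightarrow> 'i"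
  assumes D: "closed_discrete_in (product_topology (\<lambda>j. discrete_topology (S j)) J) D"
    and a: "inj_on a J"
    and t1: "\<And>j. j \<in> J \<Longrightarrow> t1_space (X (a j))"
    and g: "\<And>j. j \<in> J \<Longrightarrow> inj_on (g j) (S j)"
      "\<And>j. j \<in> J \<Longrightarrow> closed_discrete_in (X (a j)) (g j ` S j)"
  obtains H where "inj_on H D" "closed_discrete_in (product_topology X (a ` J)) (H ` D)"
proof -
  let ?P = "product_topology X (a ` J)"
  let ?Q = "product_topology (\<lambda>j. discrete_topology (S j)) J"
  define H where "H s = restrict (\<lambda>i. g (inv_into J a i) (s (inv_into J a i))) (a ` J)" for s
  have H: "H s (a j) = g j (s j)" if "j \<in> J" for s j
    using that a by (simp add: H_def)
  have DS: "s \<in> Pi\<^sub>E J S" if "s \<in> D" for s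
    using closed_discrete_in_subset_topspace[OF D] that by auto
  have gS: "g j x \<in> topspace (X (a j))" if "j \<in> J" "x \<in> S j" for j x
    using closed_discrete_in_subset_topspace[OF g(2)[OF that(1)]] that(2) by blast
  have inj: "inj_on H D"
  proof (rule inj_onI)
    fix s t assume st: "s \<in> D" "t \<in> D" "H s = H t"
    have "s j = t j" if j: "j \<in> J" for j
      using H[OF j, of s] H[OF j, of t] st(3) DS[OF st(1)] DS[OF st(2)] g(1)[OF j] j
      by (auto simp: PiE_iff dest: inj_onD)
    then show "s = t" using DS[OF st(1)] DS[OF st(2)] by (intro extensionalityI[of s J t]) (auto simp: PiE_iff)
  qed
  have t1P: "t1_space ?P" using t1 by (intro t1_space_product) auto
  have t1Q: "t1_space ?Q" by (intro t1_space_product) (simp add: t1_space_closedin_singleton)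
  have "closed_discrete_in ?P (H ` D)"
  proof (rule closed_discrete_inI[OF t1P])
    have "H s \<in> topspace ?P" if "s \<in> D" for s
      using DS[OF that] gS by (auto simp: PiE_iff H) (auto simp: H_def)
    then show "H ` D \<subseteq> topspace ?P" by blast
    fix y assume y: "y \<in> topspace ?P"
    then have yX: "y (a j) \<in> topspace (X (a j))" if "j \<in> J" for j using that by auto
    show "\<exists>U. openin ?P U \<and> y \<in> U \<and> (\<forall>p q. p \<in> H ` D \<and> p \<in> U \<longrightarrow> q \<in> H ` D \<and> q \<in> U \<longrightarrow> p = q)"
    proof (cases "\<exists>j\<in>J. y (a j) \<notin> g j ` S j")
      case True
      then obtain j where j: "j \<in> J" "y (a j) \<notin> g j ` S j" by blast
      let ?U = "{x \<in> topspace ?P. \<forall>i\<in>{a j}. x i \<in> topspace (X (a j)) - g j ` S j}"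
      have "openin ?P ?U"
        using j(1) g(2)[OF j(1)] by (intro openin_box) (auto simp: closed_discrete_in_def)
      moreover have "y \<in> ?U" using y yX j by simp
      moreover have "H s \<notin> ?U" if "s \<in> D" for s
        using H[OF j(1)] DS[OF that] j(1) by auto
      ultimately show ?thesis by (intro exI[of _ ?U]) blast
    next
      case False
      then have "\<forall>j\<in>J. \<exists>s. s \<in> S j \<and> y (a j) = g j s" by blast
      then obtain s0' where s0': "\<And>j. j \<in> J \<Longrightarrow> s0' j \<in> S j \<and> y (a j) = g j (s0' j)" by metis
      define s0 where "s0 = restrict s0' J"
      have s0: "s0 j \<in> S j" "y (a j) = g j (s0 j)" if "j \<in> J" for j
        using s0'[OF that] that by (auto simp: s0_def)
      have "s0 \<in> topspace ?Q" using s0 by (auto simp: s0_def)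
      then obtain V where V: "openin ?Q V" "s0 \<in> V"
          "\<forall>a b. a \<in> D \<longrightarrow> a \<in> V \<longrightarrow> b \<in> D \<longrightarrow> b \<in> V \<longrightarrow> a = b"
        by (rule closed_discrete_in_nbhd[OF t1Q D])
      obtain W where W: "finite {j \<in> J. W j \<noteq> S j}" "s0 \<in> Pi\<^sub>E J W" "Pi\<^sub>E J W \<subseteq> V"
        using V(1,2) unfolding openin_product_topology_alt by auto
      define K where "K = {j \<in> J. W j \<noteq> S j}"
      have "\<exists>U. openin (X (a j)) U \<and> y (a j) \<in> U \<and> (\<forall>p q. p \<in> g j ` S j \<longrightarrow> p \<in> U \<longrightarrow> q \<in> g j ` S j \<longrightarrow> q \<in> U \<longrightarrow> p = q)"
        if j: "j \<in> J" for j
        by (rule closed_discrete_in_nbhd[OF t1[OF j] g(2)[OF j] yX[OF j]]) blast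
      then obtain U where U: "\<And>j. j \<in> J \<Longrightarrow> openin (X (a j)) (U j)" "\<And>j. j \<in> J \<Longrightarrow> y (a j) \<in> U j"
          "\<And>j p q. j \<in> J \<Longrightarrow> p \<in> g j ` S j \<Longrightarrow> p \<in> U j \<Longrightarrow> q \<in> g j ` S j \<Longrightarrow> q \<in> U j \<Longrightarrow> p = q"
        by metis
      define N where "N = {x \<in> topspace ?P. \<forall>i\<in>a ` K. x i \<in> U (inv_into J a i)}"
      have KJ: "K \<subseteq> J" by (auto simp: K_def)
      have "openin ?P N"
        unfolding N_def using KJ W(1) U(1) a by (intro openin_box) (auto simp: K_def)
      moreover have "y \<in> N"
        unfolding N_def using y U(2) a KJ by (auto simp: subset_iff)
      moreover have "s \<in> V" if s: "s \<in> D" "H s \<in> N" for s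
      proof -
        have "s j \<in> W j" if j: "j \<in> J" for j
        proof (cases "j \<in> K")
          case True
          then have "H s (a j) \<in> U j"
            using s(2) a j unfolding N_def by auto
          then have "g j (s j) = g j (s0 j)"
            using U(2,3)[OF j] H[OF j] s0[OF j] DS[OF s(1)] j by (auto simp: PiE_iff)
          then have "s j = s0 j"
            using g(1)[OF j] s0[OF j] DS[OF s(1)] j by (auto simp: PiE_iff dest: inj_onD)
          then show ?thesis using W(2) j by auto
        next
          case False
          then show ?thesis using j DS[OF s(1)] by (auto simp: K_def)
        qed
        then have "s \<in> Pi\<^sub>E J W" using DS[OF s(1)] by (auto simp: PiE_iff)
        then show ?thesis using W(3) by blast
      qed
      then have "p = q" if "p \<in> H ` D" "p \<in> N" "q \<in> H ` D" "q \<in> N" for p q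
        using that V(3) by blast
      ultimately show ?thesis by (intro exI[of _ N]) blast
    qed
  qed
  with inj that show ?thesis by blast
qed

text \<open>Density at most the size of \<open>M\<close>. A set stands for the cardinal, so that
  infinite cardinals below \<open>l\<close> are represented by subsets of \<open>Field l\<close> and
  compared by \<open>card_of\<close>.\<close>

definition has_dense_upto :: "'a topology \<Rightarrow> 'b set \<Rightarrow> bool" where
  "has_dense_upto X M \<longleftrightarrow> (\<exists>G. G \<subseteq> topspace X \<and> X closure_of G = topspace X \<and> |G| \<le>o |M| )"

text \<open>Otherwise every level of a dense sequence of closed discrete sets has size at most
  \<open>|M|\<close>, and so has their countable union, \<open>M\<close> being infinite.\<close>

lemma large_closed_discrete:
  assumes "e_separable X" "infinite M" "\<not> has_dense_upto X M"
  shows "\<exists>D. closed_discrete_in X D \<and> |M| \<le>o |D|"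
proof (rule ccontr)
  assume "\<nexists>D. closed_discrete_in X D \<and> |M| \<le>o |D|"
  then have no: "\<not> |M| \<le>o |D|" if "closed_discrete_in X D" for D
    using that by blast
  obtain D :: "nat \<Rightarrow> _" where D: "\<And>n. closed_discrete_in X (D n)" "X closure_of (\<Union>n. D n) = topspace X"
    using assms(1) unfolding e_separable_def by blast
  have "|D n| \<le>o |M|" for n
    using no[OF D(1)[of n]] ordLeq_total[OF card_of_Well_order card_of_Well_order, of M "D n"] by simp
  then have "|\<Union>n. D n| \<le>o |M|"
    using assms(2) by (intro card_of_UNION_ordLeq_infinite) (auto simp: infinite_iff_card_of_nat)
  moreover have "(\<Union>n. D n) \<subseteq> topspace X"
    using closed_discrete_in_subset_topspace[OF D(1)] by blast
  ultimately show False using assms(3) D(2) unfolding has_dense_upto_def by blast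
qed

lemma e_separable_empty: "topspace X = {} \<Longrightarrow> e_separable X"
  by (intro e_separable_countableI[of "{}"]) (auto simp: closure_of_eq_empty)

lemma ordLeq_imp_inj:
  assumes "|A| \<le>o |B|" obtains f where "inj_on f A" "f ` A \<subseteq> B"
  using assms unfolding card_of_ordLeq[symmetric] by (elim exE conjE)

lemma Card_order_uncountable_infinite:
  assumes "Card_order l" "|UNIV :: nat set| <o l" shows "infinite (Field l)"
proof -
  have "|UNIV :: nat set| \<le>o |Field l|"
    using ordLess_imp_ordLeq[OF assms(2)] card_of_Field_leq(2)[OF assms(1)] by (rule ordLeq_transitive)
  then show ?thesis by (simp add: infinite_iff_card_of_nat)
qed

lemma mrowka_starE:
  fixes l :: "'i rel"
  assumes "mrowka_star l"
  obtains S :: "'i \<Rightarrow> 'i set" and D where "\<And>i. i \<in> Field l \<Longrightarrow> |S i| <o l"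
    "closed_discrete_in (product_topology (\<lambda>i. discrete_topology (S i)) (Field l)) D" "( |D|, l) \<in> ordIso"
proof -
  obtain S :: "'i \<Rightarrow> 'i set" and D where *: "\<forall>i\<in>Field l. |S i| <o l"
    "closed_discrete_in (product_topology (\<lambda>i. discrete_topology (S i)) (Field l)) D" "( |D|, l) \<in> ordIso"
    using assms unfolding mrowka_star_def by (elim exE conjE)
  show ?thesis by (rule that[of S D]) (use * in auto)
qed

text \<open>Each discrete factor \<open>S i\<close> of the witness for \<open>mrowka_star l\<close>
  is embedded, for every \<open>m\<close> anew, as a closed discrete set in a factor of sufficiently
  large density. So every block \<open>A m\<close> contains a copy of \<open>D\<close> as a supply
  of labels. A code is a finite set of pairs of a coordinate and a level; there are at most
  \<open>l\<close> codes, and \<open>D\<close> has \<open>l\<close> points.\<close>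

lemma e_separable_product_mrowka_star:
  fixes X :: "'i \<Rightarrow> 'a topology"
  assumes l: "Card_order l" "|UNIV :: nat set| <o l" and "mrowka_star l"
    and t1: "\<And>i. i \<in> Field l \<Longrightarrow> t1_space (X i)" and es: "\<And>i. i \<in> Field l \<Longrightarrow> e_separable (X i)"
    and big: "\<And>M. M \<subseteq> Field l \<Longrightarrow> infinite M \<Longrightarrow> |M| <o l \<Longrightarrow>
      l \<le>o |{i \<in> Field l. \<not> has_dense_upto (X i) M}|"
  shows "e_separable (product_topology X (Field l))"
proof (cases "topspace (product_topology X (Field l)) = {}")
  case True
  then show ?thesis by (rule e_separable_empty)
next
  case False
  then obtain z where z: "\<And>i. i \<in> Field l \<Longrightarrow> z i \<in> topspace (X i)" by (auto simp: PiE_iff)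
  have inf: "infinite (Field l)" using l by (rule Card_order_uncountable_infinite)
  obtain S :: "'i \<Rightarrow> 'i set" and D where S: "\<And>i. i \<in> Field l \<Longrightarrow> |S i| <o l"
    and D: "closed_discrete_in (product_topology (\<lambda>i. discrete_topology (S i)) (Field l)) D"
    and Dl: "( |D|, l) \<in> ordIso"
    using mrowka_starE[OF \<open>mrowka_star l\<close>] by metis
  obtain N where N: "N \<subseteq> Field l" "infinite N" "countable N"
    using infinite_countable_subset'[OF inf] by blast
  have Nl: "|N| <o l"
    using N(3) l(2) unfolding countable_card_of_nat by (rule ordLeq_ordLess_trans)
  have "\<exists>c. inj_on c (S i) \<and> c ` S i \<subseteq> Field l" if "i \<in> Field l" for i
    using ordLeq_imp_inj[OF ordLeq_transitive[OF ordLess_imp_ordLeq[OF S[OF that]] card_of_Field_leq(2)[OF l(1)]]]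
    by metis
  then obtain c where c: "\<And>i. i \<in> Field l \<Longrightarrow> inj_on (c i) (S i)" "\<And>i. i \<in> Field l \<Longrightarrow> c i ` S i \<subseteq> Field l"
    by metis
  \<comment> \<open>\<open>S i\<close> may be finite, whereas large closed discrete sets are
    obtained for infinite cardinals; adding the countable \<open>N\<close> keeps the size below the
    uncountable \<open>l\<close>.\<close>
  define M where "M i = c i ` S i \<union> N" for i
  have M: "M i \<subseteq> Field l" "infinite (M i)" "|M i| <o l" "|S i| \<le>o |M i|" if i: "i \<in> Field l" for i
  proof -
    show "M i \<subseteq> Field l" "infinite (M i)" using c(2)[OF i] N by (auto simp: M_def)
    have "|c i ` S i| <o l" using card_of_image S[OF i] by (rule ordLeq_ordLess_trans)
    then show "|M i| <o l"
      unfolding M_def using Nl inf l(1) by (intro card_of_Un_ordLess_infinite_Field) auto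
    show "|S i| \<le>o |M i|"
      using c(1)[OF i] by (intro card_of_ordLeqI[of "c i"]) (auto simp: M_def)
  qed
  have Jl: "|(UNIV :: nat set) \<times> Field l| \<le>o l"
    using inf l(1) ordLess_imp_ordLeq[OF l(2)] card_of_Field_leq(1)[OF l(1)]
    by (intro card_of_Sigma_ordLeq_infinite_Field) auto
  \<comment> \<open>One injective choice over all pairs makes the coordinates within a block
    distinct and different blocks disjoint.\<close>
  obtain a where a: "inj_on a ((UNIV :: nat set) \<times> Field l)"
      "\<And>j. j \<in> UNIV \<times> Field l \<Longrightarrow> a j \<in> {i \<in> Field l. \<not> has_dense_upto (X i) (M (snd j))}"
  proof (rule inj_on_choice[OF l(1) Jl])
    show "l \<le>o |{i \<in> Field l. \<not> has_dense_upto (X i) (M (snd j))}|" if "j \<in> (UNIV :: nat set) \<times> Field l" for j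
      using that by (intro big M) auto
  qed blast
  have am: "inj_on (\<lambda>i. a (m, i)) (Field l)" for m
    using a(1) by (auto simp: inj_on_def)
  have aF: "a (m, i) \<in> Field l" if "i \<in> Field l" for m i
    using a(2)[of "(m, i)"] that by auto
  have "\<exists>g. inj_on g (S i) \<and> closed_discrete_in (X (a (m, i))) (g ` S i)" if i: "i \<in> Field l" for m i
  proof -
    have "\<not> has_dense_upto (X (a (m, i))) (M i)" using a(2)[of "(m, i)"] i by auto
    then obtain C where C: "closed_discrete_in (X (a (m, i))) C" "|M i| \<le>o |C|"
      using large_closed_discrete[OF es[OF aF[OF i]] M(2)[OF i]] by blast
    obtain g where "inj_on g (S i)" "g ` S i \<subseteq> C"
      using ordLeq_imp_inj[OF ordLeq_transitive[OF M(4)[OF i] C(2)]] .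
    then show ?thesis using closed_discrete_in_subset[OF C(1)] by blast
  qed
  then have "\<forall>m i. \<exists>g. i \<in> Field l \<longrightarrow> inj_on g (S i) \<and> closed_discrete_in (X (a (m, i))) (g ` S i)"
    by blast
  then obtain g where g: "\<And>m i. i \<in> Field l \<Longrightarrow> inj_on (g m i) (S i)"
      "\<And>m i. i \<in> Field l \<Longrightarrow> closed_discrete_in (X (a (m, i))) (g m i ` S i)"
    by metis
  define A where "A m = (\<lambda>i. a (m, i)) ` Field l" for m
  have "\<exists>H. inj_on H D \<and> closed_discrete_in (product_topology X (A m)) (H ` D)" for m
    unfolding A_def
    by (rule closed_discrete_in_product_embedding[where a = "\<lambda>i. a (m, i)" and X = X, OF D am t1[OF aF] g[where m = m]]) blast+
  then obtain H where H: "\<And>m. inj_on (H m) D" "\<And>m. closed_discrete_in (product_topology X (A m)) (H m ` D)"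
    by metis
  obtain C :: "'i \<Rightarrow> nat \<Rightarrow> _" where C: "\<And>i n. i \<in> Field l \<Longrightarrow> closed_discrete_in (X i) (C i n)"
      "\<And>i. i \<in> Field l \<Longrightarrow> X i closure_of (\<Union>n. C i n) = topspace (X i)"
    using es unfolding e_separable_def by metis
  define G where "G = Fpow (Field l \<times> (UNIV :: nat set))"
  have "|Field l \<times> (UNIV :: nat set)| \<le>o |Field l|"
    using inf ordLess_imp_ordLeq[OF l(2)] card_of_Field_leq(2)[OF l(1)]
    by (intro card_of_Sigma_ordLeq_infinite) (auto simp: infinite_iff_card_of_nat intro: card_of_mono1)
  then have "|G| \<le>o |Field l|"
    unfolding G_def by (rule card_of_Fpow_bound[OF inf])
  also have "|Field l| \<le>o |D|"
    using ordLeq_ordIso_trans[OF card_of_Field_leq(1)[OF l(1)] ordIso_symmetric[OF Dl]] .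
  finally obtain k where k: "inj_on k G" "k ` G \<subseteq> D" by (rule ordLeq_imp_inj)
  show ?thesis
  \<comment> \<open>A code with several levels at one coordinate gets an arbitrary one of them;
    density is witnessed by codes that are graphs of functions.\<close>
  proof (rule e_separable_productI[of "Field l" X A "\<lambda>m n. H m ` D" "\<lambda>m g. H m (k g)" G "\<lambda>g. fst ` g"
        "\<lambda>g i. C i (SOME n. (i, n) \<in> g)" "\<lambda>g. z"])
    show "A m \<subseteq> Field l" for m using aF by (auto simp: A_def)
    show "A m \<inter> A n = {}" if "m \<noteq> n" for m n
      using that a(1) by (auto simp: A_def inj_on_def)
    show "inj_on (\<lambda>g. H m (k g)) G" for m
      using comp_inj_on[OF k(1) inj_on_subset[OF H(1) k(2)]] by (simp add: comp_def)
    show "H m (k g) \<in> (\<Union>n. H m ` D)" if "g \<in> G" for m g using k(2) that by blast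
    show "finite (fst ` g) \<and> fst ` g \<subseteq> Field l" if "g \<in> G" for g
      using that by (auto simp: G_def Fpow_def)
    show "closed_discrete_in (X i) (C i (SOME n. (i, n) \<in> g))" if "g \<in> G" "i \<in> fst ` g" for g i
      using that by (intro C) (auto simp: G_def Fpow_def)
    fix K U assume K: "finite K" "K \<subseteq> Field l" "\<And>i. i \<in> K \<Longrightarrow> openin (X i) (U i) \<and> U i \<noteq> {}"
    have "\<exists>n. C i n \<inter> U i \<noteq> {}" if "i \<in> K" for i
    proof -
      have "i \<in> Field l" "openin (X i) (U i)" "U i \<noteq> {}" using K that by auto
      then show ?thesis using dense_hits_open[OF C(2)[OF \<open>i \<in> Field l\<close>], of "U i"] by blast
    qed
    then obtain n where n: "\<And>i. i \<in> K \<Longrightarrow> C i (n i) \<inter> U i \<noteq> {}" by metis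
    define g where "g = (\<lambda>i. (i, n i)) ` K"
    have "g \<in> G" using K by (auto simp: g_def G_def Fpow_def)
    moreover have "fst ` g = K" by (force simp: g_def)
    moreover have "(SOME n. (i, n) \<in> g) = n i" if "i \<in> K" for i
      using that by (intro some_equality) (auto simp: g_def)
    ultimately show "\<exists>g\<in>G. fst ` g \<subseteq> K \<and>
        (\<forall>i\<in>K. if i \<in> fst ` g then C i (SOME n. (i, n) \<in> g) \<inter> U i \<noteq> {} else z i \<in> U i)"
      using n by (intro bexI[of _ g]) auto
  qed (use t1 H z in auto)
qed

text \<open>All factors are finite, so the product is compact, and closed discrete subsets of a
  compact space are finite. Hence \<open>mrowka_star l\<close> forces an infinite \<open>l\<close>
  to be uncountable.\<close>

lemma not_mrowka_star_countable:
  fixes l :: "'i rel"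
  assumes l: "Card_order l" "infinite (Field l)" "l \<le>o |UNIV :: nat set|"
  shows "\<not> mrowka_star l"
proof
  assume "mrowka_star l"
  then obtain S :: "'i \<Rightarrow> 'i set" and D where S: "\<And>i. i \<in> Field l \<Longrightarrow> |S i| <o l"
    and D: "closed_discrete_in (product_topology (\<lambda>i. discrete_topology (S i)) (Field l)) D"
    and Dl: "( |D|, l) \<in> ordIso"
    using mrowka_starE by metis
  let ?P = "product_topology (\<lambda>i. discrete_topology (S i)) (Field l)"
  have "finite (S i)" if "i \<in> Field l" for i
  proof (rule ccontr)
    assume "infinite (S i)"
    then have "|UNIV :: nat set| \<le>o |S i|" by (simp add: infinite_iff_card_of_nat)
    with l(3) have "l \<le>o |S i|" by (rule ordLeq_transitive)
    with S[OF that] show False by (simp add: not_ordLess_ordLeq)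
  qed
  then have "compact_space ?P"
    by (simp add: compact_space_product_topology compact_space_discrete_topology)
  then have "compactin ?P D"
    using D by (simp add: closed_discrete_in_def closedin_compact_space)
  then have "compact_space (subtopology ?P D)"
    by (rule compact_space_subtopology)
  then have "finite D"
    using D by (simp add: closed_discrete_in_def compact_space_discrete_topology)
  moreover have "|Field l| \<le>o |D|"
    using ordLeq_ordIso_trans[OF card_of_Field_leq(1)[OF l(1)] ordIso_symmetric[OF Dl]] .
  ultimately show False using l(2) card_of_ordLeq_finite by blast
qed

lemma has_dense_upto_image:
  assumes "has_dense_upto X K" "K \<noteq> {}" "topspace X \<noteq> {}"
  shows "\<exists>d. d ` K \<subseteq> topspace X \<and> X closure_of (d ` K) = topspace X"
proof -
  obtain G where G: "G \<subseteq> topspace X" "X closure_of G = topspace X" "|G| \<le>o |K|"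
    using assms(1) unfolding has_dense_upto_def by blast
  have "G \<noteq> {}"
  proof
    assume "G = {}"
    with G(2) have "topspace X = {}" by simp
    with assms(3) show False by simp
  qed
  then obtain d where "d ` K = G" using G(3) card_of_ordLeq2[of G K] by auto
  then show ?thesis using G by blast
qed

text \<open>
  The Hewitt--Marczewski--Pondiczery argument: finitely many coordinates are separated by
  initial segments of their codes in the Cantor set.
\<close>

lemma ex_finite_code:
  fixes r :: "'i \<Rightarrow> nat \<Rightarrow> bool" and k :: "'i \<Rightarrow> 'k"
  assumes "finite F" "inj_on r F" "k ` F \<subseteq> K"
  shows "\<exists>g\<in>Fpow (UNIV \<times> K). \<forall>i\<in>F. (SOME x. \<exists>n. (map (r i) [0..<n], x) \<in> g) = k i"
proof -
  have "\<exists>n. r i n \<noteq> r j n" if "i \<in> F" "j \<in> F" "i \<noteq> j" for i j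
    using inj_onD[OF assms(2), of i j] that by auto
  then obtain d where d: "\<And>i j. i \<in> F \<Longrightarrow> j \<in> F \<Longrightarrow> i \<noteq> j \<Longrightarrow> r i (d i j) \<noteq> r j (d i j)"
    by metis
  \<comment> \<open>\<open>N\<close> lies beyond all the chosen places \<open>d i j\<close> of
    difference. The \<open>0\<close> provides for an empty \<open>F\<close>, and the successor makes
    every \<open>d i j\<close> a valid position in a segment of length \<open>N\<close>.\<close>
  define N where "N = Suc (Max (insert 0 ((\<lambda>(i, j). d i j) ` (F \<times> F))))"
  have dN: "d i j < N" if "i \<in> F" "j \<in> F" for i j
  proof -
    have "d i j \<le> Max (insert 0 ((\<lambda>(i, j). d i j) ` (F \<times> F)))"
      using assms(1) that by (intro Max_ge) auto
    then show ?thesis by (simp add: N_def)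
  qed
  have sep: "i = j" if "i \<in> F" "j \<in> F" "map (r i) [0..<N] = map (r j) [0..<N]" for i j
  proof (rule ccontr)
    assume "i \<noteq> j"
    moreover have "r i (d i j) = r j (d i j)"
      using arg_cong[OF that(3), of "\<lambda>xs. xs ! d i j"] dN[OF that(1,2)] by simp
    ultimately show False using d that by blast
  qed
  define g where "g = (\<lambda>i. (map (r i) [0..<N], k i)) ` F"
  have "g \<in> Fpow (UNIV \<times> K)" using assms by (auto simp: g_def Fpow_def)
  moreover have "(SOME x. \<exists>n. (map (r i) [0..<n], x) \<in> g) = k i" if i: "i \<in> F" for i
  proof (rule some_equality)
    show "\<exists>n. (map (r i) [0..<n], k i) \<in> g" using i by (auto simp: g_def)
    fix x assume "\<exists>n. (map (r i) [0..<n], x) \<in> g"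
    then obtain n j where j: "j \<in> F" "map (r i) [0..<n] = map (r j) [0..<N]" "x = k j"
      by (auto simp: g_def)
    from arg_cong[OF j(2), of length] have "n = N" by simp
    then show "x = k i" using sep[OF i j(1)] j by simp
  qed
  ultimately show ?thesis by blast
qed

text \<open>A code \<open>g\<close> is a finite table from initial segments to elements of
  \<open>K\<close>. Coordinate \<open>i\<close> looks up an initial segment of its own sequence
  \<open>r i\<close> and takes the point with the index found from its dense set. The number of
  tables depends on \<open>K\<close> alone and not on the number of factors.\<close>

lemma product_coded_dense:
  fixes X :: "'i \<Rightarrow> 'a topology" and K :: "'k set"
  assumes r: "inj_on (r :: 'i \<Rightarrow> nat \<Rightarrow> bool) R" and K: "K \<noteq> {}"
    and small: "\<And>i. i \<in> R \<Longrightarrow> has_dense_upto (X i) K"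
    and ne: "\<And>i. i \<in> R \<Longrightarrow> topspace (X i) \<noteq> {}"
  shows "\<exists>b :: (bool list \<times> 'k) set \<Rightarrow> 'i \<Rightarrow> 'a.
    (\<forall>g. \<forall>i\<in>R. b g i \<in> topspace (X i)) \<and>
    (\<forall>F U. finite F \<longrightarrow> F \<subseteq> R \<longrightarrow> (\<forall>i\<in>F. openin (X i) (U i) \<and> U i \<noteq> {}) \<longrightarrow>
       (\<exists>g\<in>Fpow (UNIV \<times> K). \<forall>i\<in>F. b g i \<in> U i))"
proof -
  have "\<forall>i. \<exists>d. i \<in> R \<longrightarrow> d ` K \<subseteq> topspace (X i) \<and> X i closure_of (d ` K) = topspace (X i)"
    using has_dense_upto_image[OF small K ne] by blast
  then obtain d where d: "\<And>i. i \<in> R \<Longrightarrow> d i ` K \<subseteq> topspace (X i)"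
      "\<And>i. i \<in> R \<Longrightarrow> X i closure_of (d i ` K) = topspace (X i)"
    by metis
  obtain k0 where k0: "k0 \<in> K" using K by blast
  define c where "c g i = (SOME x. \<exists>n. (map (r i) [0..<n], x) \<in> g)" for g :: "(bool list \<times> 'k) set" and i
  \<comment> \<open>The default \<open>k0\<close> covers tables without a usable entry for
    \<open>i\<close>, so that every \<open>b g\<close> is a point of the product.\<close>
  define b where "b g i = d i (if c g i \<in> K then c g i else k0)" for g i
  show ?thesis
  proof (intro exI[of _ b] conjI allI ballI impI)
    show "b g i \<in> topspace (X i)" if "i \<in> R" for g i
      using d(1)[OF that] k0 by (auto simp: b_def)
    fix F U assume F: "finite F" "F \<subseteq> R" "\<forall>i\<in>F. openin (X i) (U i) \<and> U i \<noteq> {}"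
    have "\<exists>k\<in>K. d i k \<in> U i" if "i \<in> F" for i
    proof -
      have "i \<in> R" "openin (X i) (U i)" "U i \<noteq> {}" using F that by auto
      then show ?thesis using dense_hits_open[OF d(2)[OF \<open>i \<in> R\<close>], of "U i"] by blast
    qed
    then obtain k where k: "\<And>i. i \<in> F \<Longrightarrow> k i \<in> K \<and> d i (k i) \<in> U i" by metis
    obtain g where "g \<in> Fpow (UNIV \<times> K)" "\<forall>i\<in>F. c g i = k i"
      using ex_finite_code[OF F(1) inj_on_subset[OF r F(2)], of k K] k unfolding c_def by blast
    then show "\<exists>g\<in>Fpow (UNIV \<times> K). \<forall>i\<in>F. b g i \<in> U i"
      using k by (intro bexI[of _ g]) (auto simp: b_def)
  qed
qed

lemma closed_discrete_in_singleton:
  assumes "t1_space X" "x \<in> topspace X" shows "closed_discrete_in X {x}"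
  using assms by (intro closed_discrete_inI) auto

text \<open>Here the coded points already form a countable dense set, and each of them is closed
  discrete as a singleton of a T1 space.\<close>

lemma e_separable_product_separable:
  fixes X :: "'i \<Rightarrow> 'a topology" and K :: "'k set"
  assumes r: "inj_on (r :: 'i \<Rightarrow> nat \<Rightarrow> bool) R" and K: "K \<noteq> {}" "countable K"
    and t1: "\<And>i. i \<in> R \<Longrightarrow> t1_space (X i)"
    and small: "\<And>i. i \<in> R \<Longrightarrow> has_dense_upto (X i) K"
    and ne: "\<And>i. i \<in> R \<Longrightarrow> topspace (X i) \<noteq> {}"
  shows "e_separable (product_topology X R)"
proof -
  let ?P = "product_topology X R"
  have "\<exists>b :: (bool list \<times> 'k) set \<Rightarrow> 'i \<Rightarrow> 'a.
    (\<forall>g. \<forall>i\<in>R. b g i \<in> topspace (X i)) \<and>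
    (\<forall>F U. finite F \<longrightarrow> F \<subseteq> R \<longrightarrow> (\<forall>i\<in>F. openin (X i) (U i) \<and> U i \<noteq> {}) \<longrightarrow>
       (\<exists>g\<in>Fpow (UNIV \<times> K). \<forall>i\<in>F. b g i \<in> U i))"
    using r K(1) small ne by (rule product_coded_dense)
  then obtain b :: "(bool list \<times> 'k) set \<Rightarrow> 'i \<Rightarrow> 'a" where b0: "\<forall>g. \<forall>i\<in>R. b g i \<in> topspace (X i)"
    "\<forall>F U. finite F \<longrightarrow> F \<subseteq> R \<longrightarrow> (\<forall>i\<in>F. openin (X i) (U i) \<and> U i \<noteq> {}) \<longrightarrow>
       (\<exists>g\<in>Fpow (UNIV \<times> K). \<forall>i\<in>F. b g i \<in> U i)"
    by (elim exE conjE)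
  note b = b0[rule_format]
  have bP: "restrict (b g) R \<in> topspace ?P" for g using b(1) by auto
  show ?thesis
  proof (rule e_separable_countableI[of "(\<lambda>g. {restrict (b g) R}) ` Fpow (UNIV \<times> K)"])
    show "countable ((\<lambda>g. {restrict (b g) R}) ` Fpow (UNIV \<times> K))"
      using K(2) by (intro countable_image countable_Fpow) auto
    show "closed_discrete_in ?P D" if "D \<in> (\<lambda>g. {restrict (b g) R}) ` Fpow (UNIV \<times> K)" for D
      using that bP t1 by (auto intro!: closed_discrete_in_singleton t1_space_product)
    show "?P closure_of \<Union>((\<lambda>g. {restrict (b g) R}) ` Fpow (UNIV \<times> K)) = topspace ?P"
    proof (rule dense_in_productI)
      fix F U assume F: "finite F" "F \<subseteq> R" "\<And>i. i \<in> F \<Longrightarrow> openin (X i) (U i) \<and> U i \<noteq> {}"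
      obtain g where g: "g \<in> Fpow (UNIV \<times> K)" "\<forall>i\<in>F. b g i \<in> U i" using b(2)[OF F] by blast
      then show "\<exists>x\<in>\<Union>((\<lambda>g. {restrict (b g) R}) ` Fpow (UNIV \<times> K)). x \<in> topspace ?P \<and> (\<forall>i\<in>F. x i \<in> U i)"
        using bP[of g] F(2) by (intro bexI[of _ "restrict (b g) R"]) auto
    qed
  qed
qed

text \<open>The labelling construction with empty \<open>F g\<close>: a code stands for the single
  point \<open>b g\<close>. There are at most \<open>|K|\<close> codes, and by \<open>large\<close>
  the dense union of the levels of each block has at least \<open>|K|\<close> points, enough to
  label the codes injectively.\<close>

lemma e_separable_product_large:
  fixes X :: "'i \<Rightarrow> 'a topology" and K :: "'k set" and A :: "nat \<Rightarrow> 'i set"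
  assumes r: "inj_on (r :: 'i \<Rightarrow> nat \<Rightarrow> bool) R" and K: "infinite K"
    and t1: "\<And>i. i \<in> R \<Longrightarrow> t1_space (X i)"
    and small: "\<And>i. i \<in> R \<Longrightarrow> has_dense_upto (X i) K"
    and ne: "\<And>i. i \<in> R \<Longrightarrow> topspace (X i) \<noteq> {}"
    and A: "\<And>m. A m \<subseteq> R" "\<And>m n. m \<noteq> n \<Longrightarrow> A m \<inter> A n = {}"
    and es: "\<And>m. e_separable (product_topology X (A m))"
    and large: "\<And>m G. product_topology X (A m) closure_of G = topspace (product_topology X (A m)) \<Longrightarrow> |K| \<le>o |G|"
  shows "e_separable (product_topology X R)"
proof -
  have "K \<noteq> {}" using K by auto
  have "\<exists>b :: (bool list \<times> 'k) set \<Rightarrow> 'i \<Rightarrow> 'a.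
    (\<forall>g. \<forall>i\<in>R. b g i \<in> topspace (X i)) \<and>
    (\<forall>F U. finite F \<longrightarrow> F \<subseteq> R \<longrightarrow> (\<forall>i\<in>F. openin (X i) (U i) \<and> U i \<noteq> {}) \<longrightarrow>
       (\<exists>g\<in>Fpow (UNIV \<times> K). \<forall>i\<in>F. b g i \<in> U i))"
    using r \<open>K \<noteq> {}\<close> small ne by (rule product_coded_dense)
  then obtain b :: "(bool list \<times> 'k) set \<Rightarrow> 'i \<Rightarrow> 'a" where b0: "\<forall>g. \<forall>i\<in>R. b g i \<in> topspace (X i)"
    "\<forall>F U. finite F \<longrightarrow> F \<subseteq> R \<longrightarrow> (\<forall>i\<in>F. openin (X i) (U i) \<and> U i \<noteq> {}) \<longrightarrow>
       (\<exists>g\<in>Fpow (UNIV \<times> K). \<forall>i\<in>F. b g i \<in> U i)"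
    by (elim exE conjE)
  note b = b0[rule_format]
  obtain E :: "nat \<Rightarrow> nat \<Rightarrow> ('i \<Rightarrow> 'a) set" where E: "\<And>m n. closed_discrete_in (product_topology X (A m)) (E m n)"
      "\<And>m. product_topology X (A m) closure_of (\<Union>n. E m n) = topspace (product_topology X (A m))"
    using es unfolding e_separable_def by metis
  define G where "G = Fpow ((UNIV :: bool list set) \<times> K)"
  have "|UNIV :: bool list set| \<le>o |UNIV :: nat set|"
    using countable_card_of_nat[of "UNIV :: bool list set"] by simp
  also have "|UNIV :: nat set| \<le>o |K|" using K by (simp add: infinite_iff_card_of_nat)
  finally have "|(UNIV :: bool list set) \<times> K| \<le>o |K|"
    using K by (intro card_of_Sigma_ordLeq_infinite) (auto intro: card_of_mono1)
  then have GK: "|G| \<le>o |K|" unfolding G_def by (rule card_of_Fpow_bound[OF K])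
  have "\<exists>e. inj_on e G \<and> e ` G \<subseteq> (\<Union>n. E m n)" for m
    using ordLeq_imp_inj[OF ordLeq_transitive[OF GK large[OF E(2)]]] by metis
  then obtain e where e: "\<And>m. inj_on (e m) G" "\<And>m. e m ` G \<subseteq> (\<Union>n. E m n)" by metis
  show ?thesis
  proof (rule e_separable_productI[of R X A E e G "\<lambda>g. {}" "\<lambda>g i. {}" b])
    show "e m g \<in> (\<Union>n. E m n)" if "g \<in> G" for m g using e(2)[of m] that by blast
    fix F U assume F: "finite F" "F \<subseteq> R" "\<And>i. i \<in> F \<Longrightarrow> openin (X i) (U i) \<and> U i \<noteq> {}"
    show "\<exists>g\<in>G. {} \<subseteq> F \<and> (\<forall>i\<in>F. if i \<in> {} then {} \<inter> U i \<noteq> {} else b g i \<in> U i)"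
      using b(2)[OF F] by (simp add: G_def)
  qed (use t1 A E(1) e(1) b(1) in auto)
qed

section \<open>Minimal failure of e-separability\<close>

lemma exists_minimal_set:
  assumes "M \<in> \<M>"
  obtains K where "K \<in> \<M>" "\<And>L. L \<in> \<M> \<Longrightarrow> |K| \<le>o |L|"
proof -
  have "\<exists>r\<in>card_of ` \<M>. \<forall>r'\<in>card_of ` \<M>. r \<le>o r'"
    using assms by (intro exists_minim_Card_order) (auto simp: card_of_card_order_on Field_card_of)
  then show ?thesis using that by auto
qed

lemma not_small_has_large_subset:
  assumes l: "Card_order l" "infinite (Field l)" and "l \<le>o |A|" "|B| <o l"
  shows "l \<le>o |A - B|"
proof (rule ccontr)
  assume "\<not> l \<le>o |A - B|"
  then have "|A - B| <o l" using ordLess_or_ordLeq_card[OF l(1)] by blast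
  then have "|(A - B) \<union> B| <o l"
    using assms by (intro card_of_Un_ordLess_infinite_Field) auto
  moreover have "|A| \<le>o |(A - B) \<union> B|" by (intro card_of_mono1) auto
  ultimately have "|A| <o l" by (meson ordLeq_ordLess_trans)
  with assms(3) show False by (simp add: not_ordLess_ordLeq)
qed

lemma dense_image_projection:
  assumes G: "product_topology X A closure_of G = topspace (product_topology X A)"
    and ne: "topspace (product_topology X A) \<noteq> {}" and i: "i \<in> A"
  shows "X i closure_of ((\<lambda>x. x i) ` G \<inter> topspace (X i)) = topspace (X i)"
  unfolding dense_intersects_open
proof (intro allI impI)
  fix T assume T: "openin (X i) T \<and> T \<noteq> {}"
  then obtain t where t: "t \<in> T" "t \<in> topspace (X i)" using openin_subset by blast
  obtain z where z: "z \<in> topspace (product_topology X A)" using ne by blast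
  let ?W = "{x \<in> topspace (product_topology X A). \<forall>j\<in>{i}. x j \<in> T}"
  have "openin (product_topology X A) ?W" using i T by (intro openin_box) auto
  moreover have "z(i := t) \<in> ?W" using z t i by (auto simp: PiE_iff extensional_def)
  then have "?W \<noteq> {}" by blast
  ultimately obtain x where "x \<in> G" "x \<in> ?W" by (rule dense_hits_open[OF G])
  then show "(\<lambda>x. x i) ` G \<inter> topspace (X i) \<inter> T \<noteq> {}" using T openin_subset by blast
qed

text \<open>\<open>B M\<close> collects the factors of density above \<open>|M|\<close>, and
  \<open>K\<close> is a smallest infinite set with \<open>B K\<close> of size below
  \<open>l\<close>. For uncountable \<open>K\<close> this leastness gives, for each initial segment
  of \<open>K\<close>, \<open>l\<close> many factors outside \<open>B K\<close> whose density
  exceeds it. A block with one such factor for each \<open>k\<close> has no dense set smaller than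
  \<open>K\<close>: such a set would fit into some initial segment, and its projection would be
  dense in the factor chosen for that segment.\<close>

lemma e_separable_product_minimal:
  fixes X :: "'i \<Rightarrow> 'a topology"
  assumes l: "Card_order l" "|UNIV :: nat set| <o l"
    and r: "inj_on (r :: 'i \<Rightarrow> nat \<Rightarrow> bool) (Field l)"
    and t1: "\<And>i. i \<in> Field l \<Longrightarrow> t1_space (X i)"
    and ne: "\<And>i. i \<in> Field l \<Longrightarrow> topspace (X i) \<noteq> {}"
    and sub: "\<And>A. A \<subseteq> Field l \<Longrightarrow> |A| <o l \<Longrightarrow> e_separable (product_topology X A)"
    and M: "M \<subseteq> Field l" "infinite M" "|M| <o l" "|{i \<in> Field l. \<not> has_dense_upto (X i) M}| <o l"
  shows "e_separable (product_topology X (Field l))"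
proof -
  have inf: "infinite (Field l)" using l by (rule Card_order_uncountable_infinite)
  define B where "B M = {i \<in> Field l. \<not> has_dense_upto (X i) M}" for M :: "'i set"
  define \<M> where "\<M> = {M. M \<subseteq> Field l \<and> infinite M \<and> |M| <o l \<and> |B M| <o l}"
  have "M \<in> \<M>" using M by (simp add: \<M>_def B_def)
  then obtain K where K: "K \<in> \<M>" "\<And>L. L \<in> \<M> \<Longrightarrow> |K| \<le>o |L|" by (rule exists_minimal_set) blast
  have KF: "K \<subseteq> Field l" "infinite K" "|K| <o l" "|B K| <o l" using K(1) by (auto simp: \<M>_def)
  define R where "R = Field l - B K"
  have RF: "R \<subseteq> Field l" "R \<inter> B K = {}" "R \<union> B K = Field l" by (auto simp: R_def B_def)
  have small: "has_dense_upto (X i) K" if "i \<in> R" for i using that by (auto simp: R_def B_def)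
  have "e_separable (product_topology X R)"
  proof (cases "countable K")
    case True
    show ?thesis
      by (rule e_separable_product_separable[OF inj_on_subset[OF r RF(1)] _ True])
        (use KF(2) t1 small ne RF(1) in auto)
  next
    case False
    obtain N where N: "N \<subseteq> K" "infinite N" "countable N"
      using infinite_countable_subset'[OF KF(2)] by blast
    have NK: "|N| <o |K|"
    proof (rule ordLeq_ordLess_trans)
      show "|N| \<le>o |UNIV :: nat set|" using N(3) by (simp add: countable_card_of_nat)
      show "|UNIV :: nat set| <o |K|"
        using False ordLess_or_ordLeq_card[OF card_of_Card_order, of "UNIV :: nat set" K]
        by (simp add: countable_card_of_nat)
    qed
    \<comment> \<open>\<open>N\<close> makes the initial segment infinite, as membership in
      \<open>\<M>\<close> requires; as \<open>K\<close> is uncountable, \<open>L k\<close> remains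
      smaller than \<open>K\<close>.\<close>
    define L where "L k = underS |K| k \<union> N" for k
    have Lbig: "l \<le>o |B (L k) - B K|" if k: "k \<in> K" for k
    proof (rule not_small_has_large_subset[OF l(1) inf _ KF(4)])
      have "|underS |K| k| <o |K|"
        using k by (intro card_of_underS) (auto simp: Field_card_of card_of_card_order_on)
      then have LK: "|L k| <o |K|" unfolding L_def by (rule card_of_Un_ordLess_infinite[OF KF(2) _ NK])
      have "underS |K| k \<subseteq> Field |K|" by (auto simp: underS_def Field_def)
      then have "underS |K| k \<subseteq> K" by (simp only: Field_card_of)
      then have "L k \<subseteq> Field l" using N(1) KF(1) by (auto simp: L_def)
      moreover have "L k \<notin> \<M>" using K(2)[of "L k"] LK by (auto dest: not_ordLess_ordLeq)
      moreover have "|L k| <o l" using LK KF(3) by (rule ordLess_transitive)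
      ultimately have "\<not> |B (L k)| <o l" using N(2) by (auto simp: \<M>_def L_def)
      then show "l \<le>o |B (L k)|" using ordLess_or_ordLeq_card[OF l(1)] by blast
    qed
    have Jl: "|(UNIV :: nat set) \<times> K| \<le>o l"
      using inf l(1) ordLess_imp_ordLeq[OF l(2)] ordLess_imp_ordLeq[OF KF(3)]
      by (intro card_of_Sigma_ordLeq_infinite_Field) auto
    obtain a where a: "inj_on a ((UNIV :: nat set) \<times> K)"
        "\<And>j. j \<in> UNIV \<times> K \<Longrightarrow> a j \<in> B (L (snd j)) - B K"
    proof (rule inj_on_choice[OF l(1) Jl])
      show "l \<le>o |B (L (snd j)) - B K|" if "j \<in> (UNIV :: nat set) \<times> K" for j
        using that by (intro Lbig) auto
    qed blast
    define A where "A m = (\<lambda>k. a (m, k)) ` K" for m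
    have AR: "A m \<subseteq> R" for m using a(2) by (auto simp: A_def R_def B_def)
    have "|A m| <o l" for m
      unfolding A_def using card_of_image KF(3) by (rule ordLeq_ordLess_trans)
    \<comment> \<open>A block has at most \<open>|K|\<close> coordinates, fewer than
      \<open>l\<close>, so it falls under the assumption on small subproducts.\<close>
    then have esA: "e_separable (product_topology X (A m))" for m
      using AR RF(1) by (intro sub) auto
    show ?thesis
    proof (rule e_separable_product_large[OF inj_on_subset[OF r RF(1)] KF(2) _ _ _ AR _ esA])
      show "A m \<inter> A n = {}" if "m \<noteq> n" for m n
        using that a(1) by (auto simp: A_def inj_on_def)
      fix m G assume G: "product_topology X (A m) closure_of G = topspace (product_topology X (A m))"
      show "|K| \<le>o |G|"
      proof (rule ccontr)
        assume "\<not> |K| \<le>o |G|"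
        then have "|G| <o |K|" using ordLess_or_ordLeq_card[OF card_of_Card_order] by blast
        then obtain k where k: "k \<in> K" "|G| \<le>o |underS |K| k|" by (rule ordLess_initial_segment)
        let ?i = "a (m, k)"
        let ?G = "(\<lambda>x. x ?i) ` G \<inter> topspace (X ?i)"
        have "topspace (product_topology X (A m)) \<noteq> {}"
        proof -
          have "X i \<noteq> trivial_topology" if "i \<in> A m" for i using ne[of i] AR RF(1) that by auto
          then show ?thesis using ne AR RF(1) by (auto simp: PiE_eq_empty_iff)
        qed
        then have "X ?i closure_of ?G = topspace (X ?i)"
          by (rule dense_image_projection[OF G]) (use k(1) in \<open>auto simp: A_def\<close>)
        moreover have "|?G| \<le>o |L k|"
        proof -
          have "|?G| \<le>o |(\<lambda>x. x ?i) ` G|" by (intro card_of_mono1) auto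
          also have "|(\<lambda>x. x ?i) ` G| \<le>o |G|" by (rule card_of_image)
          also note k(2)
          also have "|underS |K| k| \<le>o |L k|" by (intro card_of_mono1) (auto simp: L_def)
          finally show ?thesis .
        qed
        ultimately have "has_dense_upto (X ?i) (L k)" unfolding has_dense_upto_def by blast
        then show False using a(2)[of "(m, k)"] k(1) by (auto simp: B_def)
      qed
    qed (use t1 small ne RF(1) in auto)
  qed
  moreover have "e_separable (product_topology X (B K))"
    using KF(4) by (intro sub) (auto simp: B_def)
  ultimately have "e_separable (product_topology X (R \<union> B K))"
    using RF t1 by (intro e_separable_product_Un) auto
  then show ?thesis by (simp add: RF(3))
qed

text \<open>Here the bound by the continuum enters: the coordinates receive distinct points of the
  Cantor set as codes.\<close>

lemma inj_on_cantor_code: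
  fixes l :: "'i rel"
  assumes "Card_order l" "l \<le>o ctwo ^c natLeq"
  obtains r :: "'i \<Rightarrow> nat \<Rightarrow> bool" where "inj_on r (Field l)"
proof -
  have "|Field l| \<le>o |Func (UNIV :: nat set) (UNIV :: bool set)|"
    using ordLeq_transitive[OF card_of_Field_leq(1)[OF assms(1)] assms(2)]
    by (simp add: cexp_def ctwo_def Field_natLeq Field_card_of)
  then show ?thesis using that by (rule ordLeq_imp_inj)
qed

lemma e_separable_product_of_mrowka_star:
  fixes X :: "'i \<Rightarrow> 'a topology"
  assumes l: "Card_order l" "infinite (Field l)" "l \<le>o ctwo ^c natLeq" and m: "mrowka_star l"
    and t1: "\<And>i. i \<in> Field l \<Longrightarrow> t1_space (X i)" and es: "\<And>i. i \<in> Field l \<Longrightarrow> e_separable (X i)"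
    and sub: "\<And>A. A \<subseteq> Field l \<Longrightarrow> |A| <o l \<Longrightarrow> e_separable (product_topology X A)"
  shows "e_separable (product_topology X (Field l))"
proof (cases "topspace (product_topology X (Field l)) = {}")
  case True
  then show ?thesis by (rule e_separable_empty)
next
  case False
  then have ne: "topspace (X i) \<noteq> {}" if "i \<in> Field l" for i
    using that unfolding topspace_product_topology PiE_eq_empty_iff by (auto simp: comp_def)
  have unc: "|UNIV :: nat set| <o l"
  proof (rule ccontr)
    assume "\<not> |UNIV :: nat set| <o l"
    then have "l \<le>o |UNIV :: nat set|" using ordLess_or_ordLeq_card[OF l(1)] by blast
    then show False using not_mrowka_star_countable[OF l(1,2)] m by blast
  qed
  obtain r :: "'i \<Rightarrow> nat \<Rightarrow> bool" where r: "inj_on r (Field l)"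
    using inj_on_cantor_code[OF l(1,3)] by metis
  show ?thesis
  proof (cases "\<exists>M. M \<subseteq> Field l \<and> infinite M \<and> |M| <o l \<and> |{i \<in> Field l. \<not> has_dense_upto (X i) M}| <o l")
    case True
    then obtain M where M: "M \<subseteq> Field l" "infinite M" "|M| <o l"
      "|{i \<in> Field l. \<not> has_dense_upto (X i) M}| <o l" by (elim exE conjE)
    show ?thesis by (rule e_separable_product_minimal[OF l(1) unc r t1 ne sub M])
  next
    case False
    have "l \<le>o |{i \<in> Field l. \<not> has_dense_upto (X i) M}|"
      if "M \<subseteq> Field l" "infinite M" "|M| <o l" for M
      unfolding ordLess_or_ordLeq_card[OF l(1), symmetric] using False that by blast
    then show ?thesis
      by (intro e_separable_product_mrowka_star[OF l(1) unc m t1 es])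
  qed
qed

lemma e_separable_product_fails_minimal:
  fixes l :: "'i rel"
  assumes l: "Card_order l" "l \<le>o ctwo ^c natLeq"
    and fails: "e_separable_product_fails TYPE('a) l"
    and min: "\<And>k :: 'i rel. Card_order k \<Longrightarrow> k <o l \<Longrightarrow> \<not> e_separable_product_fails TYPE('a) k"
  shows "infinite (Field l)" "\<not> mrowka_star l"
proof -
  obtain X :: "'i \<Rightarrow> 'a topology" where t1: "\<And>i. i \<in> Field l \<Longrightarrow> t1_space (X i)"
    and es: "\<And>i. i \<in> Field l \<Longrightarrow> e_separable (X i)"
    and not: "\<not> e_separable (product_topology X (Field l))"
    using fails unfolding e_separable_product_fails_def by blast
  show inf: "infinite (Field l)"
    using e_separable_product_finite[of "Field l" X] t1 es not by blast
  have sub: "e_separable (product_topology X A)" if A: "A \<subseteq> Field l" "|A| <o l" for A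
  proof (rule ccontr)
    assume "\<not> e_separable (product_topology X A)"
    \<comment> \<open>The order \<open>|A|\<close> has field \<open>A\<close> and is a cardinal
      order on the same type, so the family \<open>X\<close> itself is a failure at a cardinal below
      \<open>l\<close>.\<close>
    then have "e_separable_product_fails TYPE('a) |A|"
      unfolding e_separable_product_fails_def Field_card_of using A(1) t1 es by (intro exI[of _ X]) auto
    with min[OF card_of_Card_order A(2)] show False by blast
  qed
  show "\<not> mrowka_star l"
    using e_separable_product_of_mrowka_star[OF l(1) inf l(2) _ t1 es sub] not by blast
qed

section \<open>Compactness below cardinals outside Mrowka's class\<close>

lemma infinite_Card_order_finite_less:
  assumes "Card_order l" "infinite (Field l)" "finite A" shows "|A| <o l"
proof -
  have "\<not> l \<le>o |A|"
  proof
    assume "l \<le>o |A|"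
    then have "|Field l| \<le>o |A|" using card_of_Field_leq(1)[OF assms(1)] by (rule ordLeq_transitive[rotated])
    then show False using assms(2,3) card_of_ordLeq_finite by auto
  qed
  then show ?thesis using ordLess_or_ordLeq_card[OF assms(1), of A] by simp
qed

text \<open>Frees the class from its fixed index type: at most \<open>l\<close> coordinates and
  fewer than \<open>l\<close> values at each of them are carried over into \<open>Field l\<close>,
  and the coordinates left over become singletons. Applied to a point \<open>x \<xi>\<close> itself,
  \<open>sep\<close> also yields injectivity, hence a closed discrete set of full size
  \<open>l\<close>.\<close>

lemma mrowka_starI:
  fixes l :: "'i rel" and I :: "'j set" and S :: "'j \<Rightarrow> 'b set" and x :: "'i \<Rightarrow> 'j \<Rightarrow> 'b"
  assumes l: "Card_order l" "infinite (Field l)" and I: "|I| \<le>o l"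
    and S: "\<And>j. j \<in> I \<Longrightarrow> |S j| <o l"
    and x: "\<And>\<xi> j. \<xi> \<in> Field l \<Longrightarrow> j \<in> I \<Longrightarrow> x \<xi> j \<in> S j"
    and sep: "\<And>y. (\<And>j. j \<in> I \<Longrightarrow> y j \<in> S j) \<Longrightarrow> \<exists>F. finite F \<and> F \<subseteq> I \<and>
      (\<forall>\<xi>\<in>Field l. \<forall>\<eta>\<in>Field l. (\<forall>j\<in>F. x \<xi> j = y j) \<longrightarrow> (\<forall>j\<in>F. x \<eta> j = y j) \<longrightarrow> \<xi> = \<eta>)"
  shows "mrowka_star l"
proof -
  obtain p where p: "inj_on p I" "p ` I \<subseteq> Field l"
    using ordLeq_imp_inj[OF ordLeq_transitive[OF I card_of_Field_leq(2)[OF l(1)]]] .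
  have "\<exists>c. inj_on c (S j) \<and> c ` S j \<subseteq> Field l" if "j \<in> I" for j
    using ordLeq_imp_inj[OF ordLeq_transitive[OF ordLess_imp_ordLeq[OF S[OF that]] card_of_Field_leq(2)[OF l(1)]]]
    by metis
  then have "\<forall>j\<in>I. \<exists>c. inj_on c (S j) \<and> c ` S j \<subseteq> Field l" by blast
  from bchoice[OF this] obtain c where "\<forall>j\<in>I. inj_on (c j) (S j) \<and> c j ` S j \<subseteq> Field l" by (elim exE)
  then have c: "\<And>j. j \<in> I \<Longrightarrow> inj_on (c j) (S j)" by simp
  define q where "q = inv_into I p"
  have qp: "q (p j) = j" if "j \<in> I" for j using p(1) that by (simp add: q_def)
  define S' where "S' i = (if i \<in> p ` I then c (q i) ` S (q i) else {i})" for i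
  define x' where "x' \<xi> = restrict (\<lambda>i. if i \<in> p ` I then c (q i) (x \<xi> (q i)) else i) (Field l)" for \<xi>
  have S'p: "S' (p j) = c j ` S j" if "j \<in> I" for j using that qp by (simp add: S'_def)
  have x'p: "x' \<xi> (p j) = c j (x \<xi> j)" if "j \<in> I" for \<xi> j using that qp p(2) by (auto simp: x'_def)
  let ?P = "product_topology (\<lambda>i. discrete_topology (S' i)) (Field l)"
  have S'l: "|S' i| <o l" if i: "i \<in> Field l" for i
  proof (cases "i \<in> p ` I")
    case True
    then obtain j where "j \<in> I" "i = p j" by blast
    then show ?thesis using S'p ordLeq_ordLess_trans[OF card_of_image S] by auto
  next
    case False
    then show ?thesis unfolding S'_def using infinite_Card_order_finite_less[OF l, of "{i}"] by simp
  qed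
  have x'P: "x' \<xi> \<in> topspace ?P" if "\<xi> \<in> Field l" for \<xi>
    using x[OF that] qp by (auto simp: x'_def S'_def)
  have "closed_discrete_in ?P (x' ` Field l)"
  proof (rule closed_discrete_inI)
    show "t1_space ?P" by (intro t1_space_product) (simp add: t1_space_closedin_singleton)
    show "x' ` Field l \<subseteq> topspace ?P" using x'P by blast
    fix y assume y: "y \<in> topspace ?P"
    have "y (p j) \<in> c j ` S j" if "j \<in> I" for j
    proof -
      have "p j \<in> Field l" using p(2) that by blast
      then have "y (p j) \<in> S' (p j)" using y by auto
      then show ?thesis using S'p[OF that] by simp
    qed
    then have "\<forall>j. \<exists>z. j \<in> I \<longrightarrow> z \<in> S j \<and> y (p j) = c j z" by blast
    then obtain z where z: "\<And>j. j \<in> I \<Longrightarrow> z j \<in> S j" "\<And>j. j \<in> I \<Longrightarrow> y (p j) = c j (z j)" by metis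
    obtain F where F: "finite F" "F \<subseteq> I"
      "\<forall>\<xi>\<in>Field l. \<forall>\<eta>\<in>Field l. (\<forall>j\<in>F. x \<xi> j = z j) \<longrightarrow> (\<forall>j\<in>F. x \<eta> j = z j) \<longrightarrow> \<xi> = \<eta>"
      using sep[of z] z(1) by auto
    let ?U = "{w \<in> topspace ?P. \<forall>i\<in>p ` F. w i \<in> {y i}}"
    have "openin ?P ?U"
    proof (rule openin_box)
      show "finite (p ` F)" "p ` F \<subseteq> Field l" using F(1,2) p(2) by blast+
      show "openin (discrete_topology (S' i)) {y i}" if "i \<in> p ` F" for i
        using that y p(2) F(2) by (auto simp: PiE_iff subset_iff)
    qed
    moreover have "x \<xi> j = z j" if "\<xi> \<in> Field l" "x' \<xi> \<in> ?U" "j \<in> F" for \<xi> j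
    proof -
      have j: "j \<in> I" using F(2) that by blast
      have "c j (x \<xi> j) = c j (z j)" using that(2,3) x'p[OF j] z(2)[OF j] by auto
      then show ?thesis using c[OF j] x[OF that(1) j] z(1)[OF j] by (auto dest: inj_onD)
    qed
    then have "\<xi> = \<eta>" if "\<xi> \<in> Field l" "x' \<xi> \<in> ?U" "\<eta> \<in> Field l" "x' \<eta> \<in> ?U" for \<xi> \<eta>
      using that F(3)[rule_format, of \<xi> \<eta>] by auto
    then have "\<forall>a b. a \<in> x' ` Field l \<and> a \<in> ?U \<longrightarrow> b \<in> x' ` Field l \<and> b \<in> ?U \<longrightarrow> a = b" by blast
    ultimately show "\<exists>U. openin ?P U \<and> y \<in> U \<and> (\<forall>a b. a \<in> x' ` Field l \<and> a \<in> U \<longrightarrow> b \<in> x' ` Field l \<and> b \<in> U \<longrightarrow> a = b)"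
      using y by (intro exI[of _ ?U]) auto
  qed
  moreover have "inj_on x' (Field l)"
  proof (rule inj_onI)
    fix \<xi> \<eta> assume h: "\<xi> \<in> Field l" "\<eta> \<in> Field l" "x' \<xi> = x' \<eta>"
    have eq: "x \<eta> j = x \<xi> j" if j: "j \<in> I" for j
      using x'p[OF j, of \<xi>] x'p[OF j, of \<eta>] h(3) x[OF h(1) j] x[OF h(2) j] c[OF j] by (auto dest: inj_onD)
    obtain F where F: "F \<subseteq> I" "\<forall>\<xi>'\<in>Field l. \<forall>\<eta>\<in>Field l.
        (\<forall>j\<in>F. x \<xi>' j = x \<xi> j) \<longrightarrow> (\<forall>j\<in>F. x \<eta> j = x \<xi> j) \<longrightarrow> \<xi>' = \<eta>"
      using sep[of "x \<xi>"] x[OF h(1)] by auto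
    then show "\<xi> = \<eta>" using h eq by (auto simp: subset_iff)
  qed
  then have "( |Field l|, |x' ` Field l| ) \<in> ordIso"
    using card_of_ordIso[of "Field l" "x' ` Field l"] by (auto simp: bij_betw_def)
  then have "( |x' ` Field l|, l) \<in> ordIso"
    using card_of_Field_ordIso[OF l(1)] ordIso_symmetric ordIso_transitive by blast
  ultimately show ?thesis
    unfolding mrowka_star_def using S'l by blast
qed

text \<open>
  A family of \<open>l\<close> many conditions without a common solution, any fewer of which have one, yields
  points \<open>x\<^sub>\<xi>\<close> satisfying the conditions before \<open>\<xi>\<close>. They are not yet closed discrete, but every
  point has a neighbourhood meeting only an initial segment of them; the extra coordinates
  \<open>min \<xi> \<eta>\<close> separate the points of that segment.
\<close>

lemma not_mrowka_star_compactness: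
  fixes l :: "'i rel" and S :: "'j \<Rightarrow> 'b set" and H :: "(('j \<Rightarrow> 'b) \<Rightarrow> bool) set"
  assumes l: "Card_order l" "infinite (Field l)" and m: "\<not> mrowka_star l" and H: "|H| \<le>o l"
    and fin: "\<And>h. h \<in> H \<Longrightarrow> \<exists>F. finite F \<and> (\<forall>j\<in>F. |S j| <o l) \<and> (\<forall>x y. (\<forall>j\<in>F. x j = y j) \<longrightarrow> h x \<longrightarrow> h y)"
    and part: "\<And>H'. H' \<subseteq> H \<Longrightarrow> |H'| <o l \<Longrightarrow> \<exists>x. (\<forall>j. x j \<in> S j) \<and> (\<forall>h\<in>H'. h x)"
  shows "\<exists>x. (\<forall>j. x j \<in> S j) \<and> (\<forall>h\<in>H. h x)"
proof (rule ccontr)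
  assume no: "\<nexists>x. (\<forall>j. x j \<in> S j) \<and> (\<forall>h\<in>H. h x)"
  have wo: "Well_order l" using l(1) by (simp add: card_order_on_def)
  then interpret wo_rel l by (simp add: wo_rel_def)
  have "H \<noteq> {}"
    using no part[of "{}"] infinite_Card_order_finite_less[OF l, of "{}"] by auto
  obtain e where e: "e ` Field l = H"
    using card_of_ordLeq2[OF \<open>H \<noteq> {}\<close>, of "Field l"] ordLeq_transitive[OF H card_of_Field_leq(2)[OF l(1)]] by auto
  have "\<forall>h\<in>H. \<exists>F. finite F \<and> (\<forall>j\<in>F. |S j| <o l) \<and> (\<forall>x y. (\<forall>j\<in>F. x j = y j) \<longrightarrow> h x \<longrightarrow> h y)"
    using fin by blast
  from bchoice[OF this] obtain F where F0: "\<forall>h\<in>H. finite (F h) \<and> (\<forall>j\<in>F h. |S j| <o l) \<and>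
      (\<forall>x y. (\<forall>j\<in>F h. x j = y j) \<longrightarrow> h x \<longrightarrow> h y)" by (elim exE)
  have F: "finite (F h)" "\<And>j. j \<in> F h \<Longrightarrow> |S j| <o l" "\<And>x y. (\<And>j. j \<in> F h \<Longrightarrow> x j = y j) \<Longrightarrow> h x \<Longrightarrow> h y"
    if "h \<in> H" for h
    using bspec[OF F0 that] by (simp, simp, blast)
  \<comment> \<open>The index type may be large, but only the coordinates in some support matter,
    and these are at most \<open>l\<close> many.\<close>
  define J where "J = (\<Union>h\<in>H. F h)"
  have J: "|J| \<le>o l"
    unfolding J_def
    by (intro card_of_UNION_ordLeq_infinite_Field l H ballI ordLess_imp_ordLeq infinite_Card_order_finite_less[OF l] F(1))
  have "\<exists>x. (\<forall>j. x j \<in> S j) \<and> (\<forall>\<eta>\<in>underS \<xi>. e \<eta> x)" if "\<xi> \<in> Field l" for \<xi>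
  proof -
    have "|e ` underS \<xi>| <o l"
      using card_of_image card_of_underS[OF l(1) that] by (rule ordLeq_ordLess_trans)
    moreover have "underS \<xi> \<subseteq> Field l" by (auto simp: underS_def Field_def)
    then have "e ` underS \<xi> \<subseteq> H" using e by blast
    ultimately show ?thesis using part[of "e ` underS \<xi>"] by auto
  qed
  then obtain x where x: "\<And>\<xi> j. \<xi> \<in> Field l \<Longrightarrow> x \<xi> j \<in> S j"
      "\<And>\<xi> \<eta>. \<xi> \<in> Field l \<Longrightarrow> \<eta> \<in> underS \<xi> \<Longrightarrow> e \<eta> (x \<xi>)"
    by metis
  obtain \<xi>0 where \<xi>0: "\<xi>0 \<in> Field l" using l(2) by fastforce
  define I where "I = Inl ` J \<union> Inr ` Field l"
  \<comment> \<open>The coordinate \<open>Inr \<eta>\<close> takes values up to \<eta> only; since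
    \<open>l\<close> is a cardinal order, this factor has fewer than \<open>l\<close>
    points.\<close>
  define S' where "S' = case_sum (\<lambda>j. Inl ` S j) (\<lambda>\<eta>. Inr ` under \<eta> :: ('b + 'i) set)"
  define x' where "x' \<xi> = case_sum (\<lambda>j. Inl (x \<xi> j)) (\<lambda>\<eta>. Inr (if (\<xi>, \<eta>) \<in> l then \<xi> else \<eta>))" for \<xi>
  have under: "|under \<eta>| <o l" if "\<eta> \<in> Field l" for \<eta>
  proof -
    have "|underS \<eta> \<union> {\<eta>}| <o l"
      using l card_of_underS[OF l(1) that] infinite_Card_order_finite_less[OF l, of "{\<eta>}"]
      by (intro card_of_Un_ordLess_infinite_Field) auto
    moreover have "under \<eta> \<subseteq> underS \<eta> \<union> {\<eta>}" by (auto simp: under_def underS_def)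
    ultimately show ?thesis using card_of_mono1 ordLeq_ordLess_trans by blast
  qed
  have "mrowka_star l"
  proof (rule mrowka_starI[OF l, of I S' x'])
    have "|Inl ` J| \<le>o l" "|Inr ` Field l| \<le>o l"
      using ordLeq_transitive[OF card_of_image J] ordLeq_transitive[OF card_of_image card_of_Field_leq(1)[OF l(1)]]
      by auto
    then show "|I| \<le>o l" unfolding I_def using l by (intro card_of_Un_ordLeq_infinite_Field) auto
    show "|S' j| <o l" if "j \<in> I" for j
    proof -
      have "|S k| <o l" if "k \<in> J" for k using that F(2) by (auto simp: J_def)
      then show ?thesis
        using that under by (auto simp: I_def S'_def intro!: ordLeq_ordLess_trans[OF card_of_image])
    qed
    show "x' \<xi> j \<in> S' j" if "\<xi> \<in> Field l" "j \<in> I" for \<xi> j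
      using that x(1) REFL by (auto simp: x'_def S'_def I_def under_def refl_on_def)
    fix y assume y: "\<And>j. j \<in> I \<Longrightarrow> y j \<in> S' j"
    \<comment> \<open>Outside \<open>J\<close> the admissible values of \<open>x \<xi>0\<close> are
      borrowed, to have a point of the whole product that must violate some condition.\<close>
    define z where "z j = (if j \<in> J then projl (y (Inl j)) else x \<xi>0 j)" for j
    have yz: "z j \<in> S j \<and> y (Inl j) = Inl (z j)" if "j \<in> J" for j
      using y[of "Inl j"] that by (auto simp: I_def S'_def z_def)
    have "z j \<in> S j" for j
      using yz[of j] x(1)[OF \<xi>0] by (cases "j \<in> J") (auto simp: z_def)
    then obtain h where h: "h \<in> H" "\<not> h z" using no by blast
    obtain \<eta> where \<eta>: "\<eta> \<in> Field l" "h = e \<eta>" using e h(1) by blast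
    let ?F = "insert (Inr \<eta>) (Inl ` F h)"
    \<comment> \<open>The condition \<open>e \<eta>\<close> fails at \<open>z\<close>, hence at
      every \<open>x \<xi>\<close> agreeing with \<open>z\<close> on its support. So \<eta> does not
      precede \<xi>, and the coordinate \<open>Inr \<eta>\<close> shows \<xi> itself instead of a
      truncated value.\<close>
    have char: "y (Inr \<eta>) = Inr \<xi>" if \<xi>: "\<xi> \<in> Field l" "\<forall>j\<in>?F. x' \<xi> j = y j" for \<xi>
    proof -
      have "x \<xi> j = z j" if "j \<in> F h" for j
      proof -
        have "j \<in> J" using that h(1) by (auto simp: J_def)
        then show ?thesis using \<xi>(2) that yz[of j] by (auto simp: x'_def)
      qed
      then have "\<not> h (x \<xi>)" using F(3)[OF h(1), of "x \<xi>" z] h(2) by blast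
      then have "\<eta> \<notin> underS \<xi>" using x(2)[OF \<xi>(1), of \<eta>] \<eta>(2) by blast
      then have "(\<xi>, \<eta>) \<in> l"
        using TOTALS \<xi>(1) \<eta>(1) REFL by (auto simp: underS_def refl_on_def)
      then show ?thesis using \<xi>(2) by (auto simp: x'_def)
    qed
    show "\<exists>F. finite F \<and> F \<subseteq> I \<and>
      (\<forall>\<xi>\<in>Field l. \<forall>\<eta>\<in>Field l. (\<forall>j\<in>F. x' \<xi> j = y j) \<longrightarrow> (\<forall>j\<in>F. x' \<eta> j = y j) \<longrightarrow> \<xi> = \<eta>)"
    proof (intro exI[of _ ?F] conjI ballI impI)
      show "finite ?F" using F(1)[OF h(1)] by simp
      show "?F \<subseteq> I" using h(1) \<eta>(1) by (auto simp: I_def J_def)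
      fix \<xi> \<zeta> assume a: "\<xi> \<in> Field l" "\<zeta> \<in> Field l" "\<forall>j\<in>?F. x' \<xi> j = y j" "\<forall>j\<in>?F. x' \<zeta> j = y j"
      from char[OF a(1,3)] char[OF a(2,4)] have "(Inr \<xi> :: 'b + 'i) = Inr \<zeta>" by (rule trans[OF sym])
      then show "\<xi> = \<zeta>" by simp
    qed
  qed
  from m this show False by (rule notE)
qed

section \<open>Skolem terms and valuations\<close>

text \<open>A pair of a quantified formula and one of its bound variables serves as a Skolem
  function symbol. The only variable, \<open>Var ()\<close>, names a default element and guarantees
  that terms exist.\<close>

type_synonym ('f, 'p, 'i) sk = "('f + ('f, 'p, 'i) fm \<times> 'i, unit) trm"

primrec inst :: "('v \<Rightarrow> ('f + 'g, 'w) trm) \<Rightarrow> ('f, 'v) trm \<Rightarrow> ('f + 'g, 'w) trm" where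
  "inst e (Var v) = e v"
| "inst e (App f ts) = App (Inl f) (map (inst e) ts)"

text \<open>Skolem symbols and formula atoms take lists of arguments, so the free variables need one
  fixed order; there is one whenever they are finitely many.\<close>

definition fvl :: "('f, 'p, 'i) fm \<Rightarrow> 'i list" where
  "fvl \<phi> = (SOME vs. set vs = fv \<phi>)"

text \<open>These are the coordinates of the product. \<open>AFm\<close> keeps only the terms put
  for the free variables, so environments that agree there share an atom.\<close>

datatype ('f, 'p, 'i) atm =
    AEq "('f, 'p, 'i) sk" "('f, 'p, 'i) sk"
  | ARel 'p "('f, 'p, 'i) sk list"
  | AFm "('f, 'p, 'i) fm" "('f, 'p, 'i) sk list"

abbreviation afm :: "('f, 'p, 'i) fm \<Rightarrow> ('i \<Rightarrow> ('f, 'p, 'i) sk) \<Rightarrow> ('f, 'p, 'i) atm" where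
  "afm \<phi> e \<equiv> AFm \<phi> (map e (fvl \<phi>))"

text \<open>
  A valuation assigns to each atom an optional index. A false conjunction and a true disjunction
  carry the index of a responsible member; for all other atoms only \<^term>\<open>None\<close> (false) versus
  \<^term>\<open>Some i\<close> (true) matters.
\<close>

definition holds :: "('f, 'p, 'i) fm \<Rightarrow> 'i option \<Rightarrow> bool" where
  "holds \<phi> a \<longleftrightarrow> (case \<phi> of Conj I \<Phi> \<Rightarrow> a = None | _ \<Rightarrow> a \<noteq> None)"

type_synonym ('f, 'p, 'i) vtn = "('f, 'p, 'i) atm \<Rightarrow> 'i option"

definition val :: "('f, 'p, 'i) vtn \<Rightarrow> ('f, 'p, 'i) fm \<Rightarrow> ('i \<Rightarrow> ('f, 'p, 'i) sk) \<Rightarrow> bool" where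
  "val x \<phi> e \<longleftrightarrow> holds \<phi> (x (afm \<phi> e))"

text \<open>For \<open>Exists\<close> the Skolem terms name witnesses for the whole block
  \<open>vs\<close>; for \<open>Forall\<close> they name a counterexample if there is one.\<close>

definition wit :: "('f, 'p, 'i) fm \<Rightarrow> 'i list \<Rightarrow> ('i \<Rightarrow> ('f, 'p, 'i) sk) \<Rightarrow> 'i \<Rightarrow> ('f, 'p, 'i) sk" where
  "wit \<phi> vs e = override_on e (\<lambda>v. App (Inr (\<phi>, v)) (map e (fvl \<phi>))) (set vs)"

text \<open>The Henkin requirements on a valuation. In the quantifier clauses \<open>e\<close>
  occurs on both sides: the requirement is imposed for all environments, and the atom of a
  quantified formula ignores the values at \<open>vs\<close>, so varying \<open>e\<close> there
  covers all instances of the body.\<close>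

primrec ok :: "('f, 'p, 'i) fm \<Rightarrow> 'i \<Rightarrow> ('i \<Rightarrow> ('f, 'p, 'i) sk) \<Rightarrow> ('f, 'p, 'i) vtn \<Rightarrow> bool" where
  "ok (Eql s t) i e x \<longleftrightarrow> (val x (Eql s t) e \<longleftrightarrow> x (AEq (inst e s) (inst e t)) \<noteq> None)"
| "ok (Rel p ts) i e x \<longleftrightarrow> (val x (Rel p ts) e \<longleftrightarrow> x (ARel p (map (inst e) ts)) \<noteq> None)"
| "ok (Neg \<phi>) i e x \<longleftrightarrow> (val x (Neg \<phi>) e \<longleftrightarrow> \<not> val x \<phi> e)"
| "ok (Conj I \<Phi>) i e x \<longleftrightarrow> (val x (Conj I \<Phi>) e \<longrightarrow> val x (\<Phi> i) e) \<and>
     (x (afm (Conj I \<Phi>) e) = Some i \<longrightarrow> \<not> val x (\<Phi> i) e)"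
| "ok (Disj I \<Phi>) i e x \<longleftrightarrow> (val x (\<Phi> i) e \<longrightarrow> val x (Disj I \<Phi>) e) \<and>
     (x (afm (Disj I \<Phi>) e) = Some i \<longrightarrow> val x (\<Phi> i) e)"
| "ok (Forall vs \<phi>) i e x \<longleftrightarrow> (val x (Forall vs \<phi>) e \<longrightarrow> val x \<phi> e) \<and>
     (val x \<phi> (wit (Forall vs \<phi>) vs e) \<longrightarrow> val x (Forall vs \<phi>) e)"
| "ok (Exists vs \<phi>) i e x \<longleftrightarrow> (val x \<phi> e \<longrightarrow> val x (Exists vs \<phi>) e) \<and>
     (val x (Exists vs \<phi>) e \<longrightarrow> val x \<phi> (wit (Exists vs \<phi>) vs e))"

text \<open>For a conjunction or disjunction the constraint \<^const>\<open>ok\<close> is imposed for each index.\<close>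

definition idx :: "('f, 'p, 'i) fm \<Rightarrow> 'i set" where
  "idx \<phi> = (case \<phi> of Conj I \<Phi> \<Rightarrow> I | Disj I \<Phi> \<Rightarrow> I | _ \<Rightarrow> {undefined})"

text \<open>The variables whose values \<open>ok\<close> can see. A quantifier contributes its bound
  variables because \<open>ok\<close> also evaluates the body in \<open>e\<close>.\<close>

definition scope :: "('f, 'p, 'i) fm \<Rightarrow> 'i set" where
  "scope \<phi> = fv \<phi> \<union> (case \<phi> of Forall vs _ \<Rightarrow> set vs | Exists vs _ \<Rightarrow> set vs | _ \<Rightarrow> {})"

primrec subfms :: "('f, 'p, 'i) fm \<Rightarrow> ('f, 'p, 'i) fm set" where
  "subfms (Eql s t) = {Eql s t}"
| "subfms (Rel p ts) = {Rel p ts}"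
| "subfms (Neg \<phi>) = insert (Neg \<phi>) (subfms \<phi>)"
| "subfms (Conj I \<Phi>) = insert (Conj I \<Phi>) (\<Union>i\<in>I. subfms (\<Phi> i))"
| "subfms (Disj I \<Phi>) = insert (Disj I \<Phi>) (\<Union>i\<in>I. subfms (\<Phi> i))"
| "subfms (Forall vs \<phi>) = insert (Forall vs \<phi>) (subfms \<phi>)"
| "subfms (Exists vs \<phi>) = insert (Exists vs \<phi>) (subfms \<phi>)"

text \<open>The symbols contributed by the formula at its top level. Building terms from the symbols
  of the subformulas only keeps their number within \<open>l\<close>, whatever the size of the
  signature.\<close>

primrec syms :: "('f, 'p, 'i) fm \<Rightarrow> ('f + ('f, 'p, 'i) fm \<times> 'i) set" where
  "syms (Eql s t) = Inl ` (set1_trm s \<union> set1_trm t)"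
| "syms (Rel p ts) = Inl ` (\<Union>t\<in>set ts. set1_trm t)"
| "syms (Neg \<phi>) = {}"
| "syms (Conj I \<Phi>) = {}"
| "syms (Disj I \<Phi>) = {}"
| "syms (Forall vs \<phi>) = (\<lambda>v. Inr (Forall vs \<phi>, v)) ` set vs"
| "syms (Exists vs \<phi>) = (\<lambda>v. Inr (Exists vs \<phi>, v)) ` set vs"

primrec preds :: "('f, 'p, 'i) fm \<Rightarrow> 'p set" where
  "preds (Eql s t) = {}"
| "preds (Rel p ts) = {p}"
| "preds (Neg \<phi>) = {}"
| "preds (Conj I \<Phi>) = {}"
| "preds (Disj I \<Phi>) = {}"
| "preds (Forall vs \<phi>) = {}"
| "preds (Exists vs \<phi>) = {}"

section \<open>Sizes of the sets of subformulas, symbols and terms\<close>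

lemma finite_set1_trm: "finite (set1_trm t)"
  by (induction t) auto

lemma finite_syms: "finite (syms \<phi>)"
  by (cases \<phi>) (auto simp: finite_set1_trm)

lemma finite_preds: "finite (preds \<phi>)"
  by (cases \<phi>) auto

lemma subfms_refl: "\<phi> \<in> subfms \<phi>"
  by (cases \<phi>) auto

lemma subfms_trans: "\<psi> \<in> subfms \<phi> \<Longrightarrow> subfms \<psi> \<subseteq> subfms \<phi>"
  by (induction \<phi>) auto

lemma in_lang_subfms: "\<psi> \<in> subfms \<phi> \<Longrightarrow> in_lang l \<phi> \<Longrightarrow> in_lang l \<psi>"
  by (induction \<phi>) auto

lemma finite_fv_subfms: "\<psi> \<in> subfms \<phi> \<Longrightarrow> finite (fv \<phi>) \<Longrightarrow> finite (fv \<psi>)"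
proof (induction \<phi>)
  case (Conj I \<Phi>)
  show ?case
  proof (cases "\<psi> = Conj I \<Phi>")
    case False
    then obtain i where "i \<in> I" "\<psi> \<in> subfms (\<Phi> i)" using Conj.prems(1) by auto
    moreover have "fv (\<Phi> i) \<subseteq> fv (Conj I \<Phi>)" using \<open>i \<in> I\<close> by auto
    then have "finite (fv (\<Phi> i))" using Conj.prems(2) by (rule finite_subset)
    ultimately show ?thesis using Conj.IH by blast
  qed (use Conj.prems in simp)
next
  case (Disj I \<Phi>)
  show ?case
  proof (cases "\<psi> = Disj I \<Phi>")
    case False
    then obtain i where "i \<in> I" "\<psi> \<in> subfms (\<Phi> i)" using Disj.prems(1) by auto
    moreover have "fv (\<Phi> i) \<subseteq> fv (Disj I \<Phi>)" using \<open>i \<in> I\<close> by auto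
    then have "finite (fv (\<Phi> i))" using Disj.prems(2) by (rule finite_subset)
    ultimately show ?thesis using Disj.IH by blast
  qed (use Disj.prems in simp)
qed auto

lemma set_fvl: "finite (fv \<phi>) \<Longrightarrow> set (fvl \<phi>) = fv \<phi>"
  unfolding fvl_def by (rule someI_ex) (rule finite_list)

lemma finite_scope: "finite (fv \<phi>) \<Longrightarrow> finite (scope \<phi>)"
  by (cases \<phi>) (auto simp: scope_def)

lemma card_of_subfms:
  assumes B: "infinite B" "l \<le>o |B|" and "in_lang l \<phi>"
  shows "|subfms \<phi>| \<le>o |B|"
  using assms(3)
proof (induction \<phi>)
  have sing: "|{\<psi>}| \<le>o |B|" for \<psi> :: "('f, 'p, 'i) fm"
    using B(1) by (intro card_of_singl_ordLeq) auto
  have ins: "|insert \<psi> A| \<le>o |B|" if "|A| \<le>o |B|" for \<psi> :: "('f, 'p, 'i) fm" and A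
    using card_of_Un_bound[OF B(1) sing that, of \<psi>] by simp
  {
    case (Eql s t) show ?case by (simp add: sing)
  next
    case (Rel p ts) show ?case by (simp add: sing)
  next
    case (Neg \<phi>) then show ?case by (simp add: ins)
  next
    case (Conj I \<Phi>)
    then have "|I| \<le>o |B|" using ordLeq_transitive[OF ordLess_imp_ordLeq B(2)] by auto
    then have "|\<Union>i\<in>I. subfms (\<Phi> i)| \<le>o |B|"
      using B(1) Conj by (intro card_of_UNION_ordLeq_infinite) auto
    then show ?case by (simp add: ins)
  next
    case (Disj I \<Phi>)
    then have "|I| \<le>o |B|" using ordLeq_transitive[OF ordLess_imp_ordLeq B(2)] by auto
    then have "|\<Union>i\<in>I. subfms (\<Phi> i)| \<le>o |B|"
      using B(1) Disj by (intro card_of_UNION_ordLeq_infinite) auto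
    then show ?case by (simp add: ins)
  next
    case (Forall vs \<phi>) then show ?case by (simp add: ins)
  next
    case (Exists vs \<phi>) then show ?case by (simp add: ins)
  }
qed

primrec code :: "(('h \<times> 'b list) option \<Rightarrow> 'b) \<Rightarrow> ('h, 'v) trm \<Rightarrow> 'b" where
  "code g (Var v) = g None"
| "code g (App h ts) = g (Some (h, map (code g) ts))"

text \<open>An infinite \<open>B\<close> absorbs one element together with all pairs of a symbol and
  a list over \<open>B\<close>. Folding such an injection \<open>g\<close> along a term, as
  \<open>code\<close> does, is injective by induction.\<close>

lemma card_of_trms:
  fixes A :: "'h set"
  assumes B: "infinite B" "|A| \<le>o |B|"
  shows "|{t :: ('h, unit) trm. set1_trm t \<subseteq> A}| \<le>o |B|"
proof -
  have "|lists B| \<le>o |B|" using B(1) by (rule card_of_lists_bound) (rule card_of_mono1, simp)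
  then have "|A \<times> lists B| \<le>o |B|" using B by (intro card_of_Sigma_ordLeq_infinite) auto
  then have "|Some ` (A \<times> lists B)| \<le>o |B|" using ordLeq_transitive[OF card_of_image] by blast
  moreover have "|{None :: ('h \<times> 'a list) option}| \<le>o |B|"
    using B(1) by (intro card_of_singl_ordLeq) auto
  ultimately have "|{None} \<union> Some ` (A \<times> lists B)| \<le>o |B|" using B(1) by (intro card_of_Un_bound)
  then obtain g where g: "inj_on g ({None} \<union> Some ` (A \<times> lists B))" "g ` ({None} \<union> Some ` (A \<times> lists B)) \<subseteq> B"
    by (rule ordLeq_imp_inj)
  have cB: "code g t \<in> B" if "set1_trm t \<subseteq> A" for t :: "('h, unit) trm"
    using that
  proof (induction t)
    case (App h ts)
    have "h \<in> A" using App.prems by simp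
    moreover have "code g t \<in> B" if "t \<in> set ts" for t
      using App.prems that by (intro App.IH) auto
    ultimately have "(h, map (code g) ts) \<in> A \<times> lists B" by auto
    then have "Some (h, map (code g) ts) \<in> {None} \<union> Some ` (A \<times> lists B)" by (intro UnI2 imageI)
    then have "g (Some (h, map (code g) ts)) \<in> B" using g(2) by blast
    then show ?case by simp
  qed (use g(2) in auto)
  have cL: "(h, map (code g) ts) \<in> A \<times> lists B" if "set1_trm (App h ts :: ('h, unit) trm) \<subseteq> A" for h ts
  proof -
    have "code g t \<in> B" if "t \<in> set ts" for t
      using \<open>set1_trm (App h ts) \<subseteq> A\<close> that by (intro cB) auto
    then show ?thesis using that by auto
  qed
  have "s = t" if "code g s = code g t" "set1_trm s \<subseteq> A" "set1_trm t \<subseteq> A" for s t :: "('h, unit) trm"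
    using that
  proof (induction s arbitrary: t)
    case (Var x)
    show ?case
    proof (cases t)
      case t: (App h ts)
      have "(h, map (code g) ts) \<in> A \<times> lists B" using cL Var.prems(3) t by blast
      then have "None = Some (h, map (code g) ts)"
        using Var.prems(1) t by (intro inj_onD[OF g(1)]) auto
      then show ?thesis by simp
    qed simp
  next
    case (App h ss)
    have 1: "(h, map (code g) ss) \<in> A \<times> lists B" using cL App.prems(2) by blast
    show ?case
    proof (cases t)
      case t: (Var v)
      have "Some (h, map (code g) ss) = None"
        using App.prems(1) t 1 by (intro inj_onD[OF g(1)]) auto
      then show ?thesis by simp
    next
      case t: (App k ts)
      have "(k, map (code g) ts) \<in> A \<times> lists B" using cL App.prems(3) t by blast
      then have "Some (h, map (code g) ss) = Some (k, map (code g) ts)"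
        using App.prems(1) t 1 by (intro inj_onD[OF g(1)]) auto
      then have eq: "h = k" "map (code g) ss = map (code g) ts" by simp_all
      have "ss = ts"
      proof (rule nth_equalityI)
        show len: "length ss = length ts" using eq(2) by (rule map_eq_imp_length_eq)
        fix i assume i: "i < length ss"
        have "code g (ss ! i) = code g (ts ! i)" using arg_cong[OF eq(2), of "\<lambda>xs. xs ! i"] i len by simp
        moreover have "ss ! i \<in> set ss" "ts ! i \<in> set ts" using i len by auto
        ultimately show "ss ! i = ts ! i"
          using App.prems(2,3) t by (intro App.IH) auto
      qed
      then show ?thesis using t eq(1) by simp
    qed
  qed
  then have "inj_on (code g) {t :: ('h, unit) trm. set1_trm t \<subseteq> A}" by (intro inj_onI) auto
  then show ?thesis using cB by (intro card_of_ordLeqI[of "code g"]) auto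
qed

section \<open>Dependence of satisfaction and valuations on the free variables\<close>

lemma sat_Forall_iff:
  "sat M e (Forall vs \<phi>) \<longleftrightarrow> (\<forall>d. (\<forall>v\<in>set vs. d v \<in> universe M) \<longrightarrow> sat M (override_on e d (set vs)) \<phi>)"
proof -
  have 1: "override_on e d (set vs) = d" if "\<forall>v. v \<notin> set vs \<longrightarrow> d v = e v" for d
    using that by (auto simp: override_on_def)
  show ?thesis
  proof
    assume L: "sat M e (Forall vs \<phi>)"
    show "\<forall>d. (\<forall>v\<in>set vs. d v \<in> universe M) \<longrightarrow> sat M (override_on e d (set vs)) \<phi>"
    proof (intro allI impI)
      fix d assume "\<forall>v\<in>set vs. d v \<in> universe M"
      then show "sat M (override_on e d (set vs)) \<phi>"
        using L[unfolded sat.simps, rule_format, of "override_on e d (set vs)"] by simp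
    qed
  next
    assume R: "\<forall>d. (\<forall>v\<in>set vs. d v \<in> universe M) \<longrightarrow> sat M (override_on e d (set vs)) \<phi>"
    have "sat M d \<phi>" if "\<forall>v\<in>set vs. d v \<in> universe M" "\<forall>v. v \<notin> set vs \<longrightarrow> d v = e v" for d
      using R[rule_format, of d] that(1) 1[OF that(2)] by simp
    then show "sat M e (Forall vs \<phi>)" by simp
  qed
qed

lemma sat_Exists_iff:
  "sat M e (Exists vs \<phi>) \<longleftrightarrow> (\<exists>d. (\<forall>v\<in>set vs. d v \<in> universe M) \<and> sat M (override_on e d (set vs)) \<phi>)"
  using sat_Forall_iff[of M e vs "Neg \<phi>"] by auto

lemma eval_trm_cong: "(\<And>v. v \<in> fv_trm t \<Longrightarrow> d v = e v) \<Longrightarrow> eval_trm M d t = eval_trm M e t"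
proof (induction t)
  case (App f ts)
  have "map (eval_trm M d) ts = map (eval_trm M e) ts" by (rule map_cong) (use App in auto)
  then show ?case by (simp del: map_eq_conv)
qed auto

lemma sat_cong: "(\<And>v. v \<in> fv \<phi> \<Longrightarrow> d v = e v) \<Longrightarrow> sat M d \<phi> \<longleftrightarrow> sat M e \<phi>"
proof (induction \<phi> arbitrary: d e)
  case (Eql s t)
  then show ?case using eval_trm_cong[of s d e M] eval_trm_cong[of t d e M] by simp
next
  case (Rel p ts)
  have "eval_trm M d t = eval_trm M e t" if "t \<in> set ts" for t
    by (rule eval_trm_cong) (use Rel that in auto)
  then have "map (eval_trm M d) ts = map (eval_trm M e) ts" by (intro map_cong refl)
  then show ?case by (simp del: map_eq_conv)
next
  case (Neg \<phi>)
  have "sat M d \<phi> \<longleftrightarrow> sat M e \<phi>" by (rule Neg.IH) (use Neg.prems in auto)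
  then show ?case by simp
next
  case (Conj I \<Phi>)
  have "sat M d (\<Phi> i) \<longleftrightarrow> sat M e (\<Phi> i)" if "i \<in> I" for i by (rule Conj) (use that Conj.prems in auto)
  then show ?case by simp
next
  case (Disj I \<Phi>)
  have "sat M d (\<Phi> i) \<longleftrightarrow> sat M e (\<Phi> i)" if "i \<in> I" for i by (rule Disj) (use that Disj.prems in auto)
  then show ?case by simp
next
  case (Forall vs \<phi>)
  have "sat M (override_on d c (set vs)) \<phi> \<longleftrightarrow> sat M (override_on e c (set vs)) \<phi>" for c
    by (rule Forall.IH) (use Forall.prems in \<open>auto simp: override_on_def\<close>)
  then show ?case by (simp only: sat_Forall_iff)
next
  case (Exists vs \<phi>)
  have "sat M (override_on d c (set vs)) \<phi> \<longleftrightarrow> sat M (override_on e c (set vs)) \<phi>" for c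
    by (rule Exists.IH) (use Exists.prems in \<open>auto simp: override_on_def\<close>)
  then show ?case by (simp only: sat_Exists_iff)
qed

lemma inst_cong: "(\<And>v. v \<in> fv_trm t \<Longrightarrow> d v = e v) \<Longrightarrow> inst d t = inst e t"
proof (induction t)
  case (App f ts)
  have "map (inst d) ts = map (inst e) ts" by (rule map_cong) (use App in auto)
  then show ?case by simp
qed auto

lemma afm_cong:
  assumes "finite (fv \<phi>)" "\<And>v. v \<in> fv \<phi> \<Longrightarrow> d v = e v"
  shows "afm \<phi> d = afm \<phi> e"
  using assms by (simp add: set_fvl)

lemma val_cong:
  assumes "finite (fv \<phi>)" "\<And>v. v \<in> fv \<phi> \<Longrightarrow> d v = e v"
  shows "val x \<phi> d = val x \<phi> e"
  unfolding val_def by (rule arg_cong[OF afm_cong[OF assms], where f = "\<lambda>a. holds \<phi> (x a)"])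

section \<open>The valuation of a model\<close>

text \<open>The factor at each coordinate. It has fewer than \<open>l\<close> points for formulas of
  the language; at other formula atoms it may be large, so size is controlled only on the supports
  of the conditions.\<close>

definition vals :: "('f, 'p, 'i) atm \<Rightarrow> 'i option set" where
  "vals a = (case a of AFm \<phi> ts \<Rightarrow> insert None (Some ` idx \<phi>) | _ \<Rightarrow> {None, Some undefined})"

definition envl :: "'u \<Rightarrow> 'v list \<Rightarrow> 'u list \<Rightarrow> 'v \<Rightarrow> 'u" where
  "envl u vs us v = (case map_of (zip vs us) v of Some w \<Rightarrow> w | None \<Rightarrow> u)"

lemma envl_map: "v \<in> set vs \<Longrightarrow> envl u vs (map d vs) v = d v"
  by (simp add: envl_def map_of_zip_map)

text \<open>One choice yields values for the whole block \<open>vs\<close>, and the symbol of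
  \<open>v\<close> returns the component at \<open>v\<close>, so the components fit together. Values
  outside the universe are replaced by \<open>u\<close>, which makes the function total on the
  structure.\<close>

definition skolem :: "('f, 'p, 'u) struct \<Rightarrow> 'u \<Rightarrow> ('f, 'p, 'i) fm \<times> 'i \<Rightarrow> 'u list \<Rightarrow> 'u" where
  "skolem M u h us = (let e = envl u (fvl (fst h)) us; w = (case fst h of
       Forall vs \<psi> \<Rightarrow> (SOME d. (\<forall>v\<in>set vs. d v \<in> universe M) \<and> \<not> sat M (override_on e d (set vs)) \<psi>) (snd h)
     | Exists vs \<psi> \<Rightarrow> (SOME d. (\<forall>v\<in>set vs. d v \<in> universe M) \<and> sat M (override_on e d (set vs)) \<psi>) (snd h)
     | _ \<Rightarrow> u) in if w \<in> universe M then w else u)"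

definition skolem_ext :: "('f, 'p, 'u) struct \<Rightarrow> 'u \<Rightarrow> ('f + ('f, 'p, 'i) fm \<times> 'i, 'p, 'u) struct" where
  "skolem_ext M u = \<lparr>universe = universe M, fun_interp = case_sum (fun_interp M) (skolem M u),
     rel_interp = rel_interp M\<rparr>"

abbreviation ev :: "('f, 'p, 'u) struct \<Rightarrow> 'u \<Rightarrow> ('f, 'p, 'i) sk \<Rightarrow> 'u" where
  "ev M u \<equiv> eval_trm (skolem_ext M u) (\<lambda>_. u)"

definition flag :: "bool \<Rightarrow> 'i option" where
  "flag b = (if b then Some undefined else None)"

lemma flag_None [simp]: "flag b = None \<longleftrightarrow> \<not> b" "(\<exists>i. flag b = Some i) \<longleftrightarrow> b"
  by (simp_all add: flag_def)

definition valuation_of :: "('f, 'p, 'u) struct \<Rightarrow> 'u \<Rightarrow> ('f, 'p, 'i) vtn" where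
  "valuation_of M u a = (case a of
      AEq s t \<Rightarrow> flag (ev M u s = ev M u t)
    | ARel p ts \<Rightarrow> flag (rel_interp M p (map (ev M u) ts))
    | AFm \<phi> ts \<Rightarrow> (let d = envl u (fvl \<phi>) (map (ev M u) ts) in (case \<phi> of
        Conj I \<Phi> \<Rightarrow> if \<forall>i\<in>I. sat M d (\<Phi> i) then None else Some (SOME i. i \<in> I \<and> \<not> sat M d (\<Phi> i))
      | Disj I \<Phi> \<Rightarrow> if \<exists>i\<in>I. sat M d (\<Phi> i) then Some (SOME i. i \<in> I \<and> sat M d (\<Phi> i)) else None
      | _ \<Rightarrow> flag (sat M d \<phi>))))"

lemma valuation_of_vals: "valuation_of M u a \<in> vals a"
proof (cases a)
  case (AFm \<phi> ts)
  define d where "d = envl u (fvl \<phi>) (map (ev M u) ts)"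
  show ?thesis
  proof (cases \<phi>)
    case (Conj I \<Phi>)
    have "(SOME i. i \<in> I \<and> \<not> sat M d (\<Phi> i)) \<in> I" if "\<not> (\<forall>i\<in>I. sat M d (\<Phi> i))"
      using someI_ex[of "\<lambda>i. i \<in> I \<and> \<not> sat M d (\<Phi> i)"] that by blast
    then show ?thesis using AFm Conj by (auto simp: valuation_of_def vals_def idx_def d_def Let_def)
  next
    case (Disj I \<Phi>)
    have "(SOME i. i \<in> I \<and> sat M d (\<Phi> i)) \<in> I" if "\<exists>i\<in>I. sat M d (\<Phi> i)"
      using someI_ex[of "\<lambda>i. i \<in> I \<and> sat M d (\<Phi> i)"] that by blast
    then show ?thesis using AFm Disj by (auto simp: valuation_of_def vals_def idx_def d_def Let_def)
  qed (auto simp: AFm valuation_of_def vals_def idx_def flag_def Let_def)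
qed (auto simp: valuation_of_def vals_def flag_def)

lemma ev_in_universe:
  assumes "is_struct M" "u \<in> universe M" shows "ev M u t \<in> universe M"
proof (induction t)
  case (App h ts)
  then have "map (ev M u) ts \<in> lists (universe M)" by auto
  then show ?case using assms
    by (cases h) (auto simp: skolem_ext_def is_struct_def skolem_def Let_def)
qed (use assms in simp)

lemma ev_inst: "ev M u (inst e s) = eval_trm M (\<lambda>v. ev M u (e v)) s"
proof (induction s)
  case (App f ts)
  then have "map (\<lambda>t. ev M u (inst e t)) ts = map (eval_trm M (\<lambda>v. ev M u (e v))) ts" by simp
  then show ?case by (simp add: skolem_ext_def comp_def del: map_eq_conv)
qed simp

lemma sat_envl:
  assumes "finite (fv \<phi>)" "fv \<psi> \<subseteq> fv \<phi>"
  shows "sat M (envl u (fvl \<phi>) (map (ev M u) (map e (fvl \<phi>)))) \<psi> \<longleftrightarrow> sat M (\<lambda>v. ev M u (e v)) \<psi>"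
proof (rule sat_cong)
  fix v assume "v \<in> fv \<psi>"
  then have "v \<in> set (fvl \<phi>)" using assms by (auto simp: set_fvl)
  then show "envl u (fvl \<phi>) (map (ev M u) (map e (fvl \<phi>))) v = ev M u (e v)"
    by (simp add: envl_map[of v "fvl \<phi>" u "\<lambda>v. ev M u (e v)"] comp_def)
qed

lemma val_valuation_of:
  assumes "finite (fv \<phi>)"
  shows "val (valuation_of M u) \<phi> e \<longleftrightarrow> sat M (\<lambda>v. ev M u (e v)) \<phi>"
proof -
  let ?d = "envl u (fvl \<phi>) (map (ev M u) (map e (fvl \<phi>)))"
  have "val (valuation_of M u) \<phi> e \<longleftrightarrow> sat M ?d \<phi>"
    by (cases \<phi>) (simp_all only: val_def holds_def valuation_of_def atm.case fm.case Let_def flag_None sat.simps, auto)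
  then show ?thesis using sat_envl[OF assms, of \<phi> M u e] by simp
qed

lemma ev_wit:
  "(\<lambda>v. ev M u (wit \<phi> vs e v)) = override_on (\<lambda>v. ev M u (e v))
     (\<lambda>v. skolem M u (\<phi>, v) (map (ev M u) (map e (fvl \<phi>)))) (set vs)"
  by (auto simp: fun_eq_iff wit_def override_on_def skolem_ext_def)

lemma ok_valuation_of:
  fixes \<phi> :: "('f, 'p, 'i) fm"
  assumes M: "is_struct M" "u \<in> universe M" and fin: "finite (fv \<phi>)" and i: "i \<in> idx \<phi>"
  shows "ok \<phi> i e (valuation_of M u)"
proof -
  let ?E = "\<lambda>v. ev M u (e v)"
  let ?us = "map (ev M u) (map e (fvl \<phi>))"
  let ?d = "envl u (fvl \<phi>) ?us"
  \<comment> \<open>\<open>skolem\<close> makes its choice in the environment \<open>?d\<close>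
    rebuilt from a list of values, while \<open>ok\<close> concerns \<open>?E\<close>; the two agree
    on the free variables of \<open>\<phi>\<close>.\<close>
  have dE: "sat M (override_on ?d c (set vs)) \<psi> \<longleftrightarrow> sat M (override_on ?E c (set vs)) \<psi>"
    if "fv \<psi> - set vs \<subseteq> fv \<phi>" for c vs and \<psi> :: "('f, 'p, 'i) fm"
  proof (rule sat_cong)
    fix v assume v: "v \<in> fv \<psi>"
    show "override_on ?d c (set vs) v = override_on ?E c (set vs) v"
    proof (cases "v \<in> set vs")
      case False
      then have "v \<in> set (fvl \<phi>)" using that v fin by (auto simp: set_fvl)
      then show ?thesis using False by (simp add: envl_map[of v "fvl \<phi>" u "\<lambda>v. ev M u (e v)"] comp_def)
    qed simp
  qed
  have EU: "?E v \<in> universe M" for v using ev_in_universe[OF M] .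
  show ?thesis
  proof (cases \<phi>)
    case (Eql s t)
    then show ?thesis using fin by (simp add: val_valuation_of ev_inst) (simp add: valuation_of_def ev_inst)
  next
    case (Rel p ts)
    then show ?thesis using fin
      by (simp add: val_valuation_of) (simp add: valuation_of_def ev_inst comp_def)
  next
    case (Neg \<psi>)
    then show ?thesis using fin by (simp add: val_valuation_of)
  next
    case (Conj I \<Phi>)
    have iI: "i \<in> I" using i Conj by (simp add: idx_def)
    then have f: "finite (fv (\<Phi> i))" "fv (\<Phi> i) \<subseteq> fv \<phi>" using fin Conj by (auto intro: finite_subset[rotated])
    have "\<not> sat M ?E (\<Phi> i)" if "valuation_of M u (afm \<phi> e) = Some i"
    proof -
      have "\<exists>j. j \<in> I \<and> \<not> sat M ?d (\<Phi> j)" "i = (SOME j. j \<in> I \<and> \<not> sat M ?d (\<Phi> j))"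
        using that Conj by (auto simp: valuation_of_def Let_def split: if_splits)
      then have "\<not> sat M ?d (\<Phi> i)" using someI_ex[of "\<lambda>j. j \<in> I \<and> \<not> sat M ?d (\<Phi> j)"] by simp
      then show ?thesis using sat_envl[OF fin f(2), of M u e] by simp
    qed
    moreover have "val (valuation_of M u) (Conj I \<Phi>) e \<longleftrightarrow> sat M ?E (Conj I \<Phi>)"
      using fin Conj by (intro val_valuation_of) auto
    moreover have "val (valuation_of M u) (\<Phi> i) e \<longleftrightarrow> sat M ?E (\<Phi> i)" using f(1) by (rule val_valuation_of)
    ultimately show ?thesis using Conj iI by simp
  next
    case (Disj I \<Phi>)
    have iI: "i \<in> I" using i Disj by (simp add: idx_def)
    then have f: "finite (fv (\<Phi> i))" "fv (\<Phi> i) \<subseteq> fv \<phi>" using fin Disj by (auto intro: finite_subset[rotated])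
    have "sat M ?E (\<Phi> i)" if "valuation_of M u (afm \<phi> e) = Some i"
    proof -
      have "\<exists>j. j \<in> I \<and> sat M ?d (\<Phi> j)" "i = (SOME j. j \<in> I \<and> sat M ?d (\<Phi> j))"
        using that Disj by (auto simp: valuation_of_def Let_def split: if_splits)
      then have "sat M ?d (\<Phi> i)" using someI_ex[of "\<lambda>j. j \<in> I \<and> sat M ?d (\<Phi> j)"] by simp
      then show ?thesis using sat_envl[OF fin f(2), of M u e] by simp
    qed
    moreover have "val (valuation_of M u) (Disj I \<Phi>) e \<longleftrightarrow> sat M ?E (Disj I \<Phi>)"
      using fin Disj by (intro val_valuation_of) auto
    moreover have "val (valuation_of M u) (\<Phi> i) e \<longleftrightarrow> sat M ?E (\<Phi> i)" using f(1) by (rule val_valuation_of)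
    ultimately show ?thesis using Disj iI by auto
  next
    case (Forall vs \<psi>)
    have f: "finite (fv \<psi>)" "fv \<psi> - set vs \<subseteq> fv \<phi>" using fin Forall by auto
    have v1: "val (valuation_of M u) \<phi> e \<longleftrightarrow> sat M ?E (Forall vs \<psi>)"
      using val_valuation_of[OF fin, of M u e] Forall by (simp only:)
    have v2: "val (valuation_of M u) \<psi> e' \<longleftrightarrow> sat M (\<lambda>v. ev M u (e' v)) \<psi>" for e'
      using f(1) by (rule val_valuation_of)
    have "sat M ?E \<psi>" if "sat M ?E (Forall vs \<psi>)"
    proof -
      have "sat M (override_on ?E ?E (set vs)) \<psi>" using that[unfolded sat_Forall_iff, rule_format, of ?E] EU by simp
      then show ?thesis by (simp add: override_on_def)
    qed
    moreover have "sat M ?E (Forall vs \<psi>)" if w: "sat M (\<lambda>v. ev M u (wit \<phi> vs e v)) \<psi>"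
    proof (rule ccontr)
      \<comment> \<open>This is the predicate under the choice operator in \<open>skolem\<close>, so
        the Skolem values at \<open>vs\<close> form one counterexample vector.\<close>
      define P where "P c \<longleftrightarrow> (\<forall>v\<in>set vs. c v \<in> universe M) \<and> \<not> sat M (override_on ?d c (set vs)) \<psi>" for c
      assume "\<not> sat M ?E (Forall vs \<psi>)"
      then have "\<exists>c. P c" unfolding P_def dE[OF f(2)] sat_Forall_iff by blast
      then have P: "P (SOME c. P c)" by (rule someI_ex)
      have "skolem M u (\<phi>, v) ?us = (SOME c. P c) v" if "v \<in> set vs" for v
        using P that unfolding P_def by (simp add: skolem_def Let_def Forall)
      then have "override_on ?E (\<lambda>v. skolem M u (\<phi>, v) ?us) (set vs) = override_on ?E (SOME c. P c) (set vs)"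
        by (auto simp: override_on_def)
      then show False using w P unfolding ev_wit P_def dE[OF f(2)] by simp
    qed
    ultimately show ?thesis using v1 v2 Forall by simp
  next
    case (Exists vs \<psi>)
    have f: "finite (fv \<psi>)" "fv \<psi> - set vs \<subseteq> fv \<phi>" using fin Exists by auto
    have v1: "val (valuation_of M u) \<phi> e \<longleftrightarrow> sat M ?E (Exists vs \<psi>)"
      using val_valuation_of[OF fin, of M u e] Exists by (simp only:)
    have v2: "val (valuation_of M u) \<psi> e' \<longleftrightarrow> sat M (\<lambda>v. ev M u (e' v)) \<psi>" for e'
      using f(1) by (rule val_valuation_of)
    have "sat M ?E (Exists vs \<psi>)" if "sat M ?E \<psi>"
    proof -
      have "sat M (override_on ?E ?E (set vs)) \<psi>" using that by (simp add: override_on_def)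
      then show ?thesis using EU unfolding sat_Exists_iff by (intro exI[of _ ?E]) simp
    qed
    moreover have "sat M (\<lambda>v. ev M u (wit \<phi> vs e v)) \<psi>" if ex: "sat M ?E (Exists vs \<psi>)"
    proof -
      define P where "P c \<longleftrightarrow> (\<forall>v\<in>set vs. c v \<in> universe M) \<and> sat M (override_on ?d c (set vs)) \<psi>" for c
      have "\<exists>c. P c" using ex unfolding P_def dE[OF f(2)] sat_Exists_iff by blast
      then have P: "P (SOME c. P c)" by (rule someI_ex)
      have "skolem M u (\<phi>, v) ?us = (SOME c. P c) v" if "v \<in> set vs" for v
        using P that unfolding P_def by (simp add: skolem_def Let_def Exists)
      then have "override_on ?E (\<lambda>v. skolem M u (\<phi>, v) ?us) (set vs) = override_on ?E (SOME c. P c) (set vs)"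
        by (auto simp: override_on_def)
      then show ?thesis using P unfolding ev_wit P_def dE[OF f(2)] by simp
    qed
    ultimately show ?thesis using v1 v2 Exists by simp
  qed
qed

section \<open>Finite dependence of the constraints\<close>

lemma val_dep: "x (afm \<phi> e) = y (afm \<phi> e) \<Longrightarrow> val x \<phi> e = val y \<phi> e"
  by (simp add: val_def)

text \<open>For an infinite conjunction or disjunction, \<open>ok\<close> compares the value of the
  whole with the one member \<open>i\<close>; so besides the atom of the formula itself at most two
  atoms are read.\<close>

lemma ok_support:
  fixes l :: "'i rel" and \<phi> :: "('f, 'p, 'i) fm"
  assumes small: "\<And>a. (case a of AFm \<psi> ts \<Rightarrow> in_lang l \<psi> | _ \<Rightarrow> True) \<Longrightarrow> |vals (a :: ('f, 'p, 'i) atm)| <o l"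
    and \<phi>: "in_lang l \<phi>" "i \<in> idx \<phi>"
  shows "\<exists>F. finite F \<and> (\<forall>a\<in>F. |vals a| <o l) \<and> (\<forall>x y. (\<forall>a\<in>F. x a = y a) \<longrightarrow> ok \<phi> i e x \<longrightarrow> ok \<phi> i e y)"
proof -
  define F where "F = insert (afm \<phi> e) (case \<phi> of
      Eql s t \<Rightarrow> {AEq (inst e s) (inst e t)}
    | Rel p ts \<Rightarrow> {ARel p (map (inst e) ts)}
    | Neg \<psi> \<Rightarrow> {afm \<psi> e}
    | Conj I \<Phi> \<Rightarrow> {afm (\<Phi> i) e}
    | Disj I \<Phi> \<Rightarrow> {afm (\<Phi> i) e}
    | Forall vs \<psi> \<Rightarrow> {afm \<psi> e, afm \<psi> (wit \<phi> vs e)}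
    | Exists vs \<psi> \<Rightarrow> {afm \<psi> e, afm \<psi> (wit \<phi> vs e)})"
  have "finite F" by (cases \<phi>) (simp_all add: F_def)
  moreover have "|vals a| <o l" if "a \<in> F" for a
    using that \<phi> by (intro small) (cases \<phi>; auto simp: F_def idx_def)
  moreover have "ok \<phi> i e y" if "\<forall>a\<in>F. x a = y a" "ok \<phi> i e x" for x y
    using that val_dep[of x _ _ y] by (cases \<phi>) (simp_all add: F_def)
  ultimately show ?thesis by blast
qed

text \<open>Environments assign terms to all variables, and there may be more than \<open>l\<close>
  of them. Since only the finite scope counts, finite lists of terms can replace them when the
  conditions are counted.\<close>

lemma ok_cong:
  assumes fin: "finite (fv \<phi>)" and i: "i \<in> idx \<phi>" and de: "\<And>v. v \<in> scope \<phi> \<Longrightarrow> d v = e v"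
  shows "ok \<phi> i d x = ok \<phi> i e x"
proof -
  have val: "val x \<psi> d = val x \<psi> e" if "finite (fv \<psi>)" "fv \<psi> \<subseteq> scope \<phi>" for \<psi>
    using that de by (intro val_cong) auto
  have fvs: "fv \<phi> \<subseteq> scope \<phi>" by (auto simp: scope_def)
  have self: "afm \<phi> d = afm \<phi> e" using fvs de by (intro afm_cong[OF fin]) auto
  have wit: "val x \<psi> (wit \<phi> vs d) = val x \<psi> (wit \<phi> vs e)" if "finite (fv \<psi>)" "fv \<psi> - set vs \<subseteq> fv \<phi>" for vs \<psi>
  proof (rule val_cong[OF that(1)])
    fix v assume "v \<in> fv \<psi>"
    then show "wit \<phi> vs d v = wit \<phi> vs e v"
      using self that(2) fvs de by (auto simp: wit_def override_on_def)
  qed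
  show ?thesis
  proof (cases \<phi>)
    case (Eql s t)
    have "inst d s = inst e s" "inst d t = inst e t"
      using de Eql by (auto intro!: inst_cong simp: scope_def)
    then show ?thesis using val[OF fin fvs] Eql by simp
  next
    case (Rel p ts)
    have "inst d t = inst e t" if "t \<in> set ts" for t
      using de Rel that by (auto intro!: inst_cong simp: scope_def)
    then have "map (inst d) ts = map (inst e) ts" by (intro map_cong refl)
    then show ?thesis using val[OF fin fvs] Rel by (simp del: map_eq_conv)
  next
    case (Neg \<psi>)
    then show ?thesis using val[OF fin fvs] val[of \<psi>] fin fvs by simp
  next
    case (Conj I \<Phi>)
    then have iI: "i \<in> I" using i by (simp add: idx_def)
    then have "fv (\<Phi> i) \<subseteq> fv \<phi>" using Conj by auto
    then have "val x (\<Phi> i) d = val x (\<Phi> i) e" using fin fvs by (intro val) (auto intro: finite_subset)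
    then show ?thesis using val[OF fin fvs] self Conj by (simp del: map_eq_conv)
  next
    case (Disj I \<Phi>)
    then have iI: "i \<in> I" using i by (simp add: idx_def)
    then have "fv (\<Phi> i) \<subseteq> fv \<phi>" using Disj by auto
    then have "val x (\<Phi> i) d = val x (\<Phi> i) e" using fin fvs by (intro val) (auto intro: finite_subset)
    then show ?thesis using val[OF fin fvs] self Disj by (simp del: map_eq_conv)
  next
    case (Forall vs \<psi>)
    have f: "finite (fv \<psi>)" "fv \<psi> - set vs \<subseteq> fv \<phi>" "fv \<psi> \<subseteq> scope \<phi>" using fin Forall by (auto simp: scope_def)
    then show ?thesis using val[OF fin fvs] val[OF f(1,3)] wit[OF f(1,2)] Forall by simp
  next
    case (Exists vs \<psi>)
    have f: "finite (fv \<psi>)" "fv \<psi> - set vs \<subseteq> fv \<phi>" "fv \<psi> \<subseteq> scope \<phi>" using fin Exists by (auto simp: scope_def)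
    then show ?thesis using val[OF fin fvs] val[OF f(1,3)] wit[OF f(1,2)] Exists by simp
  qed
qed

section \<open>The model of a valuation\<close>

definition terms_over :: "('f + ('f, 'p, 'i) fm \<times> 'i) set \<Rightarrow> ('f, 'p, 'i) sk set" where
  "terms_over A = {t. set1_trm t \<subseteq> A}"

lemma Var_terms_over [simp]: "Var u \<in> terms_over A"
  by (simp add: terms_over_def)

lemma App_terms_over [simp]: "App h ts \<in> terms_over A \<longleftrightarrow> h \<in> A \<and> set ts \<subseteq> terms_over A"
  by (auto simp: terms_over_def)

lemma inst_terms_over:
  "Inl ` set1_trm s \<subseteq> A \<Longrightarrow> (\<And>v. e v \<in> terms_over A) \<Longrightarrow> inst e s \<in> terms_over A"
proof (induction s)
  case (App f ts)
  have "inst e t \<in> terms_over A" if "t \<in> set ts" for t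
    using App.prems that by (intro App.IH) auto
  then show ?case using App.prems by auto
qed simp

lemma wit_terms_over:
  assumes "(\<lambda>v. Inr (\<phi>, v)) ` set vs \<subseteq> A" "\<And>v. e v \<in> terms_over A"
  shows "wit \<phi> vs e v \<in> terms_over A"
  using assms by (auto simp: wit_def override_on_def)

text \<open>\<open>c\<close> codes the terms by elements of \<open>'i\<close>, where the model is to
  live. Congruence is imposed on the original symbols: Skolem terms act as names of elements, and
  for compound formulas the compatibility with \<open>eq\<close> comes out of
  \<open>truth\<close>.\<close>

locale henkin_valuation =
  fixes x :: "('f, 'p, 'i) vtn" and Sub :: "('f, 'p, 'i) fm set" and c :: "('f, 'p, 'i) sk \<Rightarrow> 'i"
    and A T eq
  defines "A \<equiv> \<Union>\<phi>\<in>Sub. syms \<phi>" and "T \<equiv> terms_over A" and "eq s t \<equiv> x (AEq s t) \<noteq> None"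
  assumes fin: "\<phi> \<in> Sub \<Longrightarrow> finite (fv \<phi>)"
    and closed: "\<phi> \<in> Sub \<Longrightarrow> subfms \<phi> \<subseteq> Sub"
    and inj: "inj_on c T"
    and eq_refl: "t \<in> T \<Longrightarrow> eq t t"
    and eq_euclid: "\<lbrakk>r \<in> T; s \<in> T; t \<in> T; eq r t; eq s t\<rbrakk> \<Longrightarrow> eq r s"
    and eq_fun: "\<lbrakk>Inl f \<in> A; ss \<in> lists T; ts \<in> lists T; list_all2 eq ss ts\<rbrakk> \<Longrightarrow> eq (App (Inl f) ss) (App (Inl f) ts)"
    and eq_rel: "\<lbrakk>p \<in> \<Union>(preds ` Sub); ss \<in> lists T; ts \<in> lists T; list_all2 eq ss ts; x (ARel p ss) \<noteq> None\<rbrakk>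
      \<Longrightarrow> x (ARel p ts) \<noteq> None"
    and ok: "\<lbrakk>\<phi> \<in> Sub; i \<in> idx \<phi>; \<And>v. e v \<in> T\<rbrakk> \<Longrightarrow> ok \<phi> i e x"
    and vals: "x a \<in> vals a"
begin

text \<open>The element named by \<open>t\<close>: the code of a term selected from the class of
  \<open>t\<close>, hence the same for equal terms.\<close>

definition q :: "('f, 'p, 'i) sk \<Rightarrow> 'i" where
  "q t = c (SOME s. s \<in> T \<and> eq t s)"

definition pick :: "'i \<Rightarrow> ('f, 'p, 'i) sk" where
  "pick u = (SOME t. t \<in> T \<and> q t = u)"

text \<open>Symbols outside \<open>A\<close> take the constant value \<open>q (Var ())\<close>, so
  that the universe is closed under all function symbols of the type.\<close>

definition N :: "('f, 'p, 'i) struct" where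
  "N = \<lparr>universe = q ` T,
    fun_interp = \<lambda>f us. if Inl f \<in> A \<and> us \<in> lists (q ` T) then q (App (Inl f) (map pick us)) else q (Var ()),
    rel_interp = \<lambda>p us. x (ARel p (map pick us)) \<noteq> None\<rparr>"

lemma eq_sym: "s \<in> T \<Longrightarrow> t \<in> T \<Longrightarrow> eq s t \<Longrightarrow> eq t s"
  using eq_euclid[of t s t] eq_refl[of t] by blast

lemma eq_trans: "r \<in> T \<Longrightarrow> s \<in> T \<Longrightarrow> t \<in> T \<Longrightarrow> eq r s \<Longrightarrow> eq s t \<Longrightarrow> eq r t"
  using eq_euclid[of r t s] eq_sym[of s t] by blast

lemma q_eq_iff:
  assumes "s \<in> T" "t \<in> T" shows "q s = q t \<longleftrightarrow> eq s t"
proof -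
  have rep: "(SOME s. s \<in> T \<and> eq t s) \<in> T \<and> eq t (SOME s. s \<in> T \<and> eq t s)" if "t \<in> T" for t
    using someI[of "\<lambda>s. s \<in> T \<and> eq t s" t] eq_refl[OF that] that by blast
  show ?thesis
  proof
    assume "q s = q t"
    then have "(SOME r. r \<in> T \<and> eq s r) = (SOME r. r \<in> T \<and> eq t r)"
      using rep[OF assms(1)] rep[OF assms(2)] inj unfolding q_def by (auto dest: inj_onD)
    then show "eq s t" using eq_euclid[OF assms] rep[OF assms(1)] rep[OF assms(2)] by auto
  next
    assume st: "eq s t"
    have "eq s r \<longleftrightarrow> eq t r" if "r \<in> T" for r
      using eq_trans[of s t r] eq_trans[of t s r] eq_sym[OF assms st] st that assms by blast
    then have "(\<lambda>r. r \<in> T \<and> eq s r) = (\<lambda>r. r \<in> T \<and> eq t r)" by blast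
    then show "q s = q t" by (simp add: q_def)
  qed
qed

lemma pick: "u \<in> q ` T \<Longrightarrow> pick u \<in> T \<and> q (pick u) = u"
  unfolding pick_def by (rule someI_ex) blast

lemma eq_pick: "t \<in> T \<Longrightarrow> eq (pick (q t)) t"
  using pick[of "q t"] q_eq_iff[of "pick (q t)" t] by simp

lemma q_fun:
  assumes "Inl f \<in> A" "set ts \<subseteq> T"
  shows "fun_interp N f (map q ts) = q (App (Inl f) ts)"
proof -
  have "list_all2 eq (map (\<lambda>t. pick (q t)) ts) ts"
    using assms(2) eq_pick by (auto simp: list_all2_conv_all_nth subset_iff)
  moreover have p: "set (map (\<lambda>t. pick (q t)) ts) \<subseteq> T" using assms(2) pick by auto
  ultimately have "eq (App (Inl f) (map (\<lambda>t. pick (q t)) ts)) (App (Inl f) ts)"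
    using assms by (intro eq_fun) auto
  then have "q (App (Inl f) (map (\<lambda>t. pick (q t)) ts)) = q (App (Inl f) ts)"
    using assms p by (subst q_eq_iff) (auto simp: T_def)
  moreover have "map q ts \<in> lists (q ` T)" using assms(2) by (auto simp: subset_iff)
  ultimately show ?thesis using assms(1) by (simp add: N_def comp_def)
qed

lemma q_rel:
  assumes "p \<in> \<Union>(preds ` Sub)" "set ts \<subseteq> T"
  shows "rel_interp N p (map q ts) \<longleftrightarrow> x (ARel p ts) \<noteq> None"
proof -
  let ?ss = "map (\<lambda>t. pick (q t)) ts"
  have l: "list_all2 eq ?ss ts"
    using assms(2) eq_pick by (auto simp: list_all2_conv_all_nth subset_iff)
  have p: "set ?ss \<subseteq> T" using assms(2) pick by auto
  have l': "list_all2 eq ts ?ss"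
    using assms(2) eq_pick eq_sym pick by (auto simp: list_all2_conv_all_nth subset_iff)
  have "x (ARel p ?ss) \<noteq> None \<longleftrightarrow> x (ARel p ts) \<noteq> None"
    using eq_rel[OF assms(1) _ _ l] eq_rel[OF assms(1) _ _ l'] assms(2) p by blast
  then show ?thesis by (simp add: N_def comp_def)
qed

lemma eval_N:
  assumes "Inl ` set1_trm s \<subseteq> A" "\<And>v. e v \<in> T"
  shows "eval_trm N (\<lambda>v. q (e v)) s = q (inst e s)"
  using assms(1)
proof (induction s)
  case (App f ts)
  have "eval_trm N (\<lambda>v. q (e v)) t = q (inst e t)" if "t \<in> set ts" for t
    using App.prems that by (intro App.IH) auto
  then have "map (eval_trm N (\<lambda>v. q (e v))) ts = map q (map (inst e) ts)" by simp
  moreover have "set (map (inst e) ts) \<subseteq> T"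
  proof -
    have "inst e t \<in> T" if "t \<in> set ts" for t
      using App.prems that assms(2) unfolding T_def by (intro inst_terms_over) auto
    then show ?thesis by auto
  qed
  ultimately show ?case using q_fun[of f "map (inst e) ts"] App.prems by (simp del: map_map map_eq_conv)
qed simp

lemma is_struct_N: "is_struct N"
proof -
  have "q (App (Inl f) (map pick us)) \<in> q ` T" if "Inl f \<in> A" "us \<in> lists (q ` T)" for f us
    using that pick by (intro imageI) (auto simp: T_def)
  moreover have "q (Var ()) \<in> q ` T" by (simp add: T_def)
  ultimately show ?thesis unfolding is_struct_def N_def by (auto simp del: in_lists_conv_set)
qed

text \<open>A conjunction with value \<open>Some i\<close> is refuted by its member
  \<open>i\<close>, which belongs to \<open>I\<close> because the value lies in \<open>vals\<close>;
  dually for disjunctions. For quantifiers one direction uses the Skolem terms; the other lifts an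
  arbitrary assignment in \<open>N\<close> to terms by \<open>pick\<close>.\<close>

lemma truth:
  "\<phi> \<in> Sub \<Longrightarrow> (\<And>v. e v \<in> T) \<Longrightarrow> sat N (\<lambda>v. q (e v)) \<phi> \<longleftrightarrow> val x \<phi> e"
proof (induction \<phi> arbitrary: e)
  case (Eql s t)
  have A: "Inl ` set1_trm s \<subseteq> A" "Inl ` set1_trm t \<subseteq> A" using Eql.prems(1) by (force simp: A_def)+
  then have "inst e s \<in> T" "inst e t \<in> T" using Eql.prems(2) unfolding T_def by (auto intro: inst_terms_over)
  then have "sat N (\<lambda>v. q (e v)) (Eql s t) \<longleftrightarrow> eq (inst e s) (inst e t)"
    using eval_N[OF A(1) Eql.prems(2)] eval_N[OF A(2) Eql.prems(2)] q_eq_iff by simp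
  then show ?case using ok[OF Eql.prems(1) _ Eql.prems(2), of undefined] by (simp add: idx_def eq_def)
next
  case (Rel p ts)
  have A: "Inl ` set1_trm t \<subseteq> A" if "t \<in> set ts" for t using Rel.prems(1) that by (force simp: A_def)
  have "inst e t \<in> T" if "t \<in> set ts" for t
    using A[OF that] Rel.prems(2) unfolding T_def by (auto intro: inst_terms_over)
  then have T: "set (map (inst e) ts) \<subseteq> T" by auto
  have "map (eval_trm N (\<lambda>v. q (e v))) ts = map q (map (inst e) ts)"
    using eval_N[OF A Rel.prems(2)] by simp
  moreover have "p \<in> \<Union>(preds ` Sub)" using Rel.prems(1) by force
  ultimately have "sat N (\<lambda>v. q (e v)) (Rel p ts) \<longleftrightarrow> x (ARel p (map (inst e) ts)) \<noteq> None"
    using q_rel[OF _ T] by (simp del: map_map map_eq_conv)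
  then show ?case using ok[OF Rel.prems(1) _ Rel.prems(2), of undefined] by (simp add: idx_def)
next
  case (Neg \<phi>)
  have "\<phi> \<in> Sub" using closed[OF Neg.prems(1)] subfms_refl[of \<phi>] by auto
  then show ?case
    using Neg.IH[of e] Neg.prems(2) ok[OF Neg.prems(1) _ Neg.prems(2), of undefined] by (simp add: idx_def)
next
  case (Conj I \<Phi>)
  have sub: "\<Phi> i \<in> Sub" if "i \<in> I" for i using closed[OF Conj.prems(1)] subfms_refl[of "\<Phi> i"] that by auto
  have IH: "sat N (\<lambda>v. q (e v)) (\<Phi> i) \<longleftrightarrow> val x (\<Phi> i) e" if "i \<in> I" for i
    using Conj.IH[of "\<Phi> i" e] sub[OF that] Conj.prems(2) by simp
  have ok': "ok (Conj I \<Phi>) i e x" if "i \<in> I" for i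
    using ok[OF Conj.prems(1) _ Conj.prems(2)] that by (simp add: idx_def)
  show ?case
  proof (cases "x (afm (Conj I \<Phi>) e)")
    case None
    then have "val x (Conj I \<Phi>) e" by (simp add: val_def holds_def)
    then show ?thesis using IH ok' by simp
  next
    case (Some i)
    then have "i \<in> I" using vals[of "afm (Conj I \<Phi>) e"] by (auto simp: vals_def idx_def)
    moreover have "\<not> val x (Conj I \<Phi>) e" using Some by (simp add: val_def holds_def)
    moreover have "\<not> val x (\<Phi> i) e" using ok'[OF \<open>i \<in> I\<close>] Some by simp
    ultimately show ?thesis using IH by auto
  qed
next
  case (Disj I \<Phi>)
  have sub: "\<Phi> i \<in> Sub" if "i \<in> I" for i using closed[OF Disj.prems(1)] subfms_refl[of "\<Phi> i"] that by auto
  have IH: "sat N (\<lambda>v. q (e v)) (\<Phi> i) \<longleftrightarrow> val x (\<Phi> i) e" if "i \<in> I" for i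
    using Disj.IH[of "\<Phi> i" e] sub[OF that] Disj.prems(2) by simp
  have ok': "ok (Disj I \<Phi>) i e x" if "i \<in> I" for i
    using ok[OF Disj.prems(1) _ Disj.prems(2)] that by (simp add: idx_def)
  show ?case
  proof (cases "x (afm (Disj I \<Phi>) e)")
    case None
    then have "\<not> val x (Disj I \<Phi>) e" by (simp add: val_def holds_def)
    then show ?thesis using IH ok' by simp
  next
    case (Some i)
    then have "i \<in> I" using vals[of "afm (Disj I \<Phi>) e"] by (auto simp: vals_def idx_def)
    moreover have "val x (Disj I \<Phi>) e" using Some by (simp add: val_def holds_def)
    moreover have "val x (\<Phi> i) e" using ok'[OF \<open>i \<in> I\<close>] Some by simp
    ultimately show ?thesis using IH by auto
  qed
next
  case (Forall vs \<phi>)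
  let ?F = "Forall vs \<phi>"
  have sub: "\<phi> \<in> Sub" using closed[OF Forall.prems(1)] subfms_refl[of \<phi>] by auto
  have ok': "ok ?F undefined d x" if "\<And>v. d v \<in> T" for d
    using ok[OF Forall.prems(1) _ that] by (simp add: idx_def)
  show ?case
  proof
    assume L: "sat N (\<lambda>v. q (e v)) ?F"
    have w: "wit ?F vs e v \<in> T" for v
      using Forall.prems unfolding T_def by (intro wit_terms_over) (force simp: A_def)+
    have "sat N (override_on (\<lambda>v. q (e v)) (\<lambda>v. q (wit ?F vs e v)) (set vs)) \<phi>"
      using L[unfolded sat_Forall_iff, rule_format, of "\<lambda>v. q (wit ?F vs e v)"] w by (simp add: N_def)
    moreover have "override_on (\<lambda>v. q (e v)) (\<lambda>v. q (wit ?F vs e v)) (set vs) = (\<lambda>v. q (wit ?F vs e v))"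
      by (auto simp: override_on_def wit_def)
    ultimately have "val x \<phi> (wit ?F vs e)" using Forall.IH[OF sub w] by simp
    then show "val x ?F e" using ok'[OF Forall.prems(2)] by simp
  next
    assume R: "val x ?F e"
    show "sat N (\<lambda>v. q (e v)) ?F"
      unfolding sat_Forall_iff
    proof (intro allI impI)
      fix d assume d: "\<forall>v\<in>set vs. d v \<in> universe N"
      define e' where "e' = override_on e (\<lambda>v. pick (d v)) (set vs)"
      have e'T: "e' v \<in> T" for v
        using d Forall.prems(2) pick by (auto simp: e'_def override_on_def N_def)
      \<comment> \<open>The quantified formula does not see the variables \<open>vs\<close>, so the
        constraint at \<open>e'\<close> turns its value at \<open>e\<close> into an instance of the
        body.\<close>
      have "val x ?F e' = val x ?F e"
        using fin[OF Forall.prems(1)] by (rule val_cong) (auto simp: e'_def override_on_def)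
      then have "val x \<phi> e'" using R ok'[OF e'T] by simp
      then have "sat N (\<lambda>v. q (e' v)) \<phi>" using Forall.IH[OF sub e'T] by simp
      moreover have "(\<lambda>v. q (e' v)) = override_on (\<lambda>v. q (e v)) d (set vs)"
        using d pick by (auto simp: e'_def override_on_def N_def)
      ultimately show "sat N (override_on (\<lambda>v. q (e v)) d (set vs)) \<phi>" by simp
    qed
  qed
next
  case (Exists vs \<phi>)
  let ?F = "Exists vs \<phi>"
  have sub: "\<phi> \<in> Sub" using closed[OF Exists.prems(1)] subfms_refl[of \<phi>] by auto
  have ok': "ok ?F undefined d x" if "\<And>v. d v \<in> T" for d
    using ok[OF Exists.prems(1) _ that] by (simp add: idx_def)
  show ?case
  proof
    assume R: "val x ?F e"
    have w: "wit ?F vs e v \<in> T" for v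
      using Exists.prems unfolding T_def by (intro wit_terms_over) (force simp: A_def)+
    have "val x \<phi> (wit ?F vs e)" using R ok'[OF Exists.prems(2)] by simp
    then have "sat N (\<lambda>v. q (wit ?F vs e v)) \<phi>" using Exists.IH[OF sub w] by simp
    moreover have "override_on (\<lambda>v. q (e v)) (\<lambda>v. q (wit ?F vs e v)) (set vs) = (\<lambda>v. q (wit ?F vs e v))"
      by (auto simp: override_on_def wit_def)
    ultimately show "sat N (\<lambda>v. q (e v)) ?F"
      unfolding sat_Exists_iff using w by (intro exI[of _ "\<lambda>v. q (wit ?F vs e v)"]) (simp add: N_def)
  next
    assume "sat N (\<lambda>v. q (e v)) ?F"
    then obtain d where d: "\<forall>v\<in>set vs. d v \<in> universe N" "sat N (override_on (\<lambda>v. q (e v)) d (set vs)) \<phi>"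
      unfolding sat_Exists_iff by blast
    define e' where "e' = override_on e (\<lambda>v. pick (d v)) (set vs)"
    have e'T: "e' v \<in> T" for v
      using d(1) Exists.prems(2) pick by (auto simp: e'_def override_on_def N_def)
    have "(\<lambda>v. q (e' v)) = override_on (\<lambda>v. q (e v)) d (set vs)"
      using d(1) pick by (auto simp: e'_def override_on_def N_def)
    then have "val x \<phi> e'" using Exists.IH[OF sub, of e'] e'T d(2) by simp
    then have "val x ?F e'" using ok'[OF e'T] by simp
    moreover have "val x ?F e' = val x ?F e"
      using fin[OF Exists.prems(1)] by (rule val_cong) (auto simp: e'_def override_on_def)
    ultimately show "val x ?F e" by simp
  qed
qed

lemma has_model_sentence:
  assumes "\<Sigma> \<subseteq> Sub" "\<And>\<sigma>. \<sigma> \<in> \<Sigma> \<Longrightarrow> fv \<sigma> = {} \<and> val x \<sigma> (\<lambda>_. Var ())"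
  shows "has_model TYPE('i) \<Sigma>"
  unfolding has_model_def
proof (intro exI[of _ N] conjI ballI allI impI is_struct_N)
  fix \<sigma> e assume \<sigma>: "\<sigma> \<in> \<Sigma>"
  have "sat N (\<lambda>_. q (Var ())) \<sigma>"
    using truth[of \<sigma> "\<lambda>_. Var ()"] assms \<sigma> by (auto simp: T_def)
  then show "sat N e \<sigma>" using sat_cong[of \<sigma> e "\<lambda>_. q (Var ())" N] assms(2)[OF \<sigma>] by simp
qed

end

section \<open>Weak compactness\<close>

definition finitely_supported :: "'i rel \<Rightarrow> ('j \<Rightarrow> 'b set) \<Rightarrow> (('j \<Rightarrow> 'b) \<Rightarrow> bool) \<Rightarrow> bool" where
  "finitely_supported l S h \<longleftrightarrow>
     (\<exists>F. finite F \<and> (\<forall>j\<in>F. |S j| <o l) \<and> (\<forall>x y. (\<forall>j\<in>F. x j = y j) \<longrightarrow> h x \<longrightarrow> h y))"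

lemma finitely_supportedI:
  assumes "finite F" "\<And>j. j \<in> F \<Longrightarrow> |S j| <o l" "\<And>x y. \<lbrakk>\<forall>j\<in>F. x j = y j; h x\<rbrakk> \<Longrightarrow> h y"
  shows "finitely_supported l S h"
  unfolding finitely_supported_def by (intro exI[of _ F]) (use assms in simp)

lemma card_of_vals:
  fixes a :: "('f, 'p, 'i) atm"
  assumes l: "Card_order l" "infinite (Field l)" and a: "case a of AFm \<psi> ts \<Rightarrow> in_lang l \<psi> | _ \<Rightarrow> True"
  shows "|vals a| <o l"
proof (cases a)
  case (AFm \<psi> ts)
  have "|idx \<psi>| <o l"
    using a AFm infinite_Card_order_finite_less[OF l, of "{undefined}"] by (cases \<psi>) (auto simp: idx_def)
  then have "|Some ` idx \<psi>| <o l" by (rule ordLeq_ordLess_trans[OF card_of_image])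
  moreover have "|{None :: 'i option}| <o l" by (rule infinite_Card_order_finite_less[OF l]) simp
  ultimately have "|{None} \<union> Some ` idx \<psi>| <o l"
    using l by (intro card_of_Un_ordLess_infinite_Field) auto
  then show ?thesis by (simp add: AFm vals_def)
qed (auto simp: vals_def intro!: infinite_Card_order_finite_less[OF l])

definition scope_list :: "('f, 'p, 'i) fm \<Rightarrow> 'i list" where
  "scope_list \<phi> = (SOME vs. set vs = scope \<phi>)"

lemma set_scope_list: "finite (fv \<phi>) \<Longrightarrow> set (scope_list \<phi>) = scope \<phi>"
  unfolding scope_list_def by (rule someI_ex) (rule finite_list[OF finite_scope])

text \<open>The conditions on a valuation are the Henkin requirements over \<open>Sub\<close> and
  \<open>T\<close> together with the truth of each sentence. Fewer than \<open>l\<close> of them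
  involve fewer than \<open>l\<close> sentences, and the valuation of a model of these satisfies the
  Henkin requirements as well, since the valuation of any structure does. Compactness gives a
  valuation satisfying all conditions, and its term model satisfies \<open>\<Sigma>\<close>.\<close>

theorem weakly_compact_lang_if_not_mrowka_star:
  fixes l :: "'i rel"
  assumes l: "Card_order l" "infinite (Field l)" and m: "\<not> mrowka_star l"
  shows "weakly_compact_lang TYPE('f) TYPE('p) TYPE('u) l"
  unfolding weakly_compact_lang_def
proof (intro allI impI, elim conjE)
  fix \<Sigma> :: "('f, 'p, 'i) fm set"
  assume sent: "\<Sigma> \<subseteq> sentences l" and card: "|\<Sigma>| \<le>o l"
    and part: "\<forall>\<Sigma>'. \<Sigma>' \<subseteq> \<Sigma> \<and> |\<Sigma>'| <o l \<longrightarrow> has_model TYPE('u) \<Sigma>'"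
  define B where "B = Field l"
  have B: "infinite B" "l \<le>o |B|" "|B| \<le>o l" using l card_of_Field_leq[OF l(1)] by (auto simp: B_def)
  have UN: "|\<Union>i\<in>I. S i| \<le>o |B|" if "|I| \<le>o |B|" "\<And>i. i \<in> I \<Longrightarrow> |S i| \<le>o |B|" for I :: "'z set" and S :: "'z \<Rightarrow> 'y set"
    using B(1) that by (intro card_of_UNION_ordLeq_infinite) auto
  have finB: "|S| \<le>o |B|" if "finite S" for S :: "'z set"
    by (rule ordLeq_transitive[OF ordLess_imp_ordLeq[OF infinite_Card_order_finite_less[OF l that]] B(2)])
  have prodB: "|S \<times> S'| \<le>o |B|" if "|S| \<le>o |B|" "|S'| \<le>o |B|" for S :: "'z set" and S' :: "'y set"
    using B(1) that by (intro card_of_Sigma_ordLeq_infinite) auto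
  have imB: "|f ` S| \<le>o |B|" if "|S| \<le>o |B|" for f :: "'z \<Rightarrow> 'y" and S
    using ordLeq_transitive[OF card_of_image that] .
  have \<Sigma>: "in_lang l \<sigma>" "fv \<sigma> = {}" if "\<sigma> \<in> \<Sigma>" for \<sigma> using sent that by (auto simp: sentences_def)
  have \<Sigma>B: "|\<Sigma>| \<le>o |B|" using card B(2) by (rule ordLeq_transitive)
  define Sub where "Sub = (\<Union>\<sigma>\<in>\<Sigma>. subfms \<sigma>)"
  define A where "A = (\<Union>\<phi>\<in>Sub. syms \<phi>)"
  define T where "T = terms_over A"
  define P where "P = \<Union>(preds ` Sub)"
  define V0 :: "('f, 'p, 'i) sk" where "V0 = Var ()"
  have SubB: "|Sub| \<le>o |B|"
    unfolding Sub_def using \<Sigma>B card_of_subfms[OF B(1,2) \<Sigma>(1)] by (rule UN)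
  have AB: "|A| \<le>o |B|" unfolding A_def using SubB finB[OF finite_syms] by (rule UN)
  have PB: "|P| \<le>o |B|" unfolding P_def using SubB finB[OF finite_preds] by (rule UN)
  have TB: "|T| \<le>o |B|" unfolding T_def terms_over_def using B(1) AB by (rule card_of_trms)
  have LB: "|lists T| \<le>o |B|" using B(1) TB by (rule card_of_lists_bound)
  have lang: "in_lang l \<phi>" and fin: "finite (fv \<phi>)" if "\<phi> \<in> Sub" for \<phi>
    using that in_lang_subfms[of \<phi> _ l] finite_fv_subfms[of \<phi>] \<Sigma> by (auto simp: Sub_def)
  have idxB: "|idx \<phi>| \<le>o |B|" if "\<phi> \<in> Sub" for \<phi>
  proof -
    have "|idx \<phi>| <o l"
      using lang[OF that] infinite_Card_order_finite_less[OF l, of "{undefined}"]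
      by (cases \<phi>) (auto simp: idx_def)
    then show ?thesis by (rule ordLeq_transitive[OF ordLess_imp_ordLeq B(2)])
  qed
  define H0 where "H0 = (\<lambda>t (x :: ('f, 'p, 'i) vtn). x (AEq t t) \<noteq> None) ` T"
  \<comment> \<open>Together with reflexivity this Euclidean law yields symmetry and
    transitivity.\<close>
  define H1 where "H1 = (\<lambda>(r, s, t) (x :: ('f, 'p, 'i) vtn).
    x (AEq r t) \<noteq> None \<longrightarrow> x (AEq s t) \<noteq> None \<longrightarrow> x (AEq r s) \<noteq> None) ` (T \<times> T \<times> T)"
  define HF where "HF = (\<lambda>(h, ss, ts) (x :: ('f, 'p, 'i) vtn).
    list_all2 (\<lambda>s t. x (AEq s t) \<noteq> None) ss ts \<longrightarrow> x (AEq (App h ss) (App h ts)) \<noteq> None) `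
    ((A \<inter> range Inl) \<times> lists T \<times> lists T)"
  define HR where "HR = (\<lambda>(p, ss, ts) (x :: ('f, 'p, 'i) vtn).
    list_all2 (\<lambda>s t. x (AEq s t) \<noteq> None) ss ts \<longrightarrow> x (ARel p ss) \<noteq> None \<longrightarrow> x (ARel p ts) \<noteq> None) `
    (P \<times> lists T \<times> lists T)"
  \<comment> \<open>Lists of terms stand for environments, which keeps the number of conditions
    within \<open>l\<close>; variables outside the list get the default term
    \<open>V0\<close>.\<close>
  define HO where "HO = (\<lambda>((\<phi>, i), us). ok \<phi> i (envl V0 (scope_list \<phi>) us)) ` (Sigma Sub idx \<times> lists T)"
  define HS where "HS = (\<lambda>\<sigma> (x :: ('f, 'p, 'i) vtn). val x \<sigma> (\<lambda>_. V0)) ` \<Sigma>"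
  define H where "H = H0 \<union> H1 \<union> HF \<union> HR \<union> HO \<union> HS"
  have "|A \<inter> range Inl| \<le>o |B|" by (rule ordLeq_transitive[OF card_of_mono1 AB]) simp
  moreover have "|Sigma Sub idx| \<le>o |B|"
    using B(1) SubB idxB by (intro card_of_Sigma_ordLeq_infinite) auto
  ultimately have "|H| \<le>o |B|"
    unfolding H_def H0_def H1_def HF_def HR_def HO_def HS_def
    by (intro card_of_Un_bound[OF B(1)] imB prodB TB LB PB \<Sigma>B)
  then have Hl: "|H| \<le>o l" using B(3) by (rule ordLeq_transitive)
  note small = card_of_vals[OF l]
  have supp: "finitely_supported l vals h" if "h \<in> H" for h
  proof -
    consider t where "h = (\<lambda>x. x (AEq t t) \<noteq> None)"
      | r s t where "h = (\<lambda>x. x (AEq r t) \<noteq> None \<longrightarrow> x (AEq s t) \<noteq> None \<longrightarrow> x (AEq r s) \<noteq> None)"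
      | f ss ts where "h = (\<lambda>x. list_all2 (\<lambda>s t. x (AEq s t) \<noteq> None) ss ts \<longrightarrow> x (AEq (App f ss) (App f ts)) \<noteq> None)"
      | p ss ts where "h = (\<lambda>x. list_all2 (\<lambda>s t. x (AEq s t) \<noteq> None) ss ts \<longrightarrow> x (ARel p ss) \<noteq> None \<longrightarrow> x (ARel p ts) \<noteq> None)"
      | \<phi> i e where "\<phi> \<in> Sub" "i \<in> idx \<phi>" "h = ok \<phi> i e"
      | \<sigma> where "\<sigma> \<in> \<Sigma>" "h = (\<lambda>x. val x \<sigma> (\<lambda>_. V0))"
      using \<open>h \<in> H\<close> unfolding H_def H0_def H1_def HF_def HR_def HO_def HS_def by auto
    then show ?thesis
    proof cases
      case 1
      then show ?thesis by (intro finitely_supportedI[of "{AEq t t}"]) (auto intro: small)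
    next
      case 2
      then show ?thesis
        by (intro finitely_supportedI[of "{AEq r t, AEq s t, AEq r s}"]) (auto intro: small)
    next
      case 3
      let ?F = "insert (AEq (App f ss) (App f ts)) ((\<lambda>(s, t). AEq s t) ` set (zip ss ts))"
      show ?thesis
      proof (rule finitely_supportedI[of ?F])
        fix x y :: "('f, 'p, 'i) vtn" assume xy: "\<forall>j\<in>?F. x j = y j"
        then have "x (AEq s t) = y (AEq s t)" if "(s, t) \<in> set (zip ss ts)" for s t
          using that by force
        then have "list_all2 (\<lambda>s t. x (AEq s t) \<noteq> None) ss ts = list_all2 (\<lambda>s t. y (AEq s t) \<noteq> None) ss ts"
          unfolding list_all2_iff by (intro conj_cong refl ball_cong) auto
        then show "h x \<Longrightarrow> h y" using 3 xy by simp
      qed (auto intro: small)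
    next
      case 4
      let ?F = "{ARel p ss, ARel p ts} \<union> ((\<lambda>(s, t). AEq s t) ` set (zip ss ts))"
      show ?thesis
      proof (rule finitely_supportedI[of ?F])
        fix x y :: "('f, 'p, 'i) vtn" assume xy: "\<forall>j\<in>?F. x j = y j"
        then have "x (AEq s t) = y (AEq s t)" if "(s, t) \<in> set (zip ss ts)" for s t
          using that by force
        then have "list_all2 (\<lambda>s t. x (AEq s t) \<noteq> None) ss ts = list_all2 (\<lambda>s t. y (AEq s t) \<noteq> None) ss ts"
          unfolding list_all2_iff by (intro conj_cong refl ball_cong) auto
        then show "h x \<Longrightarrow> h y" using 4 xy by simp
      qed (auto intro: small)
    next
      case 5
      then show ?thesis
        unfolding finitely_supported_def using ok_support[OF small lang[OF 5(1)] 5(2)] by blast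
    next
      case 6
      then show ?thesis
        using \<Sigma>(1)[OF 6(1)] by (intro finitely_supportedI[of "{afm \<sigma> (\<lambda>_. V0)}"]) (auto intro: small simp: val_def)
    qed
  qed
  have "\<exists>x. (\<forall>a. x a \<in> vals a) \<and> (\<forall>h\<in>H. h x)"
  proof (rule not_mrowka_star_compactness[OF l m Hl])
    show "\<exists>F. finite F \<and> (\<forall>j\<in>F. |vals j| <o l) \<and> (\<forall>x y. (\<forall>j\<in>F. x j = y j) \<longrightarrow> h x \<longrightarrow> h y)"
      if "h \<in> H" for h using supp[OF that] by (simp only: finitely_supported_def)
    fix H' assume H': "H' \<subseteq> H" "|H'| <o l"
    have "H' \<inter> HS \<subseteq> (\<lambda>\<sigma> (x :: ('f, 'p, 'i) vtn). val x \<sigma> (\<lambda>_. V0)) ` \<Sigma>" by (simp add: HS_def)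
    \<comment> \<open>One sentence is picked for each truth condition in \<open>H'\<close>, so that
      \<open>\<Sigma>'\<close> is no larger than \<open>H'\<close>.\<close>
    then obtain \<Sigma>' where \<Sigma>': "\<Sigma>' \<subseteq> \<Sigma>" "inj_on (\<lambda>\<sigma> (x :: ('f, 'p, 'i) vtn). val x \<sigma> (\<lambda>_. V0)) \<Sigma>'"
        "H' \<inter> HS = (\<lambda>\<sigma> (x :: ('f, 'p, 'i) vtn). val x \<sigma> (\<lambda>_. V0)) ` \<Sigma>'"
      unfolding subset_image_inj by blast
    have "|\<Sigma>'| \<le>o |H'|"
      using \<Sigma>'(2,3) unfolding card_of_ordLeq[symmetric] by (metis inf_le1)
    then have "|\<Sigma>'| <o l" using H'(2) by (rule ordLeq_ordLess_trans)
    then have "has_model TYPE('u) \<Sigma>'" using part \<Sigma>'(1) by blast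
    then obtain M :: "('f, 'p, 'u) struct" where M: "is_struct M"
        "\<And>\<sigma> e. \<sigma> \<in> \<Sigma>' \<Longrightarrow> (\<forall>v. e v \<in> universe M) \<Longrightarrow> sat M e \<sigma>"
      unfolding has_model_def by auto
    obtain u where u: "u \<in> universe M" using M(1) unfolding is_struct_def by blast
    define x where "x = (valuation_of M u :: ('f, 'p, 'i) vtn)"
    have eq: "x (AEq s t) \<noteq> None \<longleftrightarrow> ev M u s = ev M u t" for s t by (simp add: x_def valuation_of_def)
    have all2: "map (ev M u) ss = map (ev M u) ts" if "list_all2 (\<lambda>s t. x (AEq s t) \<noteq> None) ss ts" for ss ts
      using that unfolding eq by (simp add: list_all2_conv_all_nth list_eq_iff_nth_eq)
    have "h x" if h: "h \<in> H'" for h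
    proof -
      consider "h \<in> H0" | "h \<in> H1" | "h \<in> HF" | "h \<in> HR" | "h \<in> HO" | "h \<in> H' \<inter> HS"
        using h H'(1) unfolding H_def by blast
      then show ?thesis
      proof cases
        case 1 then show ?thesis unfolding H0_def by (auto simp: x_def valuation_of_def)
      next
        case 2
        then obtain r s t where "h = (\<lambda>x. x (AEq r t) \<noteq> None \<longrightarrow> x (AEq s t) \<noteq> None \<longrightarrow> x (AEq r s) \<noteq> None)"
          unfolding H1_def by auto
        then show ?thesis by (simp add: eq del: not_None_eq)
      next
        case 3
        then obtain f ss ts where "h = (\<lambda>x. list_all2 (\<lambda>s t. x (AEq s t) \<noteq> None) ss ts \<longrightarrow> x (AEq (App f ss) (App f ts)) \<noteq> None)"
          unfolding HF_def by auto
        then show ?thesis using all2[of ss ts] by (simp add: eq del: not_None_eq map_eq_conv)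
      next
        case 4
        then obtain p ss ts where "h = (\<lambda>x. list_all2 (\<lambda>s t. x (AEq s t) \<noteq> None) ss ts \<longrightarrow> x (ARel p ss) \<noteq> None \<longrightarrow> x (ARel p ts) \<noteq> None)"
          unfolding HR_def by auto
        then show ?thesis using all2[of ss ts] by (simp add: x_def valuation_of_def del: map_eq_conv)
      next
        case 5
        then show ?thesis
          unfolding HO_def x_def using ok_valuation_of[OF M(1) u fin] by auto
      next
        case 6
        then obtain \<sigma> where \<sigma>: "\<sigma> \<in> \<Sigma>'" "h = (\<lambda>x. val x \<sigma> (\<lambda>_. V0))" using \<Sigma>'(3) by auto
        have "val x \<sigma> (\<lambda>_. V0) \<longleftrightarrow> sat M (\<lambda>v. ev M u V0) \<sigma>"
          unfolding x_def using \<Sigma>(2) \<Sigma>'(1) \<sigma>(1) by (intro val_valuation_of) auto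
        then show ?thesis using M(2)[OF \<sigma>(1), of "\<lambda>v. ev M u V0"] ev_in_universe[OF M(1) u, of V0] \<sigma>(2) by simp
      qed
    qed
    then show "\<exists>x. (\<forall>a. x a \<in> vals a) \<and> (\<forall>h\<in>H'. h x)"
      using valuation_of_vals by (intro exI[of _ x]) (auto simp: x_def)
  qed
  then obtain x where x: "\<And>a. x a \<in> vals a" "\<And>h. h \<in> H \<Longrightarrow> h x" by blast
  \<comment> \<open>There are at most \<open>l\<close> terms over the symbols that occur, so they
    can be coded in \<open>'i\<close>, where the model of the whole set is wanted.\<close>
  obtain c :: "('f, 'p, 'i) sk \<Rightarrow> 'i" where c: "inj_on c T" using TB by (rule ordLeq_imp_inj)
  have hv: "henkin_valuation x Sub c"
  proof (unfold_locales, unfold A_def[symmetric] T_def[symmetric])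
    show "finite (fv \<phi>)" if "\<phi> \<in> Sub" for \<phi> using fin[OF that] .
    show "subfms \<phi> \<subseteq> Sub" if "\<phi> \<in> Sub" for \<phi> using that subfms_trans unfolding Sub_def by blast
    show "inj_on c T" by (rule c)
    show "x (AEq t t) \<noteq> None" if "t \<in> T" for t
      by (rule x(2)[of "\<lambda>x. x (AEq t t) \<noteq> None"]) (use that in \<open>auto simp: H_def H0_def\<close>)
    show "x (AEq r s) \<noteq> None" if "r \<in> T" "s \<in> T" "t \<in> T" "x (AEq r t) \<noteq> None" "x (AEq s t) \<noteq> None" for r s t
    proof -
      have "(\<lambda>x. x (AEq r t) \<noteq> None \<longrightarrow> x (AEq s t) \<noteq> None \<longrightarrow> x (AEq r s) \<noteq> None) \<in> H1"
        unfolding H1_def using that(1-3) by (intro image_eqI[of _ _ "(r, s, t)"]) auto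
      then show ?thesis using x(2) that(4,5) unfolding H_def by blast
    qed
    show "x (AEq (App (Inl f) ss) (App (Inl f) ts)) \<noteq> None"
      if "Inl f \<in> A" "ss \<in> lists T" "ts \<in> lists T" "list_all2 (\<lambda>s t. x (AEq s t) \<noteq> None) ss ts" for f ss ts
    proof -
      have "(\<lambda>x. list_all2 (\<lambda>s t. x (AEq s t) \<noteq> None) ss ts \<longrightarrow> x (AEq (App (Inl f) ss) (App (Inl f) ts)) \<noteq> None) \<in> HF"
        unfolding HF_def using that(1-3) by (intro image_eqI[of _ _ "(Inl f, ss, ts)"]) auto
      then show ?thesis using x(2) that(4) unfolding H_def by blast
    qed
    show "x (ARel p ts) \<noteq> None"
      if "p \<in> \<Union>(preds ` Sub)" "ss \<in> lists T" "ts \<in> lists T" "list_all2 (\<lambda>s t. x (AEq s t) \<noteq> None) ss ts"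
        "x (ARel p ss) \<noteq> None" for p ss ts
    proof -
      have "(\<lambda>x. list_all2 (\<lambda>s t. x (AEq s t) \<noteq> None) ss ts \<longrightarrow> x (ARel p ss) \<noteq> None \<longrightarrow> x (ARel p ts) \<noteq> None) \<in> HR"
        unfolding HR_def using that(1-3) by (intro image_eqI[of _ _ "(p, ss, ts)"]) (auto simp: P_def)
      then show ?thesis using x(2) that(4,5) unfolding H_def by blast
    qed
    show "ok \<phi> i e x" if "\<phi> \<in> Sub" "i \<in> idx \<phi>" "\<And>v. e v \<in> T" for \<phi> i e
    proof -
      let ?us = "map e (scope_list \<phi>)"
      have "ok \<phi> i (envl V0 (scope_list \<phi>) ?us) \<in> HO"
        unfolding HO_def using that by (intro image_eqI[of _ _ "((\<phi>, i), ?us)"]) auto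
      then have "ok \<phi> i (envl V0 (scope_list \<phi>) ?us) x" using x(2) unfolding H_def by blast
      moreover have "ok \<phi> i (envl V0 (scope_list \<phi>) ?us) x = ok \<phi> i e x"
        using fin[OF that(1)] that(2) by (rule ok_cong) (simp add: envl_map set_scope_list fin[OF that(1)])
      ultimately show ?thesis by simp
    qed
    show "x a \<in> vals a" for a by (rule x(1))
  qed
  show "has_model TYPE('i) \<Sigma>"
  proof (rule henkin_valuation.has_model_sentence[OF hv])
    show "\<Sigma> \<subseteq> Sub" using subfms_refl by (auto simp: Sub_def)
    show "fv \<sigma> = {} \<and> val x \<sigma> (\<lambda>_. Var ())" if "\<sigma> \<in> \<Sigma>" for \<sigma>
      using \<Sigma>(2)[OF that] x(2)[of "\<lambda>x. val x \<sigma> (\<lambda>_. V0)"] that by (auto simp: H_def HS_def V0_def)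
  qed
qed

theorem theorem5p10:
  fixes l :: "'i rel"
  assumes "Card_order l"
    and "l \<le>o ctwo ^c natLeq"
    and "e_separable_product_fails TYPE('a) l"
    and "\<And>k :: 'i rel. Card_order k \<Longrightarrow> k <o l \<Longrightarrow> \<not> e_separable_product_fails TYPE('a) k"
  shows "\<not> mrowka_star l \<and> weakly_compact_lang TYPE('f) TYPE('p) TYPE('u) l"
proof
  show "\<not> mrowka_star l"
    using assms by (rule e_separable_product_fails_minimal(2))
  have "infinite (Field l)"
    using assms by (rule e_separable_product_fails_minimal(1))
  then show "weakly_compact_lang TYPE('f) TYPE('p) TYPE('u) l"
    using assms(1) \<open>\<not> mrowka_star l\<close> by (intro weakly_compact_lang_if_not_mrowka_star)
qed

end
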